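(* Let $\mathbb H$ be a real separable Hilbert space and let $\{u_t\}_{t\in\mathbb Z}$ be a fourth order stationary sequence of zero mean $\mathbb H$-valued random elements such that $\mathcal C(0)\neq0$, $$\sum_{j=-\infty}^\infty\|\mathcal C(j)\|_1^2<\infty\quad\text{and}\quad \sup_{j\in\mathbb Z}\sum_{h=-\infty}^\infty\|\mathcal K_{h+j,h,j}\|_1<\infty,$$ where $\|\cdot\|_1$ is the nuclear norm. Let $k:\mathbb R\to[-1,1]$ be a symmetric function that is continuous at zero and at all but a finite number of points, with $k(0)=1$ and $k(x)=O(x^{-\alpha})$ as $x\to\infty$ for some $\alpha>1/2$. Let $\{p_n\}_{n\ge1}$ be a sequence of positive numbers with $p_n\to\infty$ and $p_n/n\to0$ as $n\to\infty$. Let $$T_n=\frac{2^{-1}n\hat Q_n^2-\hat\sigma_n^4C_n(k)}{\|\hat{\mathcal C}_n(0)\|_2^2\sqrt{2D_n(k)}}.$$ Then $$\frac{p_n^{1/2}}{n}\,T_n\xrightarrow{p}\frac{2^{-1}Q^2}{\|\mathcal C(0)\|_2^2\,(2D(k))^{1/2}}\quad\text{as } n\to\infty,$$ where $D(k)=\int_0^\infty k^4(z)\,dz$ and $Q^2=2\pi\int_{-\pi}^{\pi}\|\mathcal F(\omega)-(2\pi)^{-1}\mathcal C(0)\|_2^2\,d\omega$.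
   Context: For $x,y\in\mathbb H$, $x\otimes y:\mathbb H\to\mathbb H$ is the operator $(x\otimes y)(z)=\langle z,y\rangle x$. $\|\cdot\|_2$ applied to operators is the Hilbert–Schmidt norm; $^*$ denotes the adjoint; $\xrightarrow{p}$ is convergence in probability. Fourth order stationarity: $\operatorname E\|u_t\|^4<\infty$ for all $t$ and, for all $l=1,\dots,4$ and $t_1,\dots,t_l\in\mathbb Z$, $\operatorname E[u_{t_1}\otimes u_{t_2}\otimes\dots\otimes u_{t_l}]=\operatorname E[u_0\otimes u_{t_2-t_1}\otimes\dots\otimes u_{t_l-t_1}]$. Autocovariance operators: $\mathcal C(j)=\operatorname E[u_j\otimes u_0]$, $j\in\mathbb Z$. Spectral density operator: $\mathcal F(\omega)=(2\pi)^{-1}\sum_{j\in\mathbb Z}\mathcal C(j)e^{-\mathbf i j\omega}$, $\omega\in[-\pi,\pi]$, $\mathbf i=\sqrt{-1}$ (operators on the complexification of $\mathbb H$), the series being understood as converging in $L^2$ of $[-\pi,\pi]$ with values in the Hilbert–Schmidt operators; it converges pointwise if $\sum_j\|\mathcal C(j)\|_2<\infty$. Cumulants: for scalar random variables, $\operatorname{cum}(X_1,\dots,X_m)=\sum_\pi(|\pi|-1)!(-1)^{|\pi|-1}\prod_{B\in\pi}\operatorname E[\prod_{i\in B}X_i]$, where $\pi$ runs over all partitions of $\{1,\dots,m\}$, $B$ over the blocks of $\pi$, and $|\pi|$ is the number of blocks. For $t_1,t_2,t_3\in\mathbb Z$, $\mathcal K_{t_1,t_2,t_3}:\mathbb H\otimes\mathbb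 H\to\mathbb H\otimes\mathbb H$ is the fourth order cumulant operator determined by $$\langle\mathcal K_{t_1,t_2,t_3}(f_3\otimes f_4),f_1\otimes f_2\rangle=\operatorname{cum}(\langle u_{t_1},f_1\rangle,\langle u_{t_2},f_2\rangle,\langle u_{t_3},f_3\rangle,\langle u_0,f_4\rangle)$$ for all $f_1,\dots,f_4\in\mathbb H$, where in this formula $\mathbb H\otimes\mathbb H$ is the Hilbert space tensor product. Estimators, based on $u_1,\dots,u_n$: $\hat{\mathcal C}_n(j)=n^{-1}\sum_{t=j+1}^n u_t\otimes u_{t-j}$ for $0\le j<n$ and $\hat{\mathcal C}_n(j)=\hat{\mathcal C}_n^*(-j)$ for $-n<j<0$; $\hat{\mathcal F}_n(\omega)=(2\pi)^{-1}\sum_{|j|<n}k(j/p_n)\hat{\mathcal C}_n(j)e^{-\mathbf i j\omega}$; $\hat Q_n^2=2\pi\int_{-\pi}^\pi\|\hat{\mathcal F}_n(\omega)-(2\pi)^{-1}\hat{\mathcal C}_n(0)\|_2^2\,d\omega$, which equals $2\sum_{j=1}^{n-1}k^2(j/p_n)\|\hat{\mathcal C}_n(j)\|_2^2$; $\hat\sigma_n^2=n^{-1}\sum_{t=1}^n\|u_t\|^2$, $\hat\sigma_n^4=(\hat\sigma_n^2)^2$. $C_n(k)=\sum_{j=1}^{n-1}(1-j/n)k^2(j/p_n)$ and $D_n(k)=\sum_{j=1}^{n-2}(1-j/n)(1-(j+1)/n)k^4(j/p_n)$. ($T_n$ is considered for $n$ large enough that $D_n(k)>0$, and its value on the event that the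 denominator vanishes, whose probability tends to $0$, is immaterial.) *)

theory Defs
  imports "HOL-Probability.Probability"
begin

subsection \<open>Orthonormal bases\<close>

definition orthonormal :: "'a::real_inner set \<Rightarrow> bool"
  where "orthonormal S \<longleftrightarrow> pairwise orthogonal S \<and> (\<forall>e\<in>S. norm e = 1)"

definition orthonormal_basis :: "'a::real_inner set \<Rightarrow> bool"
  where "orthonormal_basis S \<longleftrightarrow> orthonormal S \<and> closure (span S) = UNIV"

lemma orthonormal_inner:
  "orthonormal S \<Longrightarrow> e \<in> S \<Longrightarrow> f \<in> S \<Longrightarrow> e \<bullet> f = (if e = f then 1 else 0)"
  by (auto simp: orthonormal_def pairwise_def orthogonal_def norm_eq_1)

lemma orthonormal_sum_inner:
  assumes "orthonormal S" "finite F" "F \<subseteq> S" "f \<in> S"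
  shows "(\<Sum>e\<in>F. c e *\<^sub>R e) \<bullet> f = (if f \<in> F then c f else 0)"
proof -
  have "(\<Sum>e\<in>F. c e *\<^sub>R e) \<bullet> f = (\<Sum>e\<in>F. if e = f then c e else 0)"
    unfolding inner_sum_left
    using assms by (intro sum.cong) (auto simp: orthonormal_inner[OF assms(1)] subset_iff)
  then show ?thesis using assms(2) by simp
qed

lemma orthonormal_sum_norm:
  assumes "orthonormal S" "finite F" "F \<subseteq> S"
  shows "(norm (\<Sum>e\<in>F. c e *\<^sub>R e))\<^sup>2 = (\<Sum>e\<in>F. (c e)\<^sup>2)"
proof -
  have "(norm (\<Sum>e\<in>F. c e *\<^sub>R e))\<^sup>2 = (\<Sum>f\<in>F. c f * ((\<Sum>e\<in>F. c e *\<^sub>R e) \<bullet> f))"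
    unfolding power2_norm_eq_inner by (subst inner_sum_right) simp
  also have "\<dots> = (\<Sum>f\<in>F. (c f)\<^sup>2)"
    using assms by (intro sum.cong refl) (subst orthonormal_sum_inner[OF assms], auto simp: power2_eq_square)
  finally show ?thesis .
qed

lemma bessel_finite:
  assumes "orthonormal S" "finite F" "F \<subseteq> S"
  shows "(\<Sum>e\<in>F. (x \<bullet> e)\<^sup>2) \<le> (norm x)\<^sup>2"
proof -
  let ?y = "\<Sum>e\<in>F. (x \<bullet> e) *\<^sub>R e"
  have xy: "x \<bullet> ?y = (\<Sum>e\<in>F. (x \<bullet> e)\<^sup>2)"
    by (simp add: inner_sum_right power2_eq_square)
  have "0 \<le> (norm (x - ?y))\<^sup>2" by simp
  also have "\<dots> = (norm x)\<^sup>2 - 2 * (x \<bullet> ?y) + (norm ?y)\<^sup>2"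
    unfolding power2_norm_eq_inner by (simp add: inner_diff_left inner_diff_right inner_commute)
  also have "\<dots> = (norm x)\<^sup>2 - (\<Sum>e\<in>F. (x \<bullet> e)\<^sup>2)"
    using xy orthonormal_sum_norm[OF assms, of "\<lambda>e. x \<bullet> e"] by simp
  finally show ?thesis by simp
qed

lemma bessel_summable:
  assumes "orthonormal S"
  shows "(\<lambda>e. (x \<bullet> e)\<^sup>2) summable_on S"
  by (rule nonneg_bdd_above_summable_on) (auto intro!: bdd_aboveI2 bessel_finite[OF assms])

lemma orthonormal_summable:
  fixes S :: "'a::{real_inner,banach} set"
  assumes S: "orthonormal S" and c: "(\<lambda>e. (c e)\<^sup>2) summable_on S"
  shows "(\<lambda>e. c e *\<^sub>R e) summable_on S"
proof -
  define f where "f = (\<lambda>e. c e *\<^sub>R e)"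
  define g where "g = (\<lambda>e. (c e)\<^sup>2)"
  obtain L where L: "(g has_sum L) S" using c by (auto simp: summable_on_def g_def)
  have *: "\<exists>P. eventually P (finite_subsets_at_top S) \<and>
              (\<forall>F F'. P F \<and> P F' \<longrightarrow> dist (sum f F) (sum f F') < \<epsilon>)" if "\<epsilon> > 0" for \<epsilon>
  proof -
    define d where "d = (\<epsilon>/2)\<^sup>2"
    have d: "d > 0" using that by (simp add: d_def)
    have "eventually (\<lambda>F. dist (sum g F) L < d/2) (finite_subsets_at_top S)"
      using L d unfolding has_sum_def tendsto_iff by (metis half_gt_zero)
    then obtain G where G: "finite G" "G \<subseteq> S"
      and GF: "\<And>F. finite F \<Longrightarrow> G \<subseteq> F \<Longrightarrow> F \<subseteq> S \<Longrightarrow> dist (sum g F) L < d/2"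
      by (auto simp: eventually_finite_subsets_at_top)
    define P where "P = (\<lambda>F. finite F \<and> G \<subseteq> F \<and> F \<subseteq> S)"
    have evP: "eventually P (finite_subsets_at_top S)"
      unfolding P_def eventually_finite_subsets_at_top using G by auto
    have near: "dist (sum f F) (sum f G) < \<epsilon>/2" if "P F" for F
    proof -
      from that have F: "finite F" "G \<subseteq> F" "F \<subseteq> S" by (auto simp: P_def)
      have "(norm (sum f F - sum f G))\<^sup>2 = (norm (sum f (F - G)))\<^sup>2"
        using F G by (simp add: sum_diff)
      also have "\<dots> = sum g (F - G)"
        unfolding f_def g_def using F by (intro orthonormal_sum_norm[OF S]) auto
      also have "\<dots> = sum g F - sum g G" using F G by (simp add: sum_diff)
      also have "\<dots> < d" using GF[OF F] GF[OF G(1) order_refl G(2)]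
        unfolding dist_real_def by linarith
      finally have "(norm (sum f F - sum f G))\<^sup>2 < (\<epsilon>/2)\<^sup>2" by (simp add: d_def)
      then have "norm (sum f F - sum f G) < \<epsilon>/2"
        using \<open>\<epsilon> > 0\<close> by (intro power2_less_imp_less[of _ "\<epsilon>/2"]) auto
      then show ?thesis by (simp add: dist_norm)
    qed
    have "dist (sum f F) (sum f F') < \<epsilon>" if "P F" "P F'" for F F'
      using near[OF that(1)] near[OF that(2)] dist_triangle2[of "sum f F" "sum f F'" "sum f G"] by simp
    with evP show ?thesis by blast
  qed
  then have "cauchy_filter (filtermap (sum f) (finite_subsets_at_top S))"
    by (simp add: cauchy_filter_metric_filtermap)
  moreover have "uniform_space_class.complete (UNIV::'a set)"
    by (meson Cauchy_convergent UNIV_I complete_def convergent_def)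
  ultimately obtain L' where "(sum f \<longlongrightarrow> L') (finite_subsets_at_top S)"
    using complete_uniform[where S="UNIV::'a set"] by (force simp add: filterlim_def)
  then show ?thesis
    using summable_on_def has_sum_def unfolding f_def by blast
qed

lemma orthonormal_basis_total:
  assumes "orthonormal_basis S" "\<And>e. e \<in> S \<Longrightarrow> x \<bullet> e = 0"
  shows "x = 0"
proof -
  have "S \<subseteq> {y. x \<bullet> y = 0}" using assms(2) by auto
  moreover have "subspace {y. x \<bullet> y = 0}" by (auto simp: subspace_def inner_add_right)
  ultimately have "span S \<subseteq> {y. x \<bullet> y = 0}" by (rule span_minimal)
  moreover have "closed {y. x \<bullet> y = 0}" by (rule closed_hyperplane)
  ultimately have "closure (span S) \<subseteq> {y. x \<bullet> y = 0}" by (rule closure_minimal)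
  then have "x \<in> {y. x \<bullet> y = 0}" using assms(1) unfolding orthonormal_basis_def by blast
  then have "x \<bullet> x = 0" by simp
  then show ?thesis by simp
qed

lemma orthonormal_expansion:
  fixes S :: "'a::{real_inner,banach} set"
  assumes S: "orthonormal S" and total: "\<And>y. (\<And>e. e \<in> S \<Longrightarrow> y \<bullet> e = 0) \<Longrightarrow> y = 0"
  shows "((\<lambda>e. (x \<bullet> e) *\<^sub>R e) has_sum x) S"
proof -
  obtain y where y: "((\<lambda>e. (x \<bullet> e) *\<^sub>R e) has_sum y) S"
    using orthonormal_summable[OF S bessel_summable[OF S]] by (auto simp: summable_on_def)
  have "(x - y) \<bullet> f = 0" if "f \<in> S" for f
  proof -
    have "((\<lambda>e. ((x \<bullet> e) *\<^sub>R e) \<bullet> f) has_sum (y \<bullet> f)) S"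
      using has_sum_bounded_linear[OF bounded_linear_inner_left y] .
    moreover have "((\<lambda>e. ((x \<bullet> e) *\<^sub>R e) \<bullet> f) has_sum (x \<bullet> f)) S"
    proof -
      have "((\<lambda>e. ((x \<bullet> e) *\<^sub>R e) \<bullet> f) has_sum (x \<bullet> f)) {f}"
        using orthonormal_inner[OF S that that] by (intro has_sum_finiteI) auto
      then show ?thesis
        by (rule has_sum_cong_neutral[THEN iffD1, rotated -1])
           (use that S in \<open>auto simp: orthonormal_inner[OF S]\<close>)
    qed
    ultimately show ?thesis using has_sum_unique by (fastforce simp: inner_diff_left)
  qed
  then have "x - y = 0" by (rule total)
  then show ?thesis using y by simp
qed

lemma orthonormal_basis_expansion:
  fixes S :: "'a::{real_inner,banach} set"
  assumes "orthonormal_basis S"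
  shows "((\<lambda>e. (x \<bullet> e) *\<^sub>R e) has_sum x) S"
  using assms orthonormal_basis_total[OF assms]
  by (intro orthonormal_expansion) (auto simp: orthonormal_basis_def)

lemma parseval:
  fixes S :: "'a::{real_inner,banach} set"
  assumes "orthonormal_basis S"
  shows "((\<lambda>e. (x \<bullet> e)\<^sup>2) has_sum (norm x)\<^sup>2) S"
  using has_sum_bounded_linear[OF bounded_linear_inner_right[of x] orthonormal_basis_expansion[OF assms, of x]]
  unfolding power2_norm_eq_inner by (simp add: power2_eq_square)

lemma orthonormal_total_basis:
  fixes S :: "'a::{real_inner,banach} set"
  assumes M: "orthonormal S" and total: "\<And>y. (\<And>e. e \<in> S \<Longrightarrow> y \<bullet> e = 0) \<Longrightarrow> y = 0"
  shows "orthonormal_basis S"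
proof -
  have "x \<in> closure (span S)" for x
  proof -
    have "(sum (\<lambda>e. (x \<bullet> e) *\<^sub>R e) \<longlongrightarrow> x) (finite_subsets_at_top S)"
      using orthonormal_expansion[OF M total] by (simp add: has_sum_def)
    moreover have "eventually (\<lambda>F. sum (\<lambda>e. (x \<bullet> e) *\<^sub>R e) F \<in> closure (span S)) (finite_subsets_at_top S)"
      by (rule eventually_finite_subsets_at_top_weakI)
         (rule subsetD[OF closure_subset], rule span_sum, rule span_scale, rule span_base, blast)
    ultimately show ?thesis
      by (intro Lim_in_closed_set[of "closure (span S)"]) auto
  qed
  with M show ?thesis by (auto simp: orthonormal_basis_def)
qed

lemma orthonormal_basis_exists: "\<exists>S::'a::{real_inner,banach} set. orthonormal_basis S"
proof -
  let ?A = "{S::'a set. orthonormal S}"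
  have "\<exists>M\<in>?A. \<forall>X\<in>?A. M \<subseteq> X \<longrightarrow> X = M"
  proof (rule subset_Zorn')
    fix C assume C: "subset.chain ?A C"
    then have C1: "\<And>S. S \<in> C \<Longrightarrow> orthonormal S"
      and C2: "\<And>S T. S \<in> C \<Longrightarrow> T \<in> C \<Longrightarrow> S \<subseteq> T \<or> T \<subseteq> S"
      by (auto simp: subset_chain_def)
    have "e \<bullet> f = 0" if "e \<in> \<Union>C" "f \<in> \<Union>C" "e \<noteq> f" for e f
    proof -
      obtain S T where "S \<in> C" "e \<in> S" "T \<in> C" "f \<in> T" using \<open>e \<in> \<Union>C\<close> \<open>f \<in> \<Union>C\<close> by auto
      then obtain R where "R \<in> C" "e \<in> R" "f \<in> R" using C2[of S T] by auto
      then show ?thesis using orthonormal_inner[OF C1] \<open>e \<noteq> f\<close> by auto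
    qed
    then show "\<Union>C \<in> ?A"
      using C1 by (auto simp: orthonormal_def pairwise_def orthogonal_def)
  qed
  then obtain M :: "'a set" where M: "orthonormal M" and max: "\<And>X. orthonormal X \<Longrightarrow> M \<subseteq> X \<Longrightarrow> X = M" by blast
  have total: "y = 0" if y: "\<And>e. e \<in> M \<Longrightarrow> y \<bullet> e = 0" for y
  proof (rule ccontr)
    assume "y \<noteq> 0"
    define z where "z = y /\<^sub>R norm y"
    have nz: "norm z = 1" using \<open>y \<noteq> 0\<close> by (simp add: z_def)
    have "orthonormal (insert z M)"
      using M y nz by (auto simp: orthonormal_def pairwise_insert orthogonal_def z_def inner_commute)
    then have "z \<in> M" using max by blast
    then have "y \<bullet> z = 0" by (rule y)
    then have "z \<bullet> z = 0" by (simp add: z_def)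
    then show False using nz by simp
  qed
  show ?thesis using orthonormal_total_basis[OF M total] by blast
qed

definition onb :: "'a::{real_inner,banach} set"
  where "onb = (SOME S. orthonormal_basis S)"

lemma onb: "orthonormal_basis onb"
  unfolding onb_def by (rule someI_ex[OF orthonormal_basis_exists])

lemma onb_orthonormal: "orthonormal (onb::'a::{real_inner,banach} set)"
  using onb[where 'a='a] by (simp add: orthonormal_basis_def)


subsection \<open>Hilbert--Schmidt operators\<close>

text \<open>
  The norm of the type below is the Hilbert--Schmidt norm. It is defined through a fixed orthonormal
  basis, but does not depend on it, see \<open>hs_norm_has_sum_basis\<close>.
\<close>

typedef (overloaded) ('a::"{real_inner,banach}", 'b::"{real_inner,banach}") hs =
  "{A :: 'a \<Rightarrow>\<^sub>L 'b. (\<lambda>e. (norm (blinfun_apply A e))\<^sup>2) summable_on onb}"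
  morphisms hs_blinfun Abs_hs
  by (rule exI[of _ 0]) simp

setup_lifting type_definition_hs

abbreviation hs_apply :: "('a::{real_inner,banach}, 'b::{real_inner,banach}) hs \<Rightarrow> 'a \<Rightarrow> 'b"
  where "hs_apply A \<equiv> blinfun_apply (hs_blinfun A)"

lemma hs_summable: "(\<lambda>e. (norm (hs_apply A e))\<^sup>2) summable_on onb"
  using hs_blinfun[of A] by simp

lemma hs_eqI: "(\<And>x. hs_apply A x = hs_apply B x) \<Longrightarrow> A = B"
  by (metis blinfun_eqI hs_blinfun_inject)

lemma summable_on_norm_add:
  fixes f g :: "'c \<Rightarrow> 'b::real_inner"
  assumes "(\<lambda>e. (norm (f e))\<^sup>2) summable_on S" "(\<lambda>e. (norm (g e))\<^sup>2) summable_on S"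
  shows "(\<lambda>e. (norm (f e + g e))\<^sup>2) summable_on S"
proof -
  have le: "(norm (f e + g e))\<^sup>2 \<le> 2 * (norm (f e))\<^sup>2 + 2 * (norm (g e))\<^sup>2" for e
  proof -
    have "0 \<le> (norm (f e - g e))\<^sup>2" by simp
    then show ?thesis
      unfolding power2_norm_eq_inner
      by (simp add: inner_add_left inner_add_right inner_diff_left inner_diff_right inner_commute)
  qed
  have "(\<lambda>e. 2 * (norm (f e))\<^sup>2 + 2 * (norm (g e))\<^sup>2) summable_on S"
    by (intro summable_on_add summable_on_cmult_right assms)
  then have "(\<lambda>e. norm ((norm (f e + g e))\<^sup>2)) summable_on S"
    by (rule Infinite_Sum.abs_summable_on_comparison_test') (use le in auto)
  then show ?thesis by simp
qed

lemma summable_on_inner: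
  fixes f g :: "'c \<Rightarrow> 'b::real_inner"
  assumes "(\<lambda>e. (norm (f e))\<^sup>2) summable_on S" "(\<lambda>e. (norm (g e))\<^sup>2) summable_on S"
  shows "(\<lambda>e. f e \<bullet> g e) summable_on S"
proof -
  have le: "\<bar>f e \<bullet> g e\<bar> \<le> (norm (f e))\<^sup>2 + (norm (g e))\<^sup>2" for e
  proof -
    have "\<bar>f e \<bullet> g e\<bar> \<le> norm (f e) * norm (g e)" by (rule Cauchy_Schwarz_ineq2)
    also have "\<dots> \<le> (norm (f e))\<^sup>2 + (norm (g e))\<^sup>2"
    proof -
      have "0 \<le> norm (f e) * norm (g e)" by simp
      then show ?thesis using sum_squares_bound[of "norm (f e)" "norm (g e)"] by linarith
    qed
    finally show ?thesis .
  qed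
  have "(\<lambda>e. (norm (f e))\<^sup>2 + (norm (g e))\<^sup>2) summable_on S"
    by (intro summable_on_add assms)
  then have "(\<lambda>e. norm (f e \<bullet> g e)) summable_on S"
    by (rule Infinite_Sum.abs_summable_on_comparison_test') (unfold real_norm_def, rule le)
  then show ?thesis using summable_on_iff_abs_summable_on_real by blast
qed

lemma blinfun_hs_bound:
  fixes A :: "'a::{real_inner,banach} \<Rightarrow>\<^sub>L 'b::real_inner"
  assumes S: "orthonormal_basis S" and A: "((\<lambda>e. (norm (A e))\<^sup>2) has_sum s) S"
  shows "norm (A x) \<le> sqrt s * norm x"
proof -
  have "((\<lambda>e. A ((x \<bullet> e) *\<^sub>R e)) has_sum A x) S"
    by (rule has_sum_bounded_linear[OF blinfun.bounded_linear_right orthonormal_basis_expansion[OF S]])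
  then have lim: "(sum (\<lambda>e. (x \<bullet> e) *\<^sub>R A e) \<longlongrightarrow> A x) (finite_subsets_at_top S)"
    by (simp add: has_sum_def blinfun.scaleR_right)
  have bound: "norm (\<Sum>e\<in>F. (x \<bullet> e) *\<^sub>R A e) \<le> sqrt s * norm x" if F: "finite F" "F \<subseteq> S" for F
  proof -
    have "norm (\<Sum>e\<in>F. (x \<bullet> e) *\<^sub>R A e) \<le> (\<Sum>e\<in>F. \<bar>x \<bullet> e\<bar> * \<bar>norm (A e)\<bar>)"
      by (rule order_trans[OF norm_sum]) simp
    also have "\<dots> \<le> L2_set (\<lambda>e. x \<bullet> e) F * L2_set (\<lambda>e. norm (A e)) F"
      by (rule L2_set_mult_ineq)
    also have "\<dots> \<le> norm x * sqrt s"
    proof (rule mult_mono)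
      show "L2_set (\<lambda>e. x \<bullet> e) F \<le> norm x"
        unfolding L2_set_def using bessel_finite[of S F x] S F
        by (intro real_le_lsqrt) (auto simp: orthonormal_basis_def intro: sum_nonneg)
      show "L2_set (\<lambda>e. norm (A e)) F \<le> sqrt s"
        unfolding L2_set_def
        using finite_sum_le_has_sum[OF A F(1) F(2)] by simp
    qed (auto simp: L2_set_nonneg)
    finally show ?thesis by (simp add: mult.commute)
  qed
  show ?thesis
    by (rule tendsto_upperbound[OF tendsto_norm[OF lim]])
       (auto intro!: eventually_finite_subsets_at_top_weakI bound)
qed

instantiation hs :: ("{real_inner,banach}", "{real_inner,banach}") real_vector
begin

lift_definition zero_hs :: "('a, 'b) hs" is 0 by simp
lift_definition plus_hs :: "('a, 'b) hs \<Rightarrow> ('a, 'b) hs \<Rightarrow> ('a, 'b) hs" is "(+)"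
  by (simp add: blinfun.add_left summable_on_norm_add)
lift_definition uminus_hs :: "('a, 'b) hs \<Rightarrow> ('a, 'b) hs" is uminus
  by (simp add: blinfun.minus_left)
lift_definition minus_hs :: "('a, 'b) hs \<Rightarrow> ('a, 'b) hs \<Rightarrow> ('a, 'b) hs" is "(-)"
proof -
  fix A B :: "'a \<Rightarrow>\<^sub>L 'b"
  assume "(\<lambda>e. (norm (A e))\<^sup>2) summable_on onb" "(\<lambda>e. (norm (B e))\<^sup>2) summable_on onb"
  then show "(\<lambda>e. (norm ((A - B) e))\<^sup>2) summable_on onb"
    using summable_on_norm_add[of A onb "\<lambda>e. - B e"] by (simp add: blinfun.diff_left)
qed
lift_definition scaleR_hs :: "real \<Rightarrow> ('a, 'b) hs \<Rightarrow> ('a, 'b) hs" is scaleR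
  by (simp add: blinfun.scaleR_left power_mult_distrib summable_on_cmult_right)

instance
  by standard (transfer, simp add: algebra_simps)+

end

lemma hs_apply_simps [simp]:
  "hs_apply 0 x = 0"
  "hs_apply (A + B) x = hs_apply A x + hs_apply B x"
  "hs_apply (A - B) x = hs_apply A x - hs_apply B x"
  "hs_apply (- A) x = - hs_apply A x"
  "hs_apply (c *\<^sub>R A) x = c *\<^sub>R hs_apply A x"
  by (simp_all add: zero_hs.rep_eq plus_hs.rep_eq minus_hs.rep_eq uminus_hs.rep_eq scaleR_hs.rep_eq
      blinfun.bilinear_simps)

instantiation hs :: ("{real_inner,banach}", "{real_inner,banach}") real_inner
begin

definition inner_hs :: "('a, 'b) hs \<Rightarrow> ('a, 'b) hs \<Rightarrow> real"
  where "inner_hs A B = (\<Sum>\<^sub>\<infinity>e\<in>onb. hs_apply A e \<bullet> hs_apply B e)"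
definition norm_hs :: "('a, 'b) hs \<Rightarrow> real"
  where "norm_hs A = sqrt (\<Sum>\<^sub>\<infinity>e\<in>onb. (norm (hs_apply A e))\<^sup>2)"
definition dist_hs :: "('a, 'b) hs \<Rightarrow> ('a, 'b) hs \<Rightarrow> real"
  where "dist_hs A B = norm (A - B)"
definition sgn_hs :: "('a, 'b) hs \<Rightarrow> ('a, 'b) hs"
  where "sgn_hs A = A /\<^sub>R norm A"
definition uniformity_hs :: "(('a, 'b) hs \<times> ('a, 'b) hs) filter"
  where "uniformity_hs = (INF e\<in>{0 <..}. principal {(x, y). dist x y < e})"
definition open_hs :: "('a, 'b) hs set \<Rightarrow> bool"
  where "open_hs S = (\<forall>x\<in>S. \<forall>\<^sub>F (x', y) in uniformity. x' = x \<longrightarrow> y \<in> S)"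

instance
proof
  fix A B C :: "('a, 'b) hs" and r :: real and U :: "('a, 'b) hs set"
  have s: "(\<lambda>e. hs_apply A e \<bullet> hs_apply B e) summable_on onb" for A B :: "('a, 'b) hs"
    by (intro summable_on_inner hs_summable)
  show "dist A B = norm (A - B)" by (rule dist_hs_def)
  show "sgn A = A /\<^sub>R norm A" by (rule sgn_hs_def)
  show "(uniformity :: (('a, 'b) hs \<times> ('a, 'b) hs) filter) = (INF e\<in>{0 <..}. principal {(x, y). dist x y < e})"
    by (rule uniformity_hs_def)
  show "open U = (\<forall>x\<in>U. \<forall>\<^sub>F (x', y) in uniformity. x' = x \<longrightarrow> y \<in> U)" by (rule open_hs_def)
  show "A \<bullet> B = B \<bullet> A" by (simp add: inner_hs_def inner_commute)
  show "(A + B) \<bullet> C = A \<bullet> C + B \<bullet> C"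
    by (simp add: inner_hs_def inner_add_left infsum_add s)
  show "r *\<^sub>R A \<bullet> B = r * (A \<bullet> B)"
    by (simp add: inner_hs_def infsum_cmult_right s)
  show nonneg: "0 \<le> A \<bullet> A" by (simp add: inner_hs_def infsum_nonneg)
  show "norm A = sqrt (A \<bullet> A)" by (simp add: inner_hs_def norm_hs_def power2_norm_eq_inner)
  show "(A \<bullet> A = 0) = (A = 0)"
  proof
    assume "A \<bullet> A = 0"
    then have "((\<lambda>e. (norm (hs_apply A e))\<^sup>2) has_sum 0) onb"
      using s[of A A] by (simp add: has_sum_iff inner_hs_def power2_norm_eq_inner)
    from blinfun_hs_bound[OF onb this] show "A = 0"
      by (intro hs_eqI) simp
  next
    assume "A = 0"
    then show "A \<bullet> A = 0"
      by (simp only: inner_hs_def hs_apply_simps inner_zero_left infsum_0_simp)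
  qed
qed

end

lemma hs_norm_has_sum: "((\<lambda>e. (norm (hs_apply A e))\<^sup>2) has_sum (norm A)\<^sup>2) onb"
proof -
  have "(norm A)\<^sup>2 = (\<Sum>\<^sub>\<infinity>e\<in>onb. (norm (hs_apply A e))\<^sup>2)"
    unfolding norm_hs_def by (rule real_sqrt_pow2) (rule infsum_nonneg, simp)
  then show ?thesis using has_sum_infsum[OF hs_summable[of A]] by simp
qed

lemma norm_hs_apply: "norm (hs_apply A x) \<le> norm A * norm x"
  using blinfun_hs_bound[OF onb hs_norm_has_sum, of A x] by simp

lemma norm_hs_blinfun: "norm (hs_blinfun A) \<le> norm A"
  by (rule norm_blinfun_bound) (auto simp: norm_hs_apply)

lemma bounded_linear_hs_blinfun: "bounded_linear hs_blinfun"
proof (rule bounded_linear_intro[where K=1])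
  show "norm (hs_blinfun A) \<le> norm A * 1" for A :: "('a, 'b) hs"
    using norm_hs_blinfun[of A] by simp
qed (simp_all only: plus_hs.rep_eq scaleR_hs.rep_eq)

instance hs :: ("{real_inner,banach}", "{real_inner,banach}") banach
proof
  fix X :: "nat \<Rightarrow> ('a, 'b) hs"
  assume X: "Cauchy X"
  have "Cauchy (\<lambda>n. hs_blinfun (X n))"
    by (rule bounded_linear.Cauchy[OF bounded_linear_hs_blinfun X])
  then obtain L where L: "(\<lambda>n. hs_blinfun (X n)) \<longlonglongrightarrow> L"
    using Cauchy_convergent[of "\<lambda>n. hs_blinfun (X n)"] unfolding convergent_def by auto
  have Le: "(\<lambda>n. hs_apply (X n) e) \<longlonglongrightarrow> L e" for e
    by (rule blinfun.tendsto[OF L tendsto_const])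
  have key: "\<exists>N. \<forall>m\<ge>N. \<forall>F. finite F \<and> F \<subseteq> onb \<longrightarrow>
      (\<Sum>e\<in>F. (norm (hs_apply (X m) e - L e))\<^sup>2) \<le> \<epsilon>\<^sup>2" if \<epsilon>: "\<epsilon> > 0" for \<epsilon>
  proof -
    obtain N where N: "\<And>m n. m \<ge> N \<Longrightarrow> n \<ge> N \<Longrightarrow> norm (X m - X n) < \<epsilon>"
      using X \<epsilon> unfolding Cauchy_iff by blast
    have "(\<Sum>e\<in>F. (norm (hs_apply (X m) e - L e))\<^sup>2) \<le> \<epsilon>\<^sup>2"
      if m: "m \<ge> N" and F: "finite F" "F \<subseteq> onb" for m F
    proof (rule tendsto_upperbound)
      show "(\<lambda>n. \<Sum>e\<in>F. (norm (hs_apply (X m) e - hs_apply (X n) e))\<^sup>2) \<longlonglongrightarrow>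
          (\<Sum>e\<in>F. (norm (hs_apply (X m) e - L e))\<^sup>2)"
        by (intro tendsto_sum tendsto_power tendsto_norm tendsto_diff tendsto_const Le)
      have "(\<Sum>e\<in>F. (norm (hs_apply (X m) e - hs_apply (X n) e))\<^sup>2) \<le> \<epsilon>\<^sup>2" if "n \<ge> N" for n
      proof -
        have "(\<Sum>e\<in>F. (norm (hs_apply (X m) e - hs_apply (X n) e))\<^sup>2) \<le> (norm (X m - X n))\<^sup>2"
          using finite_sum_le_has_sum[OF hs_norm_has_sum[of "X m - X n"] F(1) F(2)] by simp
        also have "\<dots> \<le> \<epsilon>\<^sup>2"
          using N[OF m that] by (intro power_mono) auto
        finally show ?thesis .
      qed
      then show "\<forall>\<^sub>F n in sequentially. (\<Sum>e\<in>F. (norm (hs_apply (X m) e - hs_apply (X n) e))\<^sup>2) \<le> \<epsilon>\<^sup>2"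
        by (auto simp: eventually_sequentially)
    qed simp
    then show ?thesis by blast
  qed
  have summ: "(\<lambda>e. (norm ((hs_blinfun (X m) - L) e))\<^sup>2) summable_on onb"
    if "\<forall>F. finite F \<and> F \<subseteq> onb \<longrightarrow> (\<Sum>e\<in>F. (norm (hs_apply (X m) e - L e))\<^sup>2) \<le> c" for m c
    using that by (intro nonneg_bdd_above_summable_on) (auto simp: blinfun.diff_left intro!: bdd_aboveI2)
  obtain m0 where "\<forall>F. finite F \<and> F \<subseteq> onb \<longrightarrow> (\<Sum>e\<in>F. (norm (hs_apply (X m0) e - L e))\<^sup>2) \<le> 1\<^sup>2"
    using key[of 1] by auto
  then have "(\<lambda>e. (norm ((hs_blinfun (X m0) - L) e))\<^sup>2) summable_on onb"
    by (rule summ)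
  then have "(\<lambda>e. (norm (hs_apply (X m0) e + - ((hs_blinfun (X m0) - L) e)))\<^sup>2) summable_on onb"
    by (intro summable_on_norm_add hs_summable) simp
  then have "(\<lambda>e. (norm (L e))\<^sup>2) summable_on onb"
    by (simp add: blinfun.diff_left)
  then obtain Z where Z: "hs_blinfun Z = L"
    using Abs_hs_inverse[of L] by (metis mem_Collect_eq)
  have "X \<longlonglongrightarrow> Z"
  proof (rule LIMSEQ_I)
    fix r :: real assume r: "0 < r"
    obtain N where N: "\<forall>m\<ge>N. \<forall>F. finite F \<and> F \<subseteq> onb \<longrightarrow>
      (\<Sum>e\<in>F. (norm (hs_apply (X m) e - L e))\<^sup>2) \<le> (r/2)\<^sup>2" using key[of "r/2"] r by auto
    have "norm (X m - Z) < r" if "m \<ge> N" for m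
    proof -
      have "(norm (X m - Z))\<^sup>2 \<le> (r/2)\<^sup>2"
      proof (rule has_sum_le_finite_sums[OF hs_norm_has_sum])
        fix F :: "'a set" assume "finite F" "F \<subseteq> onb"
        then show "(\<Sum>e\<in>F. (norm (hs_apply (X m - Z) e))\<^sup>2) \<le> (r/2)\<^sup>2"
          using N that by (simp add: Z)
      qed
      then have "norm (X m - Z) \<le> r/2" using r by (auto intro: power2_le_imp_le[of "norm (X m - Z)" "r/2"])
      then show ?thesis using r by simp
    qed
    then show "\<exists>no. \<forall>n\<ge>no. norm (X n - Z) < r" by blast
  qed
  then show "convergent X" by (auto simp: convergent_def)
qed

lemma summable_inner_sq:
  assumes "orthonormal S" shows "(\<lambda>e. (norm ((e \<bullet> y) *\<^sub>R x))\<^sup>2) summable_on S"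
proof -
  have "(\<lambda>e. (y \<bullet> e)\<^sup>2 * (norm x)\<^sup>2) summable_on S"
    by (rule summable_on_cmult_left[OF bessel_summable[OF assms]])
  then show ?thesis by (simp add: power_mult_distrib inner_commute)
qed

lemma bounded_linear_tensor: "bounded_linear (\<lambda>z. (z \<bullet> y) *\<^sub>R x)"
  by (rule bounded_linear_compose[OF bounded_linear_scaleR_left bounded_linear_inner_left])

text \<open>
  The rank one operator \<open>z \<mapsto> \<langle>z, y\<rangle> x\<close>. The space of Hilbert--Schmidt operators from \<open>'a\<close> to \<open>'b\<close> is
  a realization of the Hilbert space tensor product of \<open>'b\<close> and \<open>'a\<close>, so iterating the operation,
  which associates to the left, gives tensors of higher order.
\<close>

lift_definition tensor ::
    "'b::{real_inner,banach} \<Rightarrow> 'a::{real_inner,banach} \<Rightarrow> ('a, 'b) hs" (infixl "\<otimes>\<^sub>H" 75)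
  is "\<lambda>x y. Blinfun (\<lambda>z. (z \<bullet> y) *\<^sub>R x)"
  by (simp only: bounded_linear_Blinfun_apply[OF bounded_linear_tensor]
      summable_inner_sq[OF onb_orthonormal])

lemma tensor_apply [simp]: "hs_apply (x \<otimes>\<^sub>H y) z = (z \<bullet> y) *\<^sub>R x"
  by (simp only: tensor.rep_eq bounded_linear_Blinfun_apply[OF bounded_linear_tensor])

lemma inner_tensor: "A \<bullet> (x \<otimes>\<^sub>H y) = hs_apply A y \<bullet> x"
proof -
  have "bounded_linear (\<lambda>z. hs_apply A z \<bullet> x)"
    by (rule bounded_linear_compose[OF bounded_linear_inner_left blinfun.bounded_linear_right])
  from has_sum_bounded_linear[OF this orthonormal_basis_expansion[OF onb, of y]]
  have "((\<lambda>e. hs_apply A e \<bullet> hs_apply (x \<otimes>\<^sub>H y) e) has_sum (hs_apply A y \<bullet> x)) onb"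
    by (simp add: blinfun.scaleR_right inner_commute mult.commute)
  then show ?thesis unfolding inner_hs_def by (rule infsumI)
qed

lemma tensor_inner_tensor [simp]: "(a \<otimes>\<^sub>H b) \<bullet> (c \<otimes>\<^sub>H d) = (a \<bullet> c) * (b \<bullet> d)"
  by (simp add: inner_tensor inner_commute)

lemma norm_tensor [simp]: "norm (x \<otimes>\<^sub>H y) = norm x * norm y"
  by (simp add: norm_eq_sqrt_inner real_sqrt_mult)

lemma bounded_bilinear_tensor: "bounded_bilinear (\<otimes>\<^sub>H)"
proof
  show "\<exists>K. \<forall>a b. norm (a \<otimes>\<^sub>H b) \<le> norm a * norm b * K"
    by (rule exI[of _ 1]) simp
qed (auto intro!: hs_eqI simp: inner_add_right algebra_simps)

lemma orthonormal_basis_tensor: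
  "orthonormal_basis {f \<otimes>\<^sub>H e | f e. f \<in> (onb::'b::{real_inner,banach} set) \<and> e \<in> (onb::'a::{real_inner,banach} set)}"
  (is "orthonormal_basis ?T")
proof (rule orthonormal_total_basis)
  note [simp] = orthonormal_inner[OF onb_orthonormal[where 'a='a]]
    orthonormal_inner[OF onb_orthonormal[where 'a='b]]
  have "norm e = 1" if "e \<in> onb" for e :: 'a
    using onb_orthonormal[where 'a='a] that by (simp add: orthonormal_def)
  moreover have "norm e = 1" if "e \<in> onb" for e :: 'b
    using onb_orthonormal[where 'a='b] that by (simp add: orthonormal_def)
  ultimately show "orthonormal ?T"
    by (auto simp: orthonormal_def pairwise_def orthogonal_def)
next
  fix A :: "('a, 'b) hs" assume A: "\<And>t. t \<in> ?T \<Longrightarrow> A \<bullet> t = 0"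
  have "hs_apply A e \<bullet> f = 0" if "e \<in> onb" "f \<in> onb" for e f
    using A[of "f \<otimes>\<^sub>H e"] that by (auto simp: inner_tensor)
  then have "hs_apply A e = 0" if "e \<in> onb" for e
    using orthonormal_basis_total[OF onb] that by blast
  then have "((\<lambda>e. (norm (hs_apply A e))\<^sup>2) has_sum 0) onb"
    by (intro has_sum_0) simp
  then have "(norm A)\<^sup>2 = 0" using hs_norm_has_sum has_sum_unique by blast
  then show "A = 0" by simp
qed

lemma second_countable_if_dense:
  fixes D :: "'a::metric_space set"
  assumes D: "countable D" and dense: "closure D = UNIV"
  shows "\<exists>B::'a set set. countable B \<and> open = generate_topology B"
proof -
  define B where "B = (\<lambda>(x, n). ball x (inverse (real (Suc n)))) ` (D \<times> (UNIV::nat set))"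
  have "topological_basis B"
  proof (rule topological_basisI)
    fix U :: "'a set" and x assume U: "open U" "x \<in> U"
    then obtain e where e: "e > 0" "ball x e \<subseteq> U" by (auto simp: open_contains_ball)
    obtain n where n: "inverse (real (Suc n)) < e / 2" using reals_Archimedean[of "e/2"] e by auto
    have "x \<in> closure D" using dense by simp
    then obtain d where d: "d \<in> D" "dist d x < inverse (real (Suc n))"
      unfolding closure_approachable by (meson inverse_positive_iff_positive of_nat_0_less_iff zero_less_Suc)
    show "\<exists>B'\<in>B. x \<in> B' \<and> B' \<subseteq> U"
    proof (rule bexI[of _ "ball d (inverse (real (Suc n)))"])
      have "ball d (inverse (real (Suc n))) \<subseteq> ball x e"
      proof
        fix y assume "y \<in> ball d (inverse (real (Suc n)))"
        then show "y \<in> ball x e"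
          using d n dist_triangle[of x y d] by (simp add: dist_commute)
      qed
      then show "x \<in> ball d (inverse (real (Suc n))) \<and> ball d (inverse (real (Suc n))) \<subseteq> U"
        using d e by auto
      show "ball d (inverse (real (Suc n))) \<in> B" using d(1) by (auto simp: B_def)
    qed
  qed (auto simp: B_def)
  moreover have "countable B" unfolding B_def using D by (intro countable_image countable_SIGMA) auto
  ultimately show ?thesis using topological_basis_imp_subbasis by blast
qed

instance hs :: ("{real_inner,banach,second_countable_topology}", "{real_inner,banach,second_countable_topology}")
  second_countable_topology
proof
  obtain P :: "'a set" where P: "countable P" "\<And>U. open U \<Longrightarrow> U \<noteq> {} \<Longrightarrow> \<exists>d\<in>P. d \<in> U"
    using countable_dense_setE by blast
  obtain Q :: "'b set" where Q: "countable Q" "\<And>U. open U \<Longrightarrow> U \<noteq> {} \<Longrightarrow> \<exists>d\<in>Q. d \<in> U"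
    using countable_dense_setE by blast
  define D where "D = (\<lambda>l. \<Sum>(y, x)\<leftarrow>l. y \<otimes>\<^sub>H x :: ('a, 'b) hs) ` lists (Q \<times> P)"
  have cD: "countable D" unfolding D_def using P Q by (intro countable_image countable_lists countable_SIGMA)
  have closP: "closure P = UNIV" and closQ: "closure Q = UNIV"
    using P(2) Q(2) by (auto simp: closure_iff_nhds_not_empty disjoint_iff) blast+
  have add: "A + B \<in> closure D" if AB: "A \<in> closure D" "B \<in> closure D" for A B
  proof -
    obtain X where X: "\<And>n::nat. X n \<in> D" "X \<longlonglongrightarrow> A"
      using AB(1) unfolding closure_sequential by auto
    obtain Y where Y: "\<And>n::nat. Y n \<in> D" "Y \<longlonglongrightarrow> B"
      using AB(2) unfolding closure_sequential by auto
    have "X n + Y n \<in> D" for n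
    proof -
      obtain l1 l2 where "l1 \<in> lists (Q \<times> P)" "l2 \<in> lists (Q \<times> P)"
        "X n = (\<Sum>(y, x)\<leftarrow>l1. y \<otimes>\<^sub>H x)" "Y n = (\<Sum>(y, x)\<leftarrow>l2. y \<otimes>\<^sub>H x)"
        using X(1)[of n] Y(1)[of n] unfolding D_def by blast
      then show ?thesis unfolding D_def by (intro image_eqI[of _ _ "l1 @ l2"]) auto
    qed
    moreover have "(\<lambda>n. X n + Y n) \<longlonglongrightarrow> A + B" by (rule tendsto_add[OF X(2) Y(2)])
    ultimately show ?thesis
      unfolding closure_sequential by (intro exI[of _ "\<lambda>n. X n + Y n"]) auto
  qed
  have pure: "y \<otimes>\<^sub>H x \<in> closure D" for x :: 'a and y :: 'b
  proof -
    have x: "x \<in> closure P" and y: "y \<in> closure Q" using closP closQ by auto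
    obtain X where X: "\<And>n::nat. X n \<in> P" "X \<longlonglongrightarrow> x"
      using x unfolding closure_sequential by auto
    obtain Y where Y: "\<And>n::nat. Y n \<in> Q" "Y \<longlonglongrightarrow> y"
      using y unfolding closure_sequential by auto
    have "Y n \<otimes>\<^sub>H X n \<in> D" for n
      unfolding D_def using X(1)[of n] Y(1)[of n] by (intro image_eqI[of _ _ "[(Y n, X n)]"]) auto
    moreover have "(\<lambda>n. Y n \<otimes>\<^sub>H X n) \<longlonglongrightarrow> y \<otimes>\<^sub>H x"
      by (rule bounded_bilinear.tendsto[OF bounded_bilinear_tensor Y(2) X(2)])
    ultimately show ?thesis
      unfolding closure_sequential by (intro exI[of _ "\<lambda>n. Y n \<otimes>\<^sub>H X n"]) auto
  qed
  have zero: "0 \<in> closure D"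
    using pure[of 0 0] bounded_bilinear.zero_left[OF bounded_bilinear_tensor] by metis
  have "A \<in> closure D" for A
  proof -
    let ?T = "{f \<otimes>\<^sub>H e | f e. f \<in> (onb::'b set) \<and> e \<in> (onb::'a set)}"
    have "(sum (\<lambda>t. (A \<bullet> t) *\<^sub>R t) \<longlongrightarrow> A) (finite_subsets_at_top ?T)"
      using orthonormal_basis_expansion[OF orthonormal_basis_tensor] by (simp add: has_sum_def)
    moreover have "sum (\<lambda>t. (A \<bullet> t) *\<^sub>R t) F \<in> closure D" if "finite F" "F \<subseteq> ?T" for F
      using that
    proof (induction F rule: finite_induct)
      case (insert t F)
      obtain f e where "t = f \<otimes>\<^sub>H e" using insert by auto
      then have "(A \<bullet> t) *\<^sub>R t = ((A \<bullet> t) *\<^sub>R f) \<otimes>\<^sub>H e"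
        by (simp add: bounded_bilinear.scaleR_left[OF bounded_bilinear_tensor])
      then have "(A \<bullet> t) *\<^sub>R t \<in> closure D" using pure by metis
      then show ?case using insert add by simp
    qed (simp add: zero)
    ultimately show ?thesis
      by (intro Lim_in_closed_set[of "closure D"]) (auto intro!: eventually_finite_subsets_at_top_weakI)
  qed
  then have "closure D = UNIV" by auto
  with cD show "\<exists>B::('a, 'b) hs set set. countable B \<and> open = generate_topology B"
    by (rule second_countable_if_dense)
qed

lemma blinfun_adjoint_exists:
  fixes A :: "'a::{real_inner,banach} \<Rightarrow>\<^sub>L 'b::real_inner"
  shows "\<exists>g. \<forall>x y. A x \<bullet> y = x \<bullet> g y"
proof -
  have "\<exists>z. \<forall>x. A x \<bullet> y = x \<bullet> z" for y
  proof -
    define c where "c e = A e \<bullet> y" for e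
    have bound: "(\<Sum>e\<in>F. (c e)\<^sup>2) \<le> (norm A * norm y)\<^sup>2" if F: "finite F" "F \<subseteq> onb" for F
    proof -
      let ?z = "\<Sum>e\<in>F. c e *\<^sub>R e"
      let ?s = "\<Sum>e\<in>F. (c e)\<^sup>2"
      have s: "(norm ?z)\<^sup>2 = ?s" by (rule orthonormal_sum_norm[OF onb_orthonormal F])
      have "?s = A ?z \<bullet> y"
        by (simp add: blinfun.sum_right blinfun.scaleR_right inner_sum_left c_def power2_eq_square)
      also have "\<dots> \<le> norm (A ?z) * norm y" by (rule norm_cauchy_schwarz)
      also have "\<dots> \<le> norm A * norm ?z * norm y" by (intro mult_right_mono norm_blinfun) auto
      finally have le: "norm ?z * norm ?z \<le> (norm A * norm y) * norm ?z"
        unfolding s[symmetric] by (simp add: power2_eq_square mult_ac)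
      have "norm ?z \<le> norm A * norm y"
      proof (cases "norm ?z = 0")
        case False
        then have "norm ?z > 0" by simp
        then show ?thesis using le by (rule mult_right_le_imp_le[rotated])
      qed simp
      then have "(norm ?z)\<^sup>2 \<le> (norm A * norm y)\<^sup>2" by (intro power_mono) auto
      then show ?thesis using s by simp
    qed
    have "(\<lambda>e. (c e)\<^sup>2) summable_on onb"
      by (rule nonneg_bdd_above_summable_on) (auto intro!: bdd_aboveI2 bound)
    then obtain z where z: "((\<lambda>e. c e *\<^sub>R e) has_sum z) onb"
      using orthonormal_summable[OF onb_orthonormal] by (auto simp: summable_on_def)
    have "A x \<bullet> y = x \<bullet> z" for x
    proof -
      have "bounded_linear (\<lambda>z. A z \<bullet> y)"
        by (rule bounded_linear_compose[OF bounded_linear_inner_left blinfun.bounded_linear_right])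
      from has_sum_bounded_linear[OF this orthonormal_basis_expansion[OF onb, of x]]
      have "((\<lambda>e. (x \<bullet> e) * c e) has_sum (A x \<bullet> y)) onb"
        by (simp add: blinfun.scaleR_right c_def)
      moreover have "((\<lambda>e. (x \<bullet> e) * c e) has_sum (x \<bullet> z)) onb"
        using has_sum_bounded_linear[OF bounded_linear_inner_right[of x] z] by (simp add: mult.commute)
      ultimately show ?thesis by (rule has_sum_unique)
    qed
    then show ?thesis by blast
  qed
  then show ?thesis by metis
qed

lemma adjoint_blinfun:
  fixes A :: "'a::{real_inner,banach} \<Rightarrow>\<^sub>L 'b::real_inner"
  shows "x \<bullet> adjoint A y = A x \<bullet> y"
proof -
  have "\<forall>x y. A x \<bullet> y = x \<bullet> adjoint A y"
    unfolding adjoint_def by (rule someI_ex[OF blinfun_adjoint_exists])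
  then show ?thesis by metis
qed

lemma bounded_linear_adjoint_blinfun:
  fixes A :: "'a::{real_inner,banach} \<Rightarrow>\<^sub>L 'b::real_inner"
  shows "bounded_linear (adjoint A)"
proof (rule bounded_linear_intro[where K = "norm A"])
  fix x y :: 'b and r :: real
  show "adjoint A (x + y) = adjoint A x + adjoint A y"
    by (rule vector_eq_ldot[THEN iffD1, OF allI]) (simp add: adjoint_blinfun inner_add_right)
  show "adjoint A (r *\<^sub>R x) = r *\<^sub>R adjoint A x"
    by (rule vector_eq_ldot[THEN iffD1, OF allI]) (simp add: adjoint_blinfun)
  have "(norm (adjoint A x))\<^sup>2 = A (adjoint A x) \<bullet> x"
    by (simp add: power2_norm_eq_inner adjoint_blinfun)
  also have "\<dots> \<le> norm (A (adjoint A x)) * norm x" by (rule norm_cauchy_schwarz)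
  also have "\<dots> \<le> norm A * norm (adjoint A x) * norm x" by (intro mult_right_mono norm_blinfun) auto
  finally have le: "norm (adjoint A x) * norm (adjoint A x) \<le> (norm x * norm A) * norm (adjoint A x)"
    by (simp add: power2_eq_square mult_ac)
  show "norm (adjoint A x) \<le> norm x * norm A"
  proof (cases "norm (adjoint A x) = 0")
    case False
    then have "norm (adjoint A x) > 0" by simp
    then show ?thesis using le by (rule mult_right_le_imp_le[rotated])
  qed simp
qed

lemma hs_sum_swap:
  fixes A :: "'a::{real_inner,banach} \<Rightarrow>\<^sub>L 'b::{real_inner,banach}"
  assumes S: "orthonormal_basis S" and T: "orthonormal_basis T"
    and A: "((\<lambda>e. (norm (A e))\<^sup>2) has_sum s) S"
    and B: "\<And>x y. A x \<bullet> y = x \<bullet> B y"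
  shows "((\<lambda>f. (norm (B f))\<^sup>2) has_sum s) T"
proof -
  let ?h = "\<lambda>(e, f). (A e \<bullet> f)\<^sup>2"
  have p: "((\<lambda>f. ?h (e, f)) has_sum (norm (A e))\<^sup>2) T" for e
    using parseval[OF T, of "A e"] by simp
  have "?h summable_on (S \<times> T)"
    by (rule summable_on_SigmaI[where g = "\<lambda>e. (norm (A e))\<^sup>2"])
       (use p A in \<open>auto simp: summable_on_def\<close>)
  then have "(?h has_sum s) (S \<times> T)"
    by (rule has_sum_SigmaI[OF p A])
  then have "((\<lambda>(f, e). ?h (e, f)) has_sum s) (T \<times> S)"
    using has_sum_swap[of ?h] by fastforce
  then show ?thesis
  proof (rule has_sum_SigmaD)
    fix f assume "f \<in> T"
    show "((\<lambda>e. case (f, e) of (f, e) \<Rightarrow> ?h (e, f)) has_sum (norm (B f))\<^sup>2) S"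
      using parseval[OF S, of "B f"] by (simp add: B inner_commute[of "B f"])
  qed
qed

lift_definition hs_adjoint :: "('a::{real_inner,banach}, 'b::{real_inner,banach}) hs \<Rightarrow> ('b, 'a) hs"
  is "\<lambda>A. Blinfun (adjoint (blinfun_apply A))"
proof -
  fix A :: "'a \<Rightarrow>\<^sub>L 'b"
  assume "(\<lambda>e. (norm (A e))\<^sup>2) summable_on onb"
  then obtain s where "((\<lambda>e. (norm (A e))\<^sup>2) has_sum s) onb" by (auto simp: summable_on_def)
  from hs_sum_swap[OF onb onb this, of "adjoint A"]
  show "(\<lambda>e. (norm (Blinfun (adjoint A) e))\<^sup>2) summable_on onb"
    by (auto simp: adjoint_blinfun summable_on_def bounded_linear_Blinfun_apply[OF bounded_linear_adjoint_blinfun])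
qed

lemma hs_adjoint_apply: "hs_apply (hs_adjoint A) = adjoint (hs_apply A)"
  by (simp only: hs_adjoint.rep_eq bounded_linear_Blinfun_apply[OF bounded_linear_adjoint_blinfun])

lemma inner_hs_adjoint: "x \<bullet> hs_apply (hs_adjoint A) y = hs_apply A x \<bullet> y"
  by (simp add: hs_adjoint_apply adjoint_blinfun)

lemma hs_norm_has_sum_basis:
  assumes S: "orthonormal_basis S"
  shows "((\<lambda>e. (norm (hs_apply A e))\<^sup>2) has_sum (norm A)\<^sup>2) S"
proof -
  have "((\<lambda>e. (norm (hs_apply (hs_adjoint A) e))\<^sup>2) has_sum (norm A)\<^sup>2) onb"
    by (rule hs_sum_swap[OF onb onb hs_norm_has_sum]) (simp add: inner_hs_adjoint)
  then show ?thesis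
    by (rule hs_sum_swap[OF onb S]) (metis inner_hs_adjoint inner_commute)
qed


subsection \<open>Complexification\<close>

text \<open>
  The complexification of a real Hilbert space consists of the pairs \<open>(x, y)\<close>, read as \<open>x + iy\<close>,
  with the product norm. A complex linear Hilbert--Schmidt operator on the complexification has the
  form \<open>A + iB\<close> for unique real Hilbert--Schmidt operators \<open>A\<close>, \<open>B\<close>, so these operators are
  represented by elements \<open>(A, B)\<close> of the complexification of the type of real Hilbert--Schmidt
  operators. The lemmas on \<open>complexified_apply\<close> below justify this; in particular
  the product norm of \<open>(A, B)\<close> is the Hilbert--Schmidt norm of \<open>A + iB\<close>
  (an orthonormal basis of the real space is one of its complexification).
\<close>

definition cscale :: "complex \<Rightarrow> 'v \<times> 'v \<Rightarrow> 'v::real_vector \<times> 'v"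
  where "cscale z v = (Re z *\<^sub>R fst v - Im z *\<^sub>R snd v, Re z *\<^sub>R snd v + Im z *\<^sub>R fst v)"

definition complexify :: "'v::real_vector \<Rightarrow> 'v \<times> 'v"
  where "complexify v = (v, 0)"

definition complexified_apply ::
    "('a::{real_inner,banach}, 'b::{real_inner,banach}) hs \<times> ('a, 'b) hs \<Rightarrow> 'a \<times> 'a \<Rightarrow> 'b \<times> 'b"
  where "complexified_apply P v =
    (hs_apply (fst P) (fst v) - hs_apply (snd P) (snd v),
     hs_apply (fst P) (snd v) + hs_apply (snd P) (fst v))"

lemma complexified_apply_cscale:
  "complexified_apply P (cscale z v) = cscale z (complexified_apply P v)"
  "complexified_apply (cscale z P) v = cscale z (complexified_apply P v)"
  by (simp_all add: complexified_apply_def cscale_def blinfun.bilinear_simps algebra_simps)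

lemma complexified_apply_complexify:
  "complexified_apply (complexify A) v = (hs_apply A (fst v), hs_apply A (snd v))"
  by (simp add: complexified_apply_def complexify_def)

lemma complexified_norm_has_sum:
  assumes "orthonormal_basis S"
  shows "((\<lambda>e. (norm (complexified_apply P (complexify e)))\<^sup>2) has_sum (norm P)\<^sup>2) S"
  using has_sum_add[OF hs_norm_has_sum_basis[OF assms, of "fst P"] hs_norm_has_sum_basis[OF assms, of "snd P"]]
  by (cases P) (simp add: complexified_apply_def complexify_def norm_Pair)

lemma complexified_apply_surj:
  fixes T :: "'a::{real_inner,banach} \<times> 'a \<Rightarrow> 'b::{real_inner,banach} \<times> 'b"
  assumes T: "bounded_linear T" and i: "\<And>v. T (cscale \<i> v) = cscale \<i> (T v)"
    and S: "orthonormal_basis S" and hs: "(\<lambda>e. (norm (T (complexify e)))\<^sup>2) summable_on S"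
  shows "\<exists>!P. T = complexified_apply P"
proof -
  have c: "bounded_linear (\<lambda>x::'a. (x, 0::'a))"
    by (intro bounded_linear_Pair bounded_linear_ident bounded_linear_zero)
  have bl: "bounded_linear (\<lambda>x. fst (T (x, 0)))" "bounded_linear (\<lambda>x. snd (T (x, 0)))"
    using bounded_linear_compose[OF bounded_linear_fst bounded_linear_compose[OF T c]]
      bounded_linear_compose[OF bounded_linear_snd bounded_linear_compose[OF T c]] by simp_all
  have norm_le: "(norm (fst q))\<^sup>2 \<le> (norm q)\<^sup>2" "(norm (snd q))\<^sup>2 \<le> (norm q)\<^sup>2" for q :: "'b \<times> 'b"
    by (cases q; simp add: norm_Pair)+
  have hs_ex: "\<exists>A. hs_apply A = f"
    if f: "bounded_linear f" and le: "\<And>x. (norm (f x))\<^sup>2 \<le> (norm (T (complexify x)))\<^sup>2"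
    for f :: "'a \<Rightarrow> 'b"
  proof -
    have "(\<lambda>e. norm ((norm (f e))\<^sup>2)) summable_on S"
      by (rule Infinite_Sum.abs_summable_on_comparison_test'[OF hs]) (simp add: le)
    then obtain s where s: "((\<lambda>e. (norm (Blinfun f e))\<^sup>2) has_sum s) S"
      by (auto simp: summable_on_def bounded_linear_Blinfun_apply[OF f])
    have 1: "((\<lambda>e. (norm (adjoint (Blinfun f) e))\<^sup>2) has_sum s) onb"
      by (rule hs_sum_swap[OF S onb s]) (simp add: adjoint_blinfun)
    have eq: "blinfun_apply (Blinfun (adjoint (Blinfun f))) = adjoint (Blinfun f)"
      by (rule bounded_linear_Blinfun_apply[OF bounded_linear_adjoint_blinfun])
    have "((\<lambda>e. (norm (Blinfun f e))\<^sup>2) has_sum s) onb"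
      by (rule hs_sum_swap[OF onb onb, of "Blinfun (adjoint (Blinfun f))"])
         (use 1 in \<open>auto simp: eq adjoint_blinfun inner_commute[of "adjoint (Blinfun f) _"]
            inner_commute[of _ "Blinfun f _"]\<close>)
    then have "hs_blinfun (Abs_hs (Blinfun f)) = Blinfun f"
      by (intro Abs_hs_inverse) (auto simp: summable_on_def)
    then show ?thesis using bounded_linear_Blinfun_apply[OF f] by (intro exI[of _ "Abs_hs (Blinfun f)"]) simp
  qed
  obtain A where A: "hs_apply A = (\<lambda>x. fst (T (x, 0)))"
    using hs_ex[OF bl(1)] norm_le by (auto simp: complexify_def)
  obtain B where B: "hs_apply B = (\<lambda>x. snd (T (x, 0)))"
    using hs_ex[OF bl(2)] norm_le by (auto simp: complexify_def)
  have "T v = complexified_apply (A, B) v" for v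
  proof -
    have "v = (fst v, 0) + cscale \<i> (snd v, 0)" by (simp add: cscale_def)
    then have "T v = T (fst v, 0) + cscale \<i> (T (snd v, 0))"
      using linear_add[OF bounded_linear.linear[OF T]] i by metis
    then show ?thesis by (simp add: complexified_apply_def A B cscale_def prod_eq_iff)
  qed
  moreover have "P = (A, B)" if P: "T = complexified_apply P" for P
  proof -
    have "hs_apply (fst P) x = hs_apply A x" "hs_apply (snd P) x = hs_apply B x" for x
      unfolding A B P by (simp_all add: complexified_apply_def)
    then show ?thesis by (auto simp: prod_eq_iff intro: hs_eqI)
  qed
  ultimately show ?thesis by blast
qed


subsection \<open>The nuclear norm\<close>

text \<open>
  The infimum of \<open>\<Sum>n. \<parallel>x\<^sub>n\<parallel> \<parallel>y\<^sub>n\<parallel>\<close> over all representations \<open>A = \<Sum>n. x\<^sub>n \<otimes> y\<^sub>n\<close>;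
  it is infinite iff \<open>A\<close> is not nuclear.
\<close>

definition nuclear_norm :: "('a::real_inner \<Rightarrow>\<^sub>L 'b::real_inner) \<Rightarrow> ennreal"
  where "nuclear_norm A =
    (INF (x, y) \<in> {(x :: nat \<Rightarrow> 'b, y :: nat \<Rightarrow> 'a). \<forall>z. (\<lambda>n. (z \<bullet> y n) *\<^sub>R x n) sums blinfun_apply A z}.
      \<Sum>n. ennreal (norm (x n) * norm (y n)))"


subsection \<open>Second and fourth order structure of a sequence of random elements\<close>

definition fourth_order_stationary ::
    "'w measure \<Rightarrow> (int \<Rightarrow> 'w \<Rightarrow> 'a::{real_inner,banach,second_countable_topology}) \<Rightarrow> bool"
  where "fourth_order_stationary M u \<longleftrightarrow>
    (\<forall>t. integrable M (\<lambda>w. norm (u t w) ^ 4)) \<and>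
    (\<forall>t1. (\<integral>w. u t1 w \<partial>M) = (\<integral>w. u 0 w \<partial>M)) \<and>
    (\<forall>t1 t2. (\<integral>w. u t1 w \<otimes>\<^sub>H u t2 w \<partial>M) = (\<integral>w. u 0 w \<otimes>\<^sub>H u (t2 - t1) w \<partial>M)) \<and>
    (\<forall>t1 t2 t3. (\<integral>w. u t1 w \<otimes>\<^sub>H u t2 w \<otimes>\<^sub>H u t3 w \<partial>M) =
      (\<integral>w. u 0 w \<otimes>\<^sub>H u (t2 - t1) w \<otimes>\<^sub>H u (t3 - t1) w \<partial>M)) \<and>
    (\<forall>t1 t2 t3 t4. (\<integral>w. u t1 w \<otimes>\<^sub>H u t2 w \<otimes>\<^sub>H u t3 w \<otimes>\<^sub>H u t4 w \<partial>M) =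
      (\<integral>w. u 0 w \<otimes>\<^sub>H u (t2 - t1) w \<otimes>\<^sub>H u (t3 - t1) w \<otimes>\<^sub>H u (t4 - t1) w \<partial>M))"

definition autocov ::
    "'w measure \<Rightarrow> (int \<Rightarrow> 'w \<Rightarrow> 'a::{real_inner,banach,second_countable_topology}) \<Rightarrow> int \<Rightarrow> ('a, 'a) hs"
  where "autocov M u j = (\<integral>w. u j w \<otimes>\<^sub>H u 0 w \<partial>M)"

text \<open>
  The Fourier series of the autocovariances is understood in \<open>L\<^sup>2\<close> of \<open>[-\<pi>, \<pi>]\<close> with values in the
  Hilbert--Schmidt operators on the complexification, which determines its sum up to null sets;
  \<open>spectral_density\<close> is an arbitrary version of it.
\<close>

definition is_spectral_density ::
    "'w measure \<Rightarrow> (int \<Rightarrow> 'w \<Rightarrow> 'a::{real_inner,banach,second_countable_topology}) \<Rightarrow>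
      (real \<Rightarrow> ('a, 'a) hs \<times> ('a, 'a) hs) \<Rightarrow> bool"
  where "is_spectral_density M u F \<longleftrightarrow>
    F \<in> borel_measurable borel \<and>
    set_integrable lborel {-pi..pi} (\<lambda>\<omega>. (norm (F \<omega>))\<^sup>2) \<and>
    (\<lambda>N::nat. LINT \<omega>:{-pi..pi}|lborel.
      (norm (F \<omega> - (1 / (2 * pi)) *\<^sub>R
        (\<Sum>j=-int N..int N. cscale (exp (- \<i> * of_int j * of_real \<omega>)) (complexify (autocov M u j)))))\<^sup>2)
      \<longlonglongrightarrow> 0"

definition spectral_density ::
    "'w measure \<Rightarrow> (int \<Rightarrow> 'w \<Rightarrow> 'a::{real_inner,banach,second_countable_topology}) \<Rightarrow>
      real \<Rightarrow> ('a, 'a) hs \<times> ('a, 'a) hs"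
  where "spectral_density M u = (SOME F. is_spectral_density M u F)"

definition cumulant :: "'w measure \<Rightarrow> ('w \<Rightarrow> real) list \<Rightarrow> real"
  where "cumulant M Xs =
    (\<Sum>\<pi> | partition_on {..<length Xs} \<pi>.
      fact (card \<pi> - 1) * (-1) ^ (card \<pi> - 1) * (\<Prod>B\<in>\<pi>. \<integral>w. (\<Prod>i\<in>B. (Xs ! i) w) \<partial>M))"

text \<open>The Hilbert space tensor product of a real Hilbert space with itself is realized as its space of
  Hilbert--Schmidt operators, with \<open>\<otimes>\<^sub>H\<close> as the elementary tensor. The operator below is determined uniquely by its values on
  elementary tensors, and exists if the fourth moments of the norms are finite.\<close>

definition cumulant_operator ::
    "'w measure \<Rightarrow> (int \<Rightarrow> 'w \<Rightarrow> 'a::{real_inner,banach,second_countable_topology}) \<Rightarrow>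
      int \<Rightarrow> int \<Rightarrow> int \<Rightarrow> ('a, 'a) hs \<Rightarrow>\<^sub>L ('a, 'a) hs"
  where "cumulant_operator M u t1 t2 t3 =
    (THE K. \<forall>f1 f2 f3 f4. blinfun_apply K (f3 \<otimes>\<^sub>H f4) \<bullet> (f1 \<otimes>\<^sub>H f2) =
      cumulant M [\<lambda>w. u t1 w \<bullet> f1, \<lambda>w. u t2 w \<bullet> f2, \<lambda>w. u t3 w \<bullet> f3, \<lambda>w. u 0 w \<bullet> f4])"


subsection \<open>Estimators\<close>

text \<open>
  Here \<open>x\<close> is the observed path \<open>t \<mapsto> u\<^sub>t\<close>, of which only \<open>x\<^sub>1, \<dots>, x\<^sub>n\<close> are used, and \<open>b\<close> is the
  bandwidth \<open>p\<^sub>n\<close>.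
\<close>

definition sample_autocov :: "(int \<Rightarrow> 'a::{real_inner,banach}) \<Rightarrow> nat \<Rightarrow> int \<Rightarrow> ('a, 'a) hs"
  where "sample_autocov x n j =
    (let C = (\<lambda>i. (1 / real n) *\<^sub>R (\<Sum>t=i+1..int n. x t \<otimes>\<^sub>H x (t - i)))
     in if 0 \<le> j then C j else hs_adjoint (C (- j)))"

definition sample_spectral_density ::
    "(real \<Rightarrow> real) \<Rightarrow> real \<Rightarrow> (int \<Rightarrow> 'a::{real_inner,banach}) \<Rightarrow> nat \<Rightarrow> real \<Rightarrow> ('a, 'a) hs \<times> ('a, 'a) hs"
  where "sample_spectral_density k b x n \<omega> = (1 / (2 * pi)) *\<^sub>R
    (\<Sum>j | \<bar>j\<bar> < int n. k (real_of_int j / b) *\<^sub>R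
      cscale (exp (- \<i> * of_int j * of_real \<omega>)) (complexify (sample_autocov x n j)))"

definition sample_Q2 ::
    "(real \<Rightarrow> real) \<Rightarrow> real \<Rightarrow> (int \<Rightarrow> 'a::{real_inner,banach}) \<Rightarrow> nat \<Rightarrow> real"
  where "sample_Q2 k b x n = 2 * pi * (LINT \<omega>:{-pi..pi}|lborel.
    (norm (sample_spectral_density k b x n \<omega> - (1 / (2 * pi)) *\<^sub>R complexify (sample_autocov x n 0)))\<^sup>2)"

definition population_Q2 ::
    "'w measure \<Rightarrow> (int \<Rightarrow> 'w \<Rightarrow> 'a::{real_inner,banach,second_countable_topology}) \<Rightarrow> real"
  where "population_Q2 M u = 2 * pi * (LINT \<omega>:{-pi..pi}|lborel.
    (norm (spectral_density M u \<omega> - (1 / (2 * pi)) *\<^sub>R complexify (autocov M u 0)))\<^sup>2)"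

definition sample_sigma2 :: "(int \<Rightarrow> 'a::real_inner) \<Rightarrow> nat \<Rightarrow> real"
  where "sample_sigma2 x n = (1 / real n) * (\<Sum>t=1..int n. (norm (x t))\<^sup>2)"

definition centering :: "(real \<Rightarrow> real) \<Rightarrow> real \<Rightarrow> nat \<Rightarrow> real"
  where "centering k b n = (\<Sum>j=1..n-1. (1 - real j / real n) * (k (real j / b))\<^sup>2)"

definition scaling :: "(real \<Rightarrow> real) \<Rightarrow> real \<Rightarrow> nat \<Rightarrow> real"
  where "scaling k b n =
    (\<Sum>j=1..n-2. (1 - real j / real n) * (1 - real (j + 1) / real n) * k (real j / b) ^ 4)"

definition test_statistic ::
    "(real \<Rightarrow> real) \<Rightarrow> real \<Rightarrow> (int \<Rightarrow> 'a::{real_inner,banach}) \<Rightarrow> nat \<Rightarrow> real"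
  where "test_statistic k b x n =
    (real n * sample_Q2 k b x n / 2 - (sample_sigma2 x n)\<^sup>2 * centering k b n) /
    ((norm (sample_autocov x n 0))\<^sup>2 * sqrt (2 * scaling k b n))"

definition tendsto_in_probability :: "'w measure \<Rightarrow> (nat \<Rightarrow> 'w \<Rightarrow> real) \<Rightarrow> real \<Rightarrow> bool"
  where "tendsto_in_probability M X c \<longleftrightarrow>
    (\<forall>\<epsilon>>0. (\<lambda>n. measure M {w \<in> space M. \<bar>X n w - c\<bar> > \<epsilon>}) \<longlonglongrightarrow> 0)"

end

theory Submission
  imports Defs
begin

text \<open>
  Write \<open>S(j)\<close> for the sample and \<open>C(j)\<close> for the population autocovariance operators. By Parseval's
  identity, the sample quadratic form is \<open>2 \<Sum>\<^bsub>1\<le>j<n\<^esub> k(j/p\<^sub>n)\<^sup>2 \<parallel>S(j)\<parallel>\<^sup>2\<close> and its population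
  analogue is \<open>2 \<Sum>\<^bsub>j\<ge>1\<^esub> \<parallel>C(j)\<parallel>\<^sup>2\<close>. Writing fourth moments as a cumulant plus products of
  covariances, the summability assumptions bound the mean square deviation of \<open>S(j)\<close> from its mean
  \<open>(1 - j/n) C(j)\<close> by \<open>B/n\<close>, uniformly in \<open>j\<close>. Since \<open>\<Sum>\<^sub>j k(j/p\<^sub>n)\<^sup>2 = O(p\<^sub>n)\<close> and \<open>p\<^sub>n/n \<longlonglongrightarrow> 0\<close>,
  the triangle inequality for weighted square sums gives convergence of the quadratic form in
  probability. The centering, divided by \<open>n\<close>, is \<open>O(p\<^sub>n/n)\<close>, and the scaling, divided by \<open>p\<^sub>n\<close>,
  is a Riemann sum of \<open>k\<^sup>4\<close>.
\<close>

subsection \<open>The nuclear norm\<close>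

text \<open>The basic quantity is the mean of
  \<open>(u t \<bullet> u s) * (u (t - j) \<bullet> u (s - j))\<close>, a double sum over an
  orthonormal basis. Of the three pairings into covariances, one gives the squared norm of
  \<open>C j\<close> and cancels against the squared mean; one is controlled by Hilbert-Schmidt
  norms at the lags \<open>h + j\<close> and \<open>h - j\<close>, where \<open>h = t - s\<close>;
  the third is the square of the trace of \<open>C h\<close>. Hilbert-Schmidt norms do not control a
  trace, which is why the nuclear norm enters, and the cumulant term is likewise a trace on the
  tensor product. Every trace is estimated on finite sections of the basis, uniformly in the
  section, and the limit is taken only in the moment itself.

  The autocovariances are merely square summable, so the spectral density is an L2 limit that must
  be constructed by completeness before Parseval's identity can be used. The kernel need not be
  monotone, so its sums are dominated through a decreasing integrable envelope. For the sample
  variance a bounded mean suffices, since it is multiplied by a deterministic null sequence.\<close>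

lemma bounded_linear_hs_apply: "bounded_linear (\<lambda>A. hs_apply A z)"
  by (rule bounded_linear_intro[where K = "norm z"]) (simp_all add: norm_hs_apply)

text \<open>A rank one operator has Hilbert-Schmidt norm \<open>norm x * norm y\<close>, so a
  representation of finite cost converges absolutely in that norm and the triangle inequality gives
  the bound. For representations of infinite cost the claim is trivial.\<close>

lemma norm_le_nuclear_norm: "ennreal (norm A) \<le> nuclear_norm (hs_blinfun A)"
  unfolding nuclear_norm_def
proof (rule INF_greatest, clarify)
  fix x y assume s: "\<forall>z. (\<lambda>n::nat. (z \<bullet> y n) *\<^sub>R x n) sums hs_apply A z"
  show "ennreal (norm A) \<le> (\<Sum>n. ennreal (norm (x n) * norm (y n)))"
  proof (cases "(\<Sum>n. ennreal (norm (x n) * norm (y n))) = \<infinity>")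
    case False
    then have sm: "summable (\<lambda>n. norm (x n) * norm (y n))"
      by (intro summable_suminf_not_top) auto
    then have sm': "summable (\<lambda>n. norm (x n \<otimes>\<^sub>H y n))" by simp
    \<comment> \<open>The representation is given only pointwise; evaluation at \<open>z\<close> is
      continuous, so the sum taken in norm has the same values.\<close>
    have "A = (\<Sum>n. x n \<otimes>\<^sub>H y n)"
    proof (rule hs_eqI)
      fix z
      have "(\<lambda>n. hs_apply (x n \<otimes>\<^sub>H y n) z) sums hs_apply (\<Sum>n. x n \<otimes>\<^sub>H y n) z"
        by (rule bounded_linear.sums[OF bounded_linear_hs_apply summable_sums[OF summable_norm_cancel[OF sm']]])
      then show "hs_apply A z = hs_apply (\<Sum>n. x n \<otimes>\<^sub>H y n) z"
        using s by (auto intro: sums_unique2)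
    qed
    then have "ennreal (norm A) \<le> ennreal (\<Sum>n. norm (x n) * norm (y n))"
      using summable_norm[OF sm'] by (simp add: ennreal_leI)
    also have "\<dots> = (\<Sum>n. ennreal (norm (x n) * norm (y n)))"
      by (rule suminf_ennreal_eq[symmetric, OF _ summable_sums[OF sm]]) simp
    finally show ?thesis .
  qed simp
qed

text \<open>Cauchy-Schwarz in coordinates, then Bessel. The sum is the trace over \<open>F\<close>
  of the rank one map \<open>z \<mapsto> (z \<bullet> y) *\<^sub>R x\<close>.\<close>

lemma inner_sums_le_norm:
  assumes S: "orthonormal S" "finite F" "F \<subseteq> S"
  shows "\<bar>\<Sum>e\<in>F. (e \<bullet> y) * (x \<bullet> e)\<bar> \<le> norm x * norm y"
proof -
  have "\<bar>\<Sum>e\<in>F. (e \<bullet> y) * (x \<bullet> e)\<bar> \<le> (\<Sum>e\<in>F. \<bar>x \<bullet> e\<bar> * \<bar>y \<bullet> e\<bar>)"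
    by (rule order_trans[OF sum_abs]) (simp add: abs_mult inner_commute mult.commute)
  also have "\<dots> \<le> L2_set (\<lambda>e. x \<bullet> e) F * L2_set (\<lambda>e. y \<bullet> e) F"
    by (rule L2_set_mult_ineq)
  also have "\<dots> \<le> norm x * norm y"
    unfolding L2_set_def using bessel_finite[OF S]
    by (intro mult_mono real_le_lsqrt) (auto intro: sum_nonneg)
  finally show ?thesis .
qed

text \<open>Each rank one term of a representation contributes at most
  \<open>norm (x n) * norm (y n)\<close> to the trace over \<open>F\<close>, and the nuclear norm is
  the infimum of the total cost. The bound does not depend on \<open>F\<close>.\<close>

lemma trace_le_nuclear_norm:
  fixes A :: "'a::{real_inner} \<Rightarrow>\<^sub>L 'a"
  assumes S: "orthonormal S" "finite F" "F \<subseteq> S"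
  shows "ennreal \<bar>\<Sum>e\<in>F. A e \<bullet> e\<bar> \<le> nuclear_norm A"
  unfolding nuclear_norm_def
proof (rule INF_greatest, clarify)
  fix x y assume s: "\<forall>z. (\<lambda>n::nat. (z \<bullet> y n) *\<^sub>R x n) sums blinfun_apply A z"
  show "ennreal \<bar>\<Sum>e\<in>F. A e \<bullet> e\<bar> \<le> (\<Sum>n. ennreal (norm (x n) * norm (y n)))"
  proof (cases "(\<Sum>n. ennreal (norm (x n) * norm (y n))) = \<infinity>")
    case False
    then have sm: "summable (\<lambda>n. norm (x n) * norm (y n))"
      by (intro summable_suminf_not_top) auto
    have "(\<lambda>n. ((e \<bullet> y n) *\<^sub>R x n) \<bullet> e) sums (A e \<bullet> e)" for e
      by (rule bounded_linear.sums[OF bounded_linear_inner_left]) (use s in auto)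
    then have *: "(\<lambda>n. \<Sum>e\<in>F. (e \<bullet> y n) * (x n \<bullet> e)) sums (\<Sum>e\<in>F. A e \<bullet> e)"
      by (intro sums_sum) simp
    have bd: "norm (\<Sum>e\<in>F. (e \<bullet> y n) * (x n \<bullet> e)) \<le> norm (x n) * norm (y n)" for n
      using inner_sums_le_norm[OF S, of "y n" "x n"] by simp
    have "ennreal \<bar>\<Sum>e\<in>F. A e \<bullet> e\<bar> = ennreal (norm (\<Sum>n. \<Sum>e\<in>F. (e \<bullet> y n) * (x n \<bullet> e)))"
      using sums_unique[OF *] by simp
    also have "\<dots> \<le> ennreal (\<Sum>n. norm (x n) * norm (y n))"
      by (rule ennreal_leI[OF norm_suminf_le[OF bd sm]])
    also have "\<dots> = (\<Sum>n. ennreal (norm (x n) * norm (y n)))"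
      by (rule suminf_ennreal_eq[symmetric, OF _ summable_sums[OF sm]]) simp
    finally show ?thesis .
  qed simp
qed

section \<open>Adjoints and the orthonormal system of elementary tensors\<close>

lemma norm_hs_adjoint [simp]: "norm (hs_adjoint A) = norm A"
proof -
  have "((\<lambda>e. (norm (hs_apply (hs_adjoint A) e))\<^sup>2) has_sum (norm A)\<^sup>2) onb"
    by (rule hs_sum_swap[OF onb onb hs_norm_has_sum]) (simp add: inner_hs_adjoint)
  then have "(norm (hs_adjoint A))\<^sup>2 = (norm A)\<^sup>2"
    using hs_norm_has_sum has_sum_unique by blast
  then show ?thesis by simp
qed

lemma hs_adjoint_eqI: "(\<And>x y. hs_apply A x \<bullet> y = x \<bullet> hs_apply B y) \<Longrightarrow> hs_adjoint A = B"
  by (rule hs_eqI, rule vector_eq_ldot[THEN iffD1, OF allI]) (simp add: inner_hs_adjoint)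

lemma bounded_linear_hs_adjoint: "bounded_linear hs_adjoint"
  by (rule bounded_linear_intro[where K = 1])
    (simp_all, (rule hs_adjoint_eqI, simp add: inner_add_left inner_add_right inner_hs_adjoint)+)

lemma hs_adjoint_tensor [simp]: "hs_adjoint (x \<otimes>\<^sub>H y) = y \<otimes>\<^sub>H x"
  by (rule hs_adjoint_eqI) (simp add: inner_commute)

text \<open>Lets sums over pairs of basis vectors be read as sums over the tensor basis. Pairing two
  equal tensors with one of them turns the equality into a product of Kronecker deltas.\<close>

lemma inj_on_tensor: "inj_on (\<lambda>(e, f). e \<otimes>\<^sub>H f) (onb \<times> onb)"
proof (rule inj_onI)
  fix p q :: "'a \<times> 'b" 
  assume "p \<in> onb \<times> onb" "q \<in> onb \<times> onb" and eq: "(case p of (e, f) \<Rightarrow> e \<otimes>\<^sub>H f) = (case q of (e, f) \<Rightarrow> e \<otimes>\<^sub>H f)"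
  then have a: "fst p \<in> onb" "snd p \<in> onb" "fst q \<in> onb" "snd q \<in> onb" by auto
  have "(fst p \<otimes>\<^sub>H snd p) \<bullet> (fst p \<otimes>\<^sub>H snd p) = (fst q \<otimes>\<^sub>H snd q) \<bullet> (fst p \<otimes>\<^sub>H snd p)" 
    using eq by (simp only: case_prod_unfold)
  then show "p = q"
    using a by (simp add: orthonormal_inner[OF onb_orthonormal] prod_eq_iff split: if_splits)
qed

lemma orthonormal_tensor:
  "orthonormal ((\<lambda>(e, f). e \<otimes>\<^sub>H f) ` ((onb :: 'b::{real_inner,banach} set) \<times> (onb :: 'a::{real_inner,banach} set)))"
proof -
  have "(\<lambda>(e, f). e \<otimes>\<^sub>H f) ` (onb \<times> onb) = {f \<otimes>\<^sub>H e | f e. f \<in> (onb::'b set) \<and> e \<in> (onb::'a set)}"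
    by auto
  then show ?thesis using orthonormal_basis_tensor[where 'a='a and 'b='b] by (simp only: orthonormal_basis_def)
qed

text \<open>The double sum is a finite section of \<open>A \<bullet> hs_adjoint B\<close> in the
  tensor basis: passing to the adjoint turns \<open>hs_apply B e \<bullet> f\<close> into a
  coordinate at the same tensor \<open>e \<otimes>\<^sub>H f\<close> as that of
  \<open>A\<close>.\<close>

lemma sum_hs_product_le:
  assumes F: "finite F" "F \<subseteq> onb" and G: "finite G" "G \<subseteq> onb"
  shows "\<bar>\<Sum>e\<in>F. \<Sum>f\<in>G. (hs_apply A f \<bullet> e) * (hs_apply B e \<bullet> f)\<bar> \<le> norm A * norm B"
proof -
  let ?I = "(\<lambda>(e, f). e \<otimes>\<^sub>H f) ` (F \<times> G)"
  have inj: "inj_on (\<lambda>(e, f). e \<otimes>\<^sub>H f) (F \<times> G)"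
    by (rule inj_on_subset[OF inj_on_tensor]) (use F G in auto)
  have eq: "(\<Sum>e\<in>F. \<Sum>f\<in>G. (hs_apply A f \<bullet> e) * (hs_apply B e \<bullet> f)) =
     (\<Sum>g\<in>?I. (g \<bullet> hs_adjoint B) * (A \<bullet> g))"
    unfolding sum.reindex[OF inj] sum.cartesian_product
  proof (intro sum.cong refl, clarify)
    fix e f
    have "(e \<otimes>\<^sub>H f) \<bullet> hs_adjoint B = e \<bullet> hs_apply (hs_adjoint B) f"
      by (metis inner_tensor inner_commute)
    then show "(hs_apply A f \<bullet> e) * (hs_apply B e \<bullet> f) =
      ((\<lambda>g. (g \<bullet> hs_adjoint B) * (A \<bullet> g)) \<circ> (\<lambda>(e, f). e \<otimes>\<^sub>H f)) (e, f)"
      by (simp add: inner_tensor inner_hs_adjoint)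
  qed
  have "?I \<subseteq> (\<lambda>(e, f). e \<otimes>\<^sub>H f) ` (onb \<times> onb)"
    by (intro image_mono Sigma_mono F G)
  moreover have "finite ?I" using F G by simp
  ultimately show ?thesis
    unfolding eq using inner_sums_le_norm[OF orthonormal_tensor, of ?I "hs_adjoint B" A] by simp
qed

text \<open>The tensors \<open>e \<otimes>\<^sub>H f\<close> are orthonormal in the Hilbert space on
  which \<open>K\<close> acts, so the double sum is a partial trace of \<open>K\<close>.\<close>

lemma sum_inner_tensor_le_nuclear_norm:
  fixes K :: "('a::{real_inner,banach}, 'b::{real_inner,banach}) hs \<Rightarrow>\<^sub>L ('a, 'b) hs"
  assumes F: "finite F" "F \<subseteq> onb" and G: "finite G" "G \<subseteq> onb"
  shows "ennreal \<bar>\<Sum>e\<in>F. \<Sum>f\<in>G. K (e \<otimes>\<^sub>H f) \<bullet> (e \<otimes>\<^sub>H f)\<bar> \<le> nuclear_norm K"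
proof -
  let ?I = "(\<lambda>(e, f). e \<otimes>\<^sub>H f) ` (F \<times> G)"
  have inj: "inj_on (\<lambda>(e, f). e \<otimes>\<^sub>H f) (F \<times> G)"
    by (rule inj_on_subset[OF inj_on_tensor]) (use F G in auto)
  have eq: "(\<Sum>e\<in>F. \<Sum>f\<in>G. K (e \<otimes>\<^sub>H f) \<bullet> (e \<otimes>\<^sub>H f)) = (\<Sum>g\<in>?I. K g \<bullet> g)"
    unfolding sum.reindex[OF inj] sum.cartesian_product by (intro sum.cong refl) auto
  have "?I \<subseteq> (\<lambda>(e, f). e \<otimes>\<^sub>H f) ` (onb \<times> onb)"
    by (intro image_mono Sigma_mono F G)
  moreover have "finite ?I" using F G by simp
  ultimately show ?thesis
    unfolding eq by (intro trace_le_nuclear_norm[OF orthonormal_tensor])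
qed

subsection \<open>Cumulants and the fourth order cumulant operator\<close>

lemma partition_on_doubleton:
  assumes P: "partition_on {x, y} P" and ns: "\<And>z. {z} \<notin> P"
  shows "P = {{x, y}}"
proof -
  have "p = {x, y}" if "p \<in> P" for p
  proof -
    have "p \<in> Pow {x, y}" "p \<noteq> {}" using that P by (auto simp: partition_on_def)
    then have "p = {x} \<or> p = {y} \<or> p = {x, y}" by (auto simp: Pow_insert insert_commute)
    then show ?thesis using that ns by auto
  qed
  moreover have "P \<noteq> {}" using P by (auto simp: partition_on_def)
  ultimately show ?thesis by blast
qed

text \<open>For centered variables a singleton block contributes a factor 0, so only these
  partitions matter. The proof classifies by the block \<open>B\<close> containing 0; the other
  blocks \<open>R\<close> partition what \<open>B\<close> leaves of \<open>{1,2,3}\<close>.\<close>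

lemma partition_on_four:
  assumes P: "partition_on {..<4::nat} P" and ns: "\<And>z. {z} \<notin> P"
  shows "P \<in> {{{0,1,2,3}}, {{0,1},{2,3}}, {{0,2},{1,3}}, {{0,3},{1,2}}}"
proof -
  have four: "{..<4::nat} = {0,1,2,3}" by auto
  obtain B where B: "B \<in> P" "0 \<in> B" using partition_onD1[OF P] by (metis UnionE lessThan_iff zero_less_numeral)
  have sub: "B \<subseteq> {0,1,2,3}" using Union_upper[OF B(1)] unfolding partition_onD1[OF P, symmetric] four .
  define R where "R = P - {B}"
  have PR: "P = insert B R" using B by (auto simp: R_def)
  have "disjnt B (\<Union>R)" using partition_onD2[OF P] B
    by (auto simp: R_def disjnt_def disjoint_def)
  then have "partition_on ({0,1,2,3} - B) R"
    using partition_on_insert[of B R "{0,1,2,3}"] P by (simp add: PR four)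
  then have part: "partition_on ({1,2,3} - B) R"
    using B(2) by (simp add: insert_Diff_if)
  have nsR: "\<And>z. {z} \<notin> R" using ns by (auto simp: R_def)
  have B0: "B = insert 0 ({1,2,3} \<inter> B)" using sub B(2) by auto
  have one: False if "partition_on {x} R" for x
    using partition_on_doubleton[of x x R] that nsR by auto
  \<comment> \<open>If \<open>B\<close> misses exactly one of 1, 2, 3, that point would be a
    singleton block; if it misses all three, \<open>B\<close> is one itself. The other four cases
    are the listed partitions.\<close>
  consider "1 \<in> B" "2 \<in> B" "3 \<in> B" | "1 \<in> B" "2 \<in> B" "3 \<notin> B" | "1 \<in> B" "2 \<notin> B" "3 \<in> B"
    | "1 \<in> B" "2 \<notin> B" "3 \<notin> B" | "1 \<notin> B" "2 \<in> B" "3 \<in> B" | "1 \<notin> B" "2 \<in> B" "3 \<notin> B"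
    | "1 \<notin> B" "2 \<notin> B" "3 \<in> B" | "1 \<notin> B" "2 \<notin> B" "3 \<notin> B" by blast
  then show ?thesis
  proof cases
    case 1
    then have "B = {0,1,2,3}" "R = {}" using B0 part by (auto simp: insert_Diff_if partition_on_empty)
    then show ?thesis by (simp add: PR)
  next
    case 4
    then have "B = {0,1}" "partition_on {2,3} R" using B0 part by (auto simp: insert_Diff_if)
    then show ?thesis using partition_on_doubleton[of 2 3 R] nsR by (simp add: PR)
  next
    case 6
    then have "B = {0,2}" "partition_on {1,3} R" using B0 part by (auto simp: insert_Diff_if)
    then show ?thesis using partition_on_doubleton[of 1 3 R] nsR by (simp add: PR)
  next
    case 7
    then have "B = {0,3}" "partition_on {1,2} R" using B0 part by (auto simp: insert_Diff_if)
    then show ?thesis using partition_on_doubleton[of 1 2 R] nsR by (simp add: PR)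
  next
    case 8
    then have "B = {0}" using B0 by auto
    then show ?thesis using ns[of 0] B by simp
  next
    case 2
    then have "partition_on {3} R" using part by (simp add: insert_Diff_if)
    from one[OF this] show ?thesis ..
  next
    case 3
    then have "partition_on {2} R" using part by (simp add: insert_Diff_if)
    from one[OF this] show ?thesis ..
  next
    case 5
    then have "partition_on {1} R" using part by (simp add: insert_Diff_if)
    from one[OF this] show ?thesis ..
  qed
qed

text \<open>After the partitions with a singleton drop out, the one-block partition has weight 1 and
  each of the three pairings, having two blocks, has weight -1.\<close>

lemma cumulant_four_centered:
  assumes "\<And>i. i < 4 \<Longrightarrow> (\<integral>w. ([a, b, c, d] ! i) w \<partial>M) = 0"
  shows "cumulant M [a, b, c, d] = (\<integral>w. a w * b w * c w * d w \<partial>M)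
    - (\<integral>w. a w * b w \<partial>M) * (\<integral>w. c w * d w \<partial>M) - (\<integral>w. a w * c w \<partial>M) * (\<integral>w. b w * d w \<partial>M)
    - (\<integral>w. a w * d w \<partial>M) * (\<integral>w. b w * c w \<partial>M)"
proof -
  define f where "f \<pi> = fact (card \<pi> - 1) * (-1) ^ (card \<pi> - 1) *
     (\<Prod>B\<in>\<pi>. \<integral>w. (\<Prod>i\<in>B. ([a, b, c, d] ! i) w) \<partial>M)" for \<pi> :: "nat set set"
  let ?G = "{{{0,1,2,3}}, {{0,1},{2,3}}, {{0,2},{1,3}}, {{0,3},{1,2}}} :: nat set set set"
  have four: "{..<4::nat} = {0,1,2,3}" by auto
  have "cumulant M [a, b, c, d] = (\<Sum>\<pi> | partition_on {..<4} \<pi>. f \<pi>)"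
    unfolding cumulant_def f_def by (simp add: numeral_eq_Suc)
  also have "\<dots> = (\<Sum>\<pi>\<in>?G. f \<pi>)"
  proof (rule sum.mono_neutral_right)
    show "finite {\<pi>. partition_on {..<4::nat} \<pi>}" by (rule finitely_many_partition_on) simp
    show "?G \<subseteq> {\<pi>. partition_on {..<4::nat} \<pi>}"
      unfolding four by (simp, intro conjI; rule partition_onI) (auto simp: disjnt_def)
    show "\<forall>\<pi>\<in>{\<pi>. partition_on {..<4::nat} \<pi>} - ?G. f \<pi> = 0"
    proof
      fix \<pi> assume \<pi>: "\<pi> \<in> {\<pi>. partition_on {..<4::nat} \<pi>} - ?G"
      then have pp: "partition_on {..<4} \<pi>" and "\<pi> \<notin> ?G" by (simp_all only: Diff_iff mem_Collect_eq not_False_eq_True)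
      then obtain z where z: "{z} \<in> \<pi>" using partition_on_four[of \<pi>] by metis
      then have "z \<in> {..<4}" using partition_onD1[OF pp] by blast
      then have "z < 4" by simp
      moreover have "finite \<pi>" by (rule finite_elements[OF _ pp]) simp
      ultimately show "f \<pi> = 0" using assms[of z] unfolding f_def
        by (intro mult_eq_0_iff[THEN iffD2] disjI2 prod_zero bexI[OF _ z]) simp_all
    qed
  qed
  also have "\<dots> = f {{0,1,2,3}} + f {{0,1},{2,3}} + f {{0,2},{1,3}} + f {{0,3},{1,2}}"
    by (simp add: insert_eq_iff doubleton_eq_iff)
  also have "f {{0,1,2,3}} = (\<integral>w. a w * b w * c w * d w \<partial>M)"
    by (simp add: f_def mult.assoc)
  also have "f {{0,1},{2,3}} = - ((\<integral>w. a w * b w \<partial>M) * (\<integral>w. c w * d w \<partial>M))"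
    by (simp add: f_def doubleton_eq_iff)
  also have "f {{0,2},{1,3}} = - ((\<integral>w. a w * c w \<partial>M) * (\<integral>w. b w * d w \<partial>M))"
    by (simp add: f_def doubleton_eq_iff)
  also have "f {{0,3},{1,2}} = - ((\<integral>w. a w * d w \<partial>M) * (\<integral>w. b w * c w \<partial>M))"
    by (simp add: f_def doubleton_eq_iff)
  finally show ?thesis by simp
qed

text \<open>The operator sends \<open>A\<close> to the mean of
  \<open>(X w \<bullet> A) *\<^sub>R Y w\<close> and is bounded by the mean of
  \<open>norm (X w) * norm (Y w)\<close>. The measure \<open>N\<close> is left general so that the
  construction also runs on a product space, where independent copies encode products of
  covariances.\<close>

lemma tensor_operator_exists:
  fixes X :: "'w \<Rightarrow> 'a::{real_inner,banach,second_countable_topology}"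
    and Y :: "'w \<Rightarrow> 'b::{real_inner,banach,second_countable_topology}"
  assumes [measurable]: "X \<in> borel_measurable N" "Y \<in> borel_measurable N"
    and int: "integrable N (\<lambda>w. norm (X w) * norm (Y w))"
  shows "\<exists>K :: 'a \<Rightarrow>\<^sub>L 'b. \<forall>A B. K A \<bullet> B = (\<integral>w. (X w \<bullet> A) * (Y w \<bullet> B) \<partial>N)"
proof -
  have bound: "norm ((X w \<bullet> A) *\<^sub>R Y w) \<le> norm A * (norm (X w) * norm (Y w))" for A w
    using mult_right_mono[OF Cauchy_Schwarz_ineq2[of "X w" A], of "norm (Y w)"] by (simp add: mult_ac)
  have int1: "integrable N (\<lambda>w. (X w \<bullet> A) *\<^sub>R Y w)" for A
  proof (rule Bochner_Integration.integrable_bound)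
    show "integrable N (\<lambda>w. norm A * (norm (X w) * norm (Y w)))" using int by simp
    show "AE w in N. norm ((X w \<bullet> A) *\<^sub>R Y w) \<le> norm (norm A * (norm (X w) * norm (Y w)))"
      using bound by simp
  qed measurable
  have bl: "bounded_linear (\<lambda>A. \<integral>w. (X w \<bullet> A) *\<^sub>R Y w \<partial>N)"
  proof (rule bounded_linear_intro)
    fix A B :: 'a and r :: real
    show "(\<integral>w. (X w \<bullet> (A + B)) *\<^sub>R Y w \<partial>N) = (\<integral>w. (X w \<bullet> A) *\<^sub>R Y w \<partial>N) + (\<integral>w. (X w \<bullet> B) *\<^sub>R Y w \<partial>N)"
      by (subst Bochner_Integration.integral_add[OF int1 int1, symmetric]) (simp add: inner_add_right scaleR_add_left)
    show "(\<integral>w. (X w \<bullet> (r *\<^sub>R A)) *\<^sub>R Y w \<partial>N) = r *\<^sub>R (\<integral>w. (X w \<bullet> A) *\<^sub>R Y w \<partial>N)"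
      by (subst integral_scaleR_right[symmetric]) simp
    have "norm (\<integral>w. (X w \<bullet> A) *\<^sub>R Y w \<partial>N) \<le> (\<integral>w. norm ((X w \<bullet> A) *\<^sub>R Y w) \<partial>N)"
      by (rule integral_norm_bound)
    also have "\<dots> \<le> (\<integral>w. norm A * (norm (X w) * norm (Y w)) \<partial>N)"
      by (intro integral_mono integrable_norm int1 bound integrable_mult_right int)
    finally show "norm (\<integral>w. (X w \<bullet> A) *\<^sub>R Y w \<partial>N) \<le> norm A * (\<integral>w. norm (X w) * norm (Y w) \<partial>N)" by simp
  qed
  have "Blinfun (\<lambda>A. \<integral>w. (X w \<bullet> A) *\<^sub>R Y w \<partial>N) A \<bullet> B = (\<integral>w. (X w \<bullet> A) * (Y w \<bullet> B) \<partial>N)" for A B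
    by (simp add: bounded_linear_Blinfun_apply[OF bl] integral_inner_left[symmetric] int1)
  then show ?thesis by blast
qed

text \<open>Elementary tensors of basis vectors are total in both spaces: testing against them fixes
  the values at tensors, and expansion in the tensor basis extends the equality to all arguments.
  This gives uniqueness of the cumulant operator.\<close>

lemma blinfun_hs_eqI:
  fixes K L :: "('a::{real_inner,banach}, 'b::{real_inner,banach}) hs \<Rightarrow>\<^sub>L ('c::{real_inner,banach}, 'd::{real_inner,banach}) hs"
  assumes "\<And>f1 f2 f3 f4. K (f3 \<otimes>\<^sub>H f4) \<bullet> (f1 \<otimes>\<^sub>H f2) = L (f3 \<otimes>\<^sub>H f4) \<bullet> (f1 \<otimes>\<^sub>H f2)"
  shows "K = L"
proof (rule blinfun_eqI)
  fix A :: "('a, 'b) hs"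
  have pure: "K (f3 \<otimes>\<^sub>H f4) = L (f3 \<otimes>\<^sub>H f4)" for f3 f4
  proof -
    have "(K (f3 \<otimes>\<^sub>H f4) - L (f3 \<otimes>\<^sub>H f4)) \<bullet> t = 0"
      if "t \<in> {f \<otimes>\<^sub>H e | f e. f \<in> (onb::'d set) \<and> e \<in> (onb::'c set)}" for t
      using that assms by (auto simp: inner_diff_left)
    then have "K (f3 \<otimes>\<^sub>H f4) - L (f3 \<otimes>\<^sub>H f4) = 0"
      by (rule orthonormal_basis_total[OF orthonormal_basis_tensor])
    then show ?thesis by simp
  qed
  let ?T = "{f \<otimes>\<^sub>H e | f e. f \<in> (onb::'b set) \<and> e \<in> (onb::'a set)}"
  have ex: "((\<lambda>t. (A \<bullet> t) *\<^sub>R t) has_sum A) ?T"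
    by (rule orthonormal_basis_expansion[OF orthonormal_basis_tensor])
  have "((\<lambda>t. K ((A \<bullet> t) *\<^sub>R t)) has_sum K A) ?T" "((\<lambda>t. L ((A \<bullet> t) *\<^sub>R t)) has_sum L A) ?T"
    by (rule has_sum_bounded_linear[OF blinfun.bounded_linear_right ex])+
  moreover have "K ((A \<bullet> t) *\<^sub>R t) = L ((A \<bullet> t) *\<^sub>R t)" if "t \<in> ?T" for t
    using that pure by (auto simp: blinfun.scaleR_right)
  ultimately have "((\<lambda>t. L ((A \<bullet> t) *\<^sub>R t)) has_sum K A) ?T"
    by (subst has_sum_cong[where g = "\<lambda>t. K ((A \<bullet> t) *\<^sub>R t)"]) auto
  then show "K A = L A" using \<open>((\<lambda>t. L ((A \<bullet> t) *\<^sub>R t)) has_sum L A) ?T\<close> has_sum_unique by blast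
qed

text \<open>Under the product measure the two coordinates act as independent copies, so a product of
  two means is a single integral.\<close>

lemma
  fixes f g :: "_ \<Rightarrow> real"
  assumes "prob_space M" and f: "integrable M f" and g: "integrable M g"
  shows integrable_pair_mult: "integrable (M \<Otimes>\<^sub>M M) (\<lambda>p. f (fst p) * g (snd p))" (is ?A)
    and integral_pair_mult: "(\<integral>p. f (fst p) * g (snd p) \<partial>(M \<Otimes>\<^sub>M M)) = (\<integral>w. f w \<partial>M) * (\<integral>w. g w \<partial>M)" (is ?B)
proof -
  interpret prob_space M by fact
  interpret P: pair_prob_space M M ..
  have [measurable]: "f \<in> borel_measurable M" "g \<in> borel_measurable M" using f g by auto
  show i: ?A
  proof (rule P.Fubini_integrable)
    have "integrable M (\<lambda>x. \<bar>f x\<bar> * (\<integral>y. \<bar>g y\<bar> \<partial>M))"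
      using f by (intro integrable_mult_left integrable_abs)
    then show "integrable M (\<lambda>x. \<integral>y. norm (f (fst (x, y)) * g (snd (x, y))) \<partial>M)"
      by (simp add: abs_mult)
  qed (use g in auto)
  show ?B using P.integral_fst'[OF i] by simp
qed

lemma borel_measurable_tensor [measurable]:
  fixes f :: "'w \<Rightarrow> 'b::{real_inner,banach,second_countable_topology}"
    and g :: "'w \<Rightarrow> 'a::{real_inner,banach,second_countable_topology}"
  assumes "f \<in> borel_measurable M" "g \<in> borel_measurable M"
  shows "(\<lambda>w. f w \<otimes>\<^sub>H g w) \<in> borel_measurable M"
  by (rule borel_measurable_continuous_Pair[OF assms])
     (intro bounded_bilinear.continuous_on[OF bounded_bilinear_tensor] continuous_intros)

text \<open>A crude arithmetic-geometric inequality. With some factors set to 1 it derives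
  integrability of lower moments from that of the fourth.\<close>

lemma mult4_le_power4:
  fixes a b c d :: real
  assumes "0 \<le> a" "0 \<le> b" "0 \<le> c" "0 \<le> d"
  shows "a * b * c * d \<le> a ^ 4 + b ^ 4 + c ^ 4 + d ^ 4"
proof -
  have two: "x * y \<le> x\<^sup>2 + y\<^sup>2" if "0 \<le> x" "0 \<le> y" for x y :: real
    using sum_squares_bound[of x y] mult_nonneg_nonneg[OF that] by linarith
  have "(a * b) * (c * d) \<le> (a * b)\<^sup>2 + (c * d)\<^sup>2" using assms by (intro two) auto
  also have "(a * b)\<^sup>2 \<le> a ^ 4 + b ^ 4" using two[of "a\<^sup>2" "b\<^sup>2"] by (simp add: power_mult_distrib)
  also have "(c * d)\<^sup>2 \<le> c ^ 4 + d ^ 4" using two[of "c\<^sup>2" "d\<^sup>2"] by (simp add: power_mult_distrib)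
  finally show ?thesis by (simp add: mult.assoc)
qed

section \<open>Moments of a centered fourth order stationary sequence\<close>

locale centered_stationary = prob_space M for M :: "'w measure" +
  fixes u :: "int \<Rightarrow> 'w \<Rightarrow> 'a::{real_inner,banach,second_countable_topology}"
  assumes measurable_u [measurable]: "\<And>t. u t \<in> borel_measurable M"
    and stationary: "fourth_order_stationary M u"
    and mean_zero: "\<And>t. (\<integral>w. u t w \<partial>M) = 0"
begin

abbreviation C :: "int \<Rightarrow> ('a, 'a) hs" where "C \<equiv> autocov M u"

lemma integrable_norm_power4: "integrable M (\<lambda>w. norm (u t w) ^ 4)"
  using stationary by (simp add: fourth_order_stationary_def)

lemma integrable_norm4:
  "integrable M (\<lambda>w. norm (u t1 w) * norm (u t2 w) * norm (u t3 w) * norm (u t4 w))"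
proof (rule Bochner_Integration.integrable_bound)
  show "integrable M (\<lambda>w. norm (u t1 w) ^ 4 + norm (u t2 w) ^ 4 + norm (u t3 w) ^ 4 + norm (u t4 w) ^ 4)"
    by (intro Bochner_Integration.integrable_add integrable_norm_power4)
qed (auto intro!: mult4_le_power4)

lemma integrable_norm2: "integrable M (\<lambda>w. norm (u s w) * norm (u t w))"
proof (rule Bochner_Integration.integrable_bound)
  show "integrable M (\<lambda>w. norm (u s w) ^ 4 + norm (u t w) ^ 4 + 1 ^ 4 + 1 ^ 4)"
    by (intro Bochner_Integration.integrable_add integrable_norm_power4 integrable_const)
qed (use mult4_le_power4[where c = 1 and d = 1] in auto)

lemma integrable_u: "integrable M (u t)"
proof (rule Bochner_Integration.integrable_bound)
  show "integrable M (\<lambda>w. norm (u t w) ^ 4 + 1 ^ 4 + 1 ^ 4 + 1 ^ 4)"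
    by (intro Bochner_Integration.integrable_add integrable_norm_power4 integrable_const)
qed (use mult4_le_power4[where b = 1 and c = 1 and d = 1] in auto)

lemma integrable_tensor: "integrable M (\<lambda>w. u s w \<otimes>\<^sub>H u t w)"
  by (rule integrable_norm_cancel) (simp_all add: integrable_norm2)

lemma integral_tensor: "(\<integral>w. u s w \<otimes>\<^sub>H u t w \<partial>M) = C (s - t)"
proof -
  have st: "(\<integral>w. u a w \<otimes>\<^sub>H u b w \<partial>M) = (\<integral>w. u 0 w \<otimes>\<^sub>H u (b - a) w \<partial>M)" for a b
    using stationary by (auto simp: fourth_order_stationary_def)
  \<comment> \<open>Stationarity moves the first index to 0, whereas \<open>autocov\<close> has its
    second index at 0; normalizing both sides leads to the same pair of indices \<open>0\<close> and
    \<open>t - s\<close>.\<close>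
  show ?thesis unfolding autocov_def st[of s t] st[of "s - t" 0] by simp
qed

lemma integrable_mult2: "integrable M (\<lambda>w. (u s w \<bullet> e) * (u t w \<bullet> f))"
  using integrable_inner_left[where c = "e \<otimes>\<^sub>H f", OF integrable_tensor] by simp

lemma integral_mult2: "(\<integral>w. (u s w \<bullet> e) * (u t w \<bullet> f) \<partial>M) = hs_apply (C (s - t)) f \<bullet> e"
proof -
  have "(\<integral>w. (u s w \<bullet> e) * (u t w \<bullet> f) \<partial>M) = (\<integral>w. (u s w \<otimes>\<^sub>H u t w) \<bullet> (e \<otimes>\<^sub>H f) \<partial>M)" by simp
  also have "\<dots> = C (s - t) \<bullet> (e \<otimes>\<^sub>H f)"
    using integrable_tensor by (subst integral_inner_left) (auto simp: integral_tensor)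
  finally show ?thesis by (simp add: inner_tensor)
qed

lemma autocov_minus: "C (- j) = hs_adjoint (C j)"
proof -
  have "hs_adjoint (C j) = (\<integral>w. hs_adjoint (u j w \<otimes>\<^sub>H u 0 w) \<partial>M)"
    unfolding autocov_def
    by (rule integral_bounded_linear[OF bounded_linear_hs_adjoint integrable_tensor, symmetric])
  then show ?thesis by (simp add: integral_tensor)
qed

text \<open>Stationarity speaks of tensor valued moments; pairing them with an elementary tensor
  passes it to scalars. Normalizing both sides to first index 0 leaves the same time
  differences.\<close>

lemma integral_mult4:
  "(\<integral>w. (u t1 w \<bullet> e1) * (u t2 w \<bullet> e2) * (u t3 w \<bullet> e3) * (u t4 w \<bullet> e4) \<partial>M) =
   (\<integral>w. (u (t1 - s) w \<bullet> e1) * (u (t2 - s) w \<bullet> e2) * (u (t3 - s) w \<bullet> e3) * (u (t4 - s) w \<bullet> e4) \<partial>M)"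
proof -
  let ?T = "\<lambda>t1 t2 t3 t4 w. u t1 w \<otimes>\<^sub>H u t2 w \<otimes>\<^sub>H u t3 w \<otimes>\<^sub>H u t4 w"
  have int: "integrable M (?T t1 t2 t3 t4)" for t1 t2 t3 t4
    by (rule integrable_norm_cancel) (simp_all add: integrable_norm4)
  have eq: "(\<integral>w. (u t1 w \<bullet> e1) * (u t2 w \<bullet> e2) * (u t3 w \<bullet> e3) * (u t4 w \<bullet> e4) \<partial>M) =
     (\<integral>w. ?T t1 t2 t3 t4 w \<partial>M) \<bullet> (e1 \<otimes>\<^sub>H e2 \<otimes>\<^sub>H e3 \<otimes>\<^sub>H e4)" for t1 t2 t3 t4
    using int by (subst integral_inner_left[symmetric]) auto
  have st: "(\<integral>w. ?T t1 t2 t3 t4 w \<partial>M) = (\<integral>w. ?T 0 (t2 - t1) (t3 - t1) (t4 - t1) w \<partial>M)" for t1 t2 t3 t4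
    using stationary unfolding fourth_order_stationary_def by blast
  show ?thesis unfolding eq st[of t1 t2] st[of "t1 - s"] by simp
qed

lemma integrable_mult4:
  "integrable M (\<lambda>w. (u t1 w \<bullet> e1) * (u t2 w \<bullet> e2) * (u t3 w \<bullet> e3) * (u t4 w \<bullet> e4))"
proof -
  have "integrable M (\<lambda>w. u t1 w \<otimes>\<^sub>H u t2 w \<otimes>\<^sub>H u t3 w \<otimes>\<^sub>H u t4 w)"
    by (rule integrable_norm_cancel) (simp_all add: integrable_norm4)
  from integrable_inner_left[where c = "e1 \<otimes>\<^sub>H e2 \<otimes>\<^sub>H e3 \<otimes>\<^sub>H e4", OF this] show ?thesis by simp
qed

lemma cumulant_eq:
  "cumulant M [\<lambda>w. u t1 w \<bullet> f1, \<lambda>w. u t2 w \<bullet> f2, \<lambda>w. u t3 w \<bullet> f3, \<lambda>w. u t4 w \<bullet> f4] =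
     (\<integral>w. (u t1 w \<bullet> f1) * (u t2 w \<bullet> f2) * (u t3 w \<bullet> f3) * (u t4 w \<bullet> f4) \<partial>M)
   - (hs_apply (C (t1 - t2)) f2 \<bullet> f1) * (hs_apply (C (t3 - t4)) f4 \<bullet> f3)
   - (hs_apply (C (t1 - t3)) f3 \<bullet> f1) * (hs_apply (C (t2 - t4)) f4 \<bullet> f2)
   - (hs_apply (C (t1 - t4)) f4 \<bullet> f1) * (hs_apply (C (t2 - t3)) f3 \<bullet> f2)"
proof (subst cumulant_four_centered)
  have z: "(\<integral>w. u t w \<bullet> f \<partial>M) = 0" for t f
    using integral_inner_left[where c = f, OF integrable_u] by (simp add: mean_zero)
  fix i :: nat assume "i < 4"
  then have "i = 0 \<or> i = 1 \<or> i = 2 \<or> i = 3" by auto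
  then show "(\<integral>w. ([\<lambda>w. u t1 w \<bullet> f1, \<lambda>w. u t2 w \<bullet> f2, \<lambda>w. u t3 w \<bullet> f3, \<lambda>w. u t4 w \<bullet> f4] ! i) w \<partial>M) = 0"
    using z by auto
qed (simp add: integral_mult2)

text \<open>The fourth moment and the three pairings are represented separately. \<open>K1\<close>
  lives on \<open>M\<close> and \<open>K2\<close> integrates constants. For the crossed pairings,
  variables sharing a covariance are read from the same coordinate of the product space: 1 with 3
  and 2 with 4 in \<open>K3\<close>, 1 with 4 and 2 with 3 in \<open>K4\<close>.\<close>

lemma cumulant_operator_exists:
  "\<exists>K :: ('a, 'a) hs \<Rightarrow>\<^sub>L ('a, 'a) hs. \<forall>f1 f2 f3 f4. K (f3 \<otimes>\<^sub>H f4) \<bullet> (f1 \<otimes>\<^sub>H f2) =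
     cumulant M [\<lambda>w. u t1 w \<bullet> f1, \<lambda>w. u t2 w \<bullet> f2, \<lambda>w. u t3 w \<bullet> f3, \<lambda>w. u t4 w \<bullet> f4]"
proof -
  note P = prob_space_axioms
  obtain K1 where K1: "\<And>A B. blinfun_apply K1 A \<bullet> B =
      (\<integral>w. ((u t3 w \<otimes>\<^sub>H u t4 w) \<bullet> A) * ((u t1 w \<otimes>\<^sub>H u t2 w) \<bullet> B) \<partial>M)"
    using tensor_operator_exists[of "\<lambda>w. u t3 w \<otimes>\<^sub>H u t4 w" M "\<lambda>w. u t1 w \<otimes>\<^sub>H u t2 w"]
      integrable_norm4[of t3 t4 t1 t2] by (auto simp: mult.assoc)
  obtain K2 where K2: "\<And>A B. blinfun_apply K2 A \<bullet> B =
      (\<integral>w. (C (t3 - t4) \<bullet> A) * (C (t1 - t2) \<bullet> B) \<partial>M)"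
    using tensor_operator_exists[of "\<lambda>w. C (t3 - t4)" M "\<lambda>w. C (t1 - t2)"] by auto
  have "integrable (M \<Otimes>\<^sub>M M) (\<lambda>p. norm (u t3 (fst p) \<otimes>\<^sub>H u t4 (snd p)) * norm (u t1 (fst p) \<otimes>\<^sub>H u t2 (snd p)))"
    using integrable_pair_mult[OF P integrable_norm2[of t3 t1] integrable_norm2[of t4 t2]]
    by (simp add: mult_ac)
  then obtain K3 where K3: "\<And>A B. blinfun_apply K3 A \<bullet> B =
      (\<integral>p. ((u t3 (fst p) \<otimes>\<^sub>H u t4 (snd p)) \<bullet> A) * ((u t1 (fst p) \<otimes>\<^sub>H u t2 (snd p)) \<bullet> B) \<partial>(M \<Otimes>\<^sub>M M))"
    using tensor_operator_exists[of "\<lambda>p. u t3 (fst p) \<otimes>\<^sub>H u t4 (snd p)" "M \<Otimes>\<^sub>M M" "\<lambda>p. u t1 (fst p) \<otimes>\<^sub>H u t2 (snd p)"]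
    by auto
  have "integrable (M \<Otimes>\<^sub>M M) (\<lambda>p. norm (u t3 (fst p) \<otimes>\<^sub>H u t4 (snd p)) * norm (u t1 (snd p) \<otimes>\<^sub>H u t2 (fst p)))"
    using integrable_pair_mult[OF P integrable_norm2[of t3 t2] integrable_norm2[of t4 t1]]
    by (simp add: mult_ac)
  then obtain K4 where K4: "\<And>A B. blinfun_apply K4 A \<bullet> B =
      (\<integral>p. ((u t3 (fst p) \<otimes>\<^sub>H u t4 (snd p)) \<bullet> A) * ((u t1 (snd p) \<otimes>\<^sub>H u t2 (fst p)) \<bullet> B) \<partial>(M \<Otimes>\<^sub>M M))"
    using tensor_operator_exists[of "\<lambda>p. u t3 (fst p) \<otimes>\<^sub>H u t4 (snd p)" "M \<Otimes>\<^sub>M M" "\<lambda>p. u t1 (snd p) \<otimes>\<^sub>H u t2 (fst p)"]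
    by auto
  show ?thesis
  proof (intro exI allI)
    fix f1 f2 f3 f4
    have 1: "K1 (f3 \<otimes>\<^sub>H f4) \<bullet> (f1 \<otimes>\<^sub>H f2) =
        (\<integral>w. (u t1 w \<bullet> f1) * (u t2 w \<bullet> f2) * (u t3 w \<bullet> f3) * (u t4 w \<bullet> f4) \<partial>M)"
      unfolding K1 by (simp add: mult_ac)
    have 2: "K2 (f3 \<otimes>\<^sub>H f4) \<bullet> (f1 \<otimes>\<^sub>H f2) =
        (hs_apply (C (t1 - t2)) f2 \<bullet> f1) * (hs_apply (C (t3 - t4)) f4 \<bullet> f3)"
      unfolding K2 by (simp add: inner_tensor prob_space)
    have 3: "K3 (f3 \<otimes>\<^sub>H f4) \<bullet> (f1 \<otimes>\<^sub>H f2) =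
        (hs_apply (C (t1 - t3)) f3 \<bullet> f1) * (hs_apply (C (t2 - t4)) f4 \<bullet> f2)"
      using integral_pair_mult[OF P integrable_mult2[of t1 f1 t3 f3] integrable_mult2[of t2 f2 t4 f4]]
      unfolding K3 integral_mult2 by (simp add: mult_ac)
    have 4: "K4 (f3 \<otimes>\<^sub>H f4) \<bullet> (f1 \<otimes>\<^sub>H f2) =
        (hs_apply (C (t1 - t4)) f4 \<bullet> f1) * (hs_apply (C (t2 - t3)) f3 \<bullet> f2)"
      using integral_pair_mult[OF P integrable_mult2[of t2 f2 t3 f3] integrable_mult2[of t1 f1 t4 f4]]
      unfolding K4 integral_mult2 by (simp add: mult_ac)
    show "(K1 - K2 - K3 - K4) (f3 \<otimes>\<^sub>H f4) \<bullet> (f1 \<otimes>\<^sub>H f2) =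
       cumulant M [\<lambda>w. u t1 w \<bullet> f1, \<lambda>w. u t2 w \<bullet> f2, \<lambda>w. u t3 w \<bullet> f3, \<lambda>w. u t4 w \<bullet> f4]"
      unfolding blinfun.diff_left inner_diff_left 1 2 3 4 cumulant_eq by simp
  qed
qed

text \<open>Resolves the definite description: the operator exists by the preceding construction and
  is determined by its values on elementary tensors.\<close>

lemma cumulant_operator:
  "cumulant_operator M u t1 t2 t3 (f3 \<otimes>\<^sub>H f4) \<bullet> (f1 \<otimes>\<^sub>H f2) =
     cumulant M [\<lambda>w. u t1 w \<bullet> f1, \<lambda>w. u t2 w \<bullet> f2, \<lambda>w. u t3 w \<bullet> f3, \<lambda>w. u 0 w \<bullet> f4]"
proof -
  let ?P = "\<lambda>K :: ('a, 'a) hs \<Rightarrow>\<^sub>L ('a, 'a) hs. \<forall>f1 f2 f3 f4. K (f3 \<otimes>\<^sub>H f4) \<bullet> (f1 \<otimes>\<^sub>H f2) =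
     cumulant M [\<lambda>w. u t1 w \<bullet> f1, \<lambda>w. u t2 w \<bullet> f2, \<lambda>w. u t3 w \<bullet> f3, \<lambda>w. u 0 w \<bullet> f4]"
  obtain K where K: "?P K" using cumulant_operator_exists[of t1 t2 t3 0] by blast
  have "?P (THE K. ?P K)"
  proof (rule theI[of ?P, OF K])
    fix L assume "?P L"
    with K show "L = K" by (intro blinfun_hs_eqI) simp
  qed
  then show ?thesis unfolding cumulant_operator_def by blast
qed

end

subsection \<open>Second moments of the sample autocovariances\<close>

text \<open>Distinct members are at distance \<open>sqrt 2\<close>, so the balls of radius 1/2
  around them are disjoint, and a second countable space has only countably many disjoint nonempty
  open sets.\<close>

lemma orthonormal_countable:
  fixes S :: "'a::{real_inner,second_countable_topology} set"
  assumes "orthonormal S"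
  shows "countable S"
proof -
  have d: "dist e f \<ge> 1" if "e \<in> S" "f \<in> S" "e \<noteq> f" for e f
  proof -
    have "(dist e f)\<^sup>2 = 2"
      using orthonormal_inner[OF assms] that
      by (simp add: dist_norm power2_norm_eq_inner inner_diff_left inner_diff_right)
    then have "1\<^sup>2 \<le> (dist e f)\<^sup>2" by simp
    then show ?thesis by (rule power2_le_imp_le) simp
  qed
  have dj: "disjnt (ball e (1/2)) (ball f (1/2))" if "e \<in> S" "f \<in> S" "e \<noteq> f" for e f
    unfolding disjnt_iff
  proof (intro allI notI, elim conjE)
    fix x assume "x \<in> ball e (1/2)" "x \<in> ball f (1/2)"
    then have "dist e x < 1/2" "dist f x < 1/2" by auto
    then show False using d[OF that] dist_triangle2[of e f x] by linarith
  qed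
  have "countable ((\<lambda>e. ball e (1/2)) ` S)"
  proof (rule countable_disjoint_open_subsets)
    show "pairwise disjnt ((\<lambda>e. ball e (1/2)) ` S)"
      unfolding pairwise_image using dj by (auto simp: pairwise_def)
  qed auto
  moreover have "inj_on (\<lambda>e. ball e (1/2::real)) S"
    using dj by (intro inj_onI) (metis centre_in_ball disjnt_iff half_gt_zero zero_less_one)
  ultimately show ?thesis by (rule countable_image_inj_on)
qed

text \<open>Basis expansions converge along the filter of finite subsets, whereas dominated
  convergence is about sequences. The elements of \<open>S\<close> numbered below \<open>m\<close>
  form a sequence that follows the filter.\<close>

lemma finite_exhaustion:
  assumes "countable S"
  obtains E :: "nat \<Rightarrow> 'a set" where "\<And>m. finite (E m)" "\<And>m. E m \<subseteq> S"
    "filterlim E (finite_subsets_at_top S) sequentially"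
proof
  let ?E = "\<lambda>m. {e \<in> S. to_nat_on S e < m}"
  have inj: "inj_on (to_nat_on S) S" by (rule inj_on_to_nat_on[OF assms])
  show "finite (?E m)" for m
    by (rule finite_imageD[of "to_nat_on S"]) (auto intro: finite_subset[of _ "{..<m}"] inj_on_subset[OF inj])
  show "filterlim ?E (finite_subsets_at_top S) sequentially"
    unfolding filterlim_finite_subsets_at_top
  proof (intro allI impI)
    fix X assume X: "finite X \<and> X \<subseteq> S"
    have "eventually (\<lambda>m. \<forall>e\<in>X. to_nat_on S e < m) sequentially"
      using X by (intro eventually_ball_finite) (auto intro: eventually_gt_at_top)
    then show "\<forall>\<^sub>F m in sequentially. finite (?E m) \<and> X \<subseteq> ?E m \<and> ?E m \<subseteq> S"
      using X \<open>\<And>m. finite (?E m)\<close> by (auto elim!: eventually_mono)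
  qed
qed auto

lemma parseval_inner:
  fixes S :: "'a::{real_inner,banach} set"
  assumes "orthonormal_basis S"
  shows "((\<lambda>e. (x \<bullet> e) * (y \<bullet> e)) has_sum (x \<bullet> y)) S"
  using has_sum_bounded_linear[OF bounded_linear_inner_right[of y] orthonormal_basis_expansion[OF assms, of x]]
  by (simp add: inner_commute[of x y])

text \<open>A sum in \<open>ennreal\<close> is the supremum of its finite sums, so a finite bound
  makes every term finite and survives the passage to reals for every finite
  \<open>F\<close>.\<close>

lemma ennreal_infsum_bounds:
  fixes f :: "'i \<Rightarrow> ennreal"
  assumes le: "(\<Sum>\<^sub>\<infinity>i. f i) \<le> L" and L: "L < \<infinity>"
  shows "f i < \<infinity>" and "finite F \<Longrightarrow> (\<Sum>i\<in>F. enn2real (f i)) \<le> enn2real L"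
proof -
  have fin: "sum f F \<le> L" if "finite F" for F
    using le SUP_upper[of F "{F. finite F \<and> F \<subseteq> UNIV}" "sum f"] that
    by (subst (asm) nonneg_infsum_complete) auto
  have lt: "f i < \<infinity>" for i using fin[of "{i}"] L by (auto intro: le_less_trans)
  show "f i < \<infinity>" by (rule lt)
  assume F: "finite F"
  have "(\<Sum>i\<in>F. enn2real (f i)) = enn2real (sum f F)"
    using lt by (subst enn2real_sum) auto
  also have "\<dots> \<le> enn2real L" using fin[OF F] L by (intro enn2real_mono) auto
  finally show "(\<Sum>i\<in>F. enn2real (f i)) \<le> enn2real L" .
qed

section \<open>Fourth moments expanded in an orthonormal basis\<close>

context centered_stationary
begin

lemma integrable_inner_mult: "integrable M (\<lambda>w. (u a w \<bullet> u c w) * (u b w \<bullet> u d w))"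
proof (rule Bochner_Integration.integrable_bound[OF integrable_norm4[of a c b d]])
  show "AE w in M. norm ((u a w \<bullet> u c w) * (u b w \<bullet> u d w)) \<le> norm (norm (u a w) * norm (u c w) * norm (u b w) * norm (u d w))"
  proof (rule AE_I2)
    fix w
    show "norm ((u a w \<bullet> u c w) * (u b w \<bullet> u d w)) \<le> norm (norm (u a w) * norm (u c w) * norm (u b w) * norm (u d w))"
      using mult_mono[OF Cauchy_Schwarz_ineq2[of "u a w" "u c w"] Cauchy_Schwarz_ineq2[of "u b w" "u d w"]]
      by (simp add: abs_mult mult.assoc)
  qed
qed measurable

text \<open>On a finite section the double sum factors into two partial Parseval sums. Each is
  bounded by a product of two norms, so the product of the four norms is an integrable
  majorant.\<close>

lemma integral_inner_mult_limit:
  assumes E: "\<And>m. finite (E m)" "\<And>m. E m \<subseteq> onb" "filterlim E (finite_subsets_at_top onb) sequentially"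
  shows "(\<lambda>m. \<Sum>e\<in>E m. \<Sum>f\<in>E m. \<integral>w. (u a w \<bullet> e) * (u b w \<bullet> f) * (u c w \<bullet> e) * (u d w \<bullet> f) \<partial>M)
    \<longlonglongrightarrow> (\<integral>w. (u a w \<bullet> u c w) * (u b w \<bullet> u d w) \<partial>M)"
proof -
  let ?S = "\<lambda>m w. (\<Sum>e\<in>E m. (u a w \<bullet> e) * (u c w \<bullet> e)) * (\<Sum>f\<in>E m. (u b w \<bullet> f) * (u d w \<bullet> f))"
  have eq: "(\<Sum>e\<in>E m. \<Sum>f\<in>E m. \<integral>w. (u a w \<bullet> e) * (u b w \<bullet> f) * (u c w \<bullet> e) * (u d w \<bullet> f) \<partial>M) = (\<integral>w. ?S m w \<partial>M)" for m
  proof -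
    have "(\<Sum>e\<in>E m. \<Sum>f\<in>E m. \<integral>w. (u a w \<bullet> e) * (u b w \<bullet> f) * (u c w \<bullet> e) * (u d w \<bullet> f) \<partial>M)
      = (\<integral>w. (\<Sum>e\<in>E m. \<Sum>f\<in>E m. (u a w \<bullet> e) * (u b w \<bullet> f) * (u c w \<bullet> e) * (u d w \<bullet> f)) \<partial>M)"
      by (simp add: Bochner_Integration.integral_sum integrable_mult4)
    also have "\<dots> = (\<integral>w. ?S m w \<partial>M)"
      by (intro Bochner_Integration.integral_cong refl) (simp add: sum_product mult_ac)
    finally show ?thesis .
  qed
  have lim: "(\<lambda>m. \<Sum>e\<in>E m. (x \<bullet> e) * (y \<bullet> e)) \<longlonglongrightarrow> x \<bullet> y" for x y
    using filterlim_compose[OF parseval_inner[OF onb, unfolded has_sum_def] E(3)] by simp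
  have bd: "\<bar>\<Sum>e\<in>E m. (x \<bullet> e) * (y \<bullet> e)\<bar> \<le> norm x * norm y" for x y m
    using inner_sums_le_norm[where x = x and y = y, OF onb_orthonormal E(1,2)[of m]] by (simp add: inner_commute mult.commute)
  show ?thesis
    unfolding eq
  proof (rule integral_dominated_convergence[where w = "\<lambda>w. norm (u a w) * norm (u c w) * norm (u b w) * norm (u d w)"])
    show "integrable M (\<lambda>w. norm (u a w) * norm (u c w) * norm (u b w) * norm (u d w))"
      by (rule integrable_norm4)
    show "AE w in M. (\<lambda>m. ?S m w) \<longlonglongrightarrow> (u a w \<bullet> u c w) * (u b w \<bullet> u d w)"
      by (intro AE_I2 tendsto_mult lim)
    show "AE w in M. norm (?S m w) \<le> norm (u a w) * norm (u c w) * norm (u b w) * norm (u d w)" for m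
    proof (rule AE_I2)
      fix w
      show "norm (?S m w) \<le> norm (u a w) * norm (u c w) * norm (u b w) * norm (u d w)"
        unfolding real_norm_def abs_mult mult.assoc[of _ _ "norm (u d w)"] by (intro mult_mono bd) auto
    qed
  qed measurable
qed

text \<open>The moment is a limit of double sums over sections of the basis, in which each summand
  is a cumulant plus three products of covariances. These sum to a partial trace of the cumulant
  operator, a section of the squared norm of \<open>C j\<close>, the square of a partial trace of
  \<open>C (t - s)\<close>, and a crossed product. The term \<open>(norm (C j))\<^sup>2\<close> is
  kept apart because centering removes it.\<close>

lemma integral_inner_mult_le:
  assumes K: "nuclear_norm (cumulant_operator M u (t - s + j) (t - s) j) < \<infinity>"
    and N: "nuclear_norm (hs_blinfun (C (t - s))) < \<infinity>"
  shows "(\<integral>w. (u t w \<bullet> u s w) * (u (t - j) w \<bullet> u (s - j) w) \<partial>M) \<le> (norm (C j))\<^sup>2 +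
    (enn2real (nuclear_norm (cumulant_operator M u (t - s + j) (t - s) j)) +
     (enn2real (nuclear_norm (hs_blinfun (C (t - s)))))\<^sup>2 + norm (C (t - s + j)) * norm (C (t - s - j)))"
proof -
  define h where "h = t - s"
  let ?K = "cumulant_operator M u (h + j) h j"
  obtain E :: "nat \<Rightarrow> 'a set" where E: "\<And>m. finite (E m)" "\<And>m. E m \<subseteq> onb"
    "filterlim E (finite_subsets_at_top onb) sequentially"
    using finite_exhaustion[OF orthonormal_countable[OF onb_orthonormal]] by metis
  have expand: "(\<integral>w. (u t w \<bullet> e) * (u (t - j) w \<bullet> f) * (u s w \<bullet> e) * (u (s - j) w \<bullet> f) \<partial>M) =
      ?K (e \<otimes>\<^sub>H f) \<bullet> (e \<otimes>\<^sub>H f) + (hs_apply (C j) f \<bullet> e) * (hs_apply (hs_adjoint (C j)) e \<bullet> f)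
      + (hs_apply (C h) e \<bullet> e) * (hs_apply (C h) f \<bullet> f) + (hs_apply (C (h + j)) f \<bullet> e) * (hs_apply (C (h - j)) e \<bullet> f)" for e f
  proof -
    have adj: "hs_apply (hs_adjoint (C j)) e \<bullet> f = hs_apply (C j) f \<bullet> e"
      by (metis inner_hs_adjoint inner_commute)
    \<comment> \<open>Shifting by \<open>s - j\<close> brings the four times to
      \<open>h + j\<close>, \<open>h\<close>, \<open>j\<close>, \<open>0\<close>, the form in which
      the cumulant operator is indexed.\<close>
    have "(\<integral>w. (u t w \<bullet> e) * (u (t - j) w \<bullet> f) * (u s w \<bullet> e) * (u (s - j) w \<bullet> f) \<partial>M) =
      (\<integral>w. (u (h + j) w \<bullet> e) * (u h w \<bullet> f) * (u j w \<bullet> e) * (u 0 w \<bullet> f) \<partial>M)"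
      by (subst integral_mult4[where s = "s - j"]) (simp add: h_def algebra_simps)
    then show ?thesis
      unfolding cumulant_operator cumulant_eq adj by simp
  qed
  have le: "(\<Sum>e\<in>E m. \<Sum>f\<in>E m. \<integral>w. (u t w \<bullet> e) * (u (t - j) w \<bullet> f) * (u s w \<bullet> e) * (u (s - j) w \<bullet> f) \<partial>M)
     \<le> (norm (C j))\<^sup>2 + (enn2real (nuclear_norm ?K) + (enn2real (nuclear_norm (hs_blinfun (C h))))\<^sup>2 + norm (C (h + j)) * norm (C (h - j)))" for m
  proof -
    note F = E(1,2)[of m]
    have 1: "(\<Sum>e\<in>E m. \<Sum>f\<in>E m. ?K (e \<otimes>\<^sub>H f) \<bullet> (e \<otimes>\<^sub>H f)) \<le> enn2real (nuclear_norm ?K)"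
      using enn2real_mono[OF sum_inner_tensor_le_nuclear_norm[OF F F, of ?K]] K by (simp add: h_def)
    have 2: "(\<Sum>e\<in>E m. \<Sum>f\<in>E m. (hs_apply (C j) f \<bullet> e) * (hs_apply (hs_adjoint (C j)) e \<bullet> f)) \<le> (norm (C j))\<^sup>2"
      using sum_hs_product_le[OF F F, of "C j" "hs_adjoint (C j)"] by (simp add: power2_eq_square)
    have "\<bar>\<Sum>e\<in>E m. hs_apply (C h) e \<bullet> e\<bar> \<le> enn2real (nuclear_norm (hs_blinfun (C h)))"
      using enn2real_mono[OF trace_le_nuclear_norm[OF onb_orthonormal F, of "hs_blinfun (C h)"]] N by (simp add: h_def)
    from power_mono[OF this, of 2]
    have 3: "(\<Sum>e\<in>E m. \<Sum>f\<in>E m. (hs_apply (C h) e \<bullet> e) * (hs_apply (C h) f \<bullet> f)) \<le> (enn2real (nuclear_norm (hs_blinfun (C h))))\<^sup>2"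
      by (simp add: sum_product[symmetric] power2_eq_square)
    have 4: "(\<Sum>e\<in>E m. \<Sum>f\<in>E m. (hs_apply (C (h + j)) f \<bullet> e) * (hs_apply (C (h - j)) e \<bullet> f)) \<le> norm (C (h + j)) * norm (C (h - j))"
      using sum_hs_product_le[OF F F, of "C (h + j)" "C (h - j)"] by simp
    show ?thesis using 1 2 3 4 unfolding expand sum.distrib by simp
  qed
  show ?thesis
    using LIMSEQ_le_const2[OF integral_inner_mult_limit[OF E, of t "t - j" s "s - j"]] le unfolding h_def by blast
qed

end

text \<open>A bound valid for all finite index sets is insensitive to injective reindexing; it
  serves for translated lags.\<close>

lemma sum_inj_translate_le:
  fixes b :: "'i \<Rightarrow> real"
  assumes "\<And>F. finite F \<Longrightarrow> sum b F \<le> B" "finite T" and g: "inj_on g T"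
  shows "(\<Sum>t\<in>T. b (g t)) \<le> B"
  using assms(1)[of "g ` T"] assms(2) by (simp add: sum.reindex[OF g])

section \<open>Mean square deviation of the sample autocovariances\<close>

context centered_stationary
begin

lemma measurable_sample_autocov [measurable]:
  assumes "0 \<le> j"
  shows "(\<lambda>w. sample_autocov (\<lambda>t. u t w) n j) \<in> borel_measurable M"
  using assms by (simp add: sample_autocov_def Let_def)

lemma sample_autocov_deviation:
  assumes j: "0 \<le> j" "j < int n"
  shows "sample_autocov (\<lambda>t. u t w) n j - (1 - of_int j / real n) *\<^sub>R C j =
    (1 / real n) *\<^sub>R (\<Sum>t=j+1..int n. u t w \<otimes>\<^sub>H u (t - j) w - C j)"
proof -
  \<comment> \<open>The estimator has \<open>n - j\<close> summands but is divided by
    \<open>n\<close>, whence the bias factor.\<close>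
  have "1 - of_int j / real n = (1 / real n) * real (card {j+1..int n})"
    using j by (simp add: field_simps)
  then show ?thesis
    using j by (simp add: sample_autocov_def sum_subtractf scaleR_diff_right sum_constant_scaleR del: card_atLeastAtMost_int)
qed

text \<open>By stationarity every \<open>u t w \<otimes>\<^sub>H u (t - j) w\<close> has mean
  \<open>C j\<close>, so centering subtracts exactly the pairing term
  \<open>(norm (C j))\<^sup>2\<close> from the mixed moment.\<close>

lemma
  shows integrable_inner_deviation:
      "integrable M (\<lambda>w. (u t w \<otimes>\<^sub>H u (t - j) w - C j) \<bullet> (u s w \<otimes>\<^sub>H u (s - j) w - C j))" (is ?A)
    and integral_inner_deviation:
      "(\<integral>w. (u t w \<otimes>\<^sub>H u (t - j) w - C j) \<bullet> (u s w \<otimes>\<^sub>H u (s - j) w - C j) \<partial>M) =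
        (\<integral>w. (u t w \<bullet> u s w) * (u (t - j) w \<bullet> u (s - j) w) \<partial>M) - (norm (C j))\<^sup>2" (is ?B)
proof -
  let ?X = "\<lambda>t w. u t w \<otimes>\<^sub>H u (t - j) w"
  have eq: "(?X t w - C j) \<bullet> (?X s w - C j) =
      (u t w \<bullet> u s w) * (u (t - j) w \<bullet> u (s - j) w) - ?X t w \<bullet> C j - ?X s w \<bullet> C j + C j \<bullet> C j" for w
    by (simp add: inner_diff_left inner_diff_right inner_commute)
  have i: "integrable M (\<lambda>w. ?X t w \<bullet> C j)" for t
    using integrable_tensor by (intro integrable_inner_left) auto
  have v: "(\<integral>w. ?X t w \<bullet> C j \<partial>M) = C j \<bullet> C j" for t
    using integrable_tensor by (subst integral_inner_left) (auto simp: integral_tensor)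
  show ?A unfolding eq by (intro Bochner_Integration.integrable_add Bochner_Integration.integrable_diff integrable_inner_mult i integrable_const)
  show ?B unfolding eq by (simp add: integrable_inner_mult i v prob_space power2_norm_eq_inner)
qed

lemma autocov_square_sum_le:
  assumes N: "(\<Sum>\<^sub>\<infinity>j. (nuclear_norm (hs_blinfun (C j)))\<^sup>2) < \<infinity>" and F: "finite F"
  shows "(\<Sum>j\<in>F. (norm (C j))\<^sup>2) \<le> enn2real (\<Sum>\<^sub>\<infinity>j. (nuclear_norm (hs_blinfun (C j)))\<^sup>2)"
proof -
  have "(\<Sum>j\<in>F. (norm (C j))\<^sup>2) \<le> (\<Sum>j\<in>F. enn2real ((nuclear_norm (hs_blinfun (C j)))\<^sup>2))"
  proof (rule sum_mono)
    fix j
    have "ennreal ((norm (C j))\<^sup>2) \<le> (nuclear_norm (hs_blinfun (C j)))\<^sup>2"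
      using power_mono[OF norm_le_nuclear_norm[of "C j"], of 2] by (simp add: ennreal_power)
    from enn2real_mono[OF this] show "(norm (C j))\<^sup>2 \<le> enn2real ((nuclear_norm (hs_blinfun (C j)))\<^sup>2)"
      using ennreal_infsum_bounds(1)[OF order_refl N, of j] by simp
  qed
  also have "\<dots> \<le> enn2real (\<Sum>\<^sub>\<infinity>j. (nuclear_norm (hs_blinfun (C j)))\<^sup>2)"
    by (rule ennreal_infsum_bounds(2)[OF order_refl N F])
  finally show ?thesis .
qed

text \<open>The squared deviation is \<open>1 / n\<^sup>2\<close> times a double sum of covariances,
  each at most \<open>b j (t - s)\<close>. Since \<open>b j\<close> depends on the times only
  through their lag, every row sums to at most \<open>L1 + 2 * L2\<close>, and there are at most
  \<open>n\<close> rows. \<open>L1\<close> bounds the cumulant sums uniformly in \<open>j\<close>;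
  \<open>L2\<close> enters once for the squared traces and once for the crossed products.\<close>

proposition sample_autocov_mean_square_bound:
  assumes N: "(\<Sum>\<^sub>\<infinity>j. (nuclear_norm (hs_blinfun (C j)))\<^sup>2) < \<infinity>"
    and K: "(SUP j. \<Sum>\<^sub>\<infinity>h. nuclear_norm (cumulant_operator M u (h + j) h j)) < \<infinity>"
  obtains B where "0 \<le> B"
    and "\<And>n j. 0 \<le> j \<Longrightarrow> j < int n \<Longrightarrow>
      integrable M (\<lambda>w. (norm (sample_autocov (\<lambda>t. u t w) n j - (1 - of_int j / real n) *\<^sub>R C j))\<^sup>2)"
    and "\<And>n j. 0 \<le> j \<Longrightarrow> j < int n \<Longrightarrow>
      (\<integral>w. (norm (sample_autocov (\<lambda>t. u t w) n j - (1 - of_int j / real n) *\<^sub>R C j))\<^sup>2 \<partial>M) \<le> B / real n"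
proof -
  define L1 where "L1 = enn2real (SUP j. \<Sum>\<^sub>\<infinity>h. nuclear_norm (cumulant_operator M u (h + j) h j))"
  define L2 where "L2 = enn2real (\<Sum>\<^sub>\<infinity>j. (nuclear_norm (hs_blinfun (C j)))\<^sup>2)"
  define \<kappa> where "\<kappa> h j = enn2real (nuclear_norm (cumulant_operator M u (h + j) h j))" for h j
  define \<nu> where "\<nu> h = enn2real (nuclear_norm (hs_blinfun (C h)))" for h
  have Kj: "(\<Sum>\<^sub>\<infinity>h. nuclear_norm (cumulant_operator M u (h + j) h j)) \<le>
      (SUP j. \<Sum>\<^sub>\<infinity>h. nuclear_norm (cumulant_operator M u (h + j) h j))" for j
    by (rule SUP_upper) simp
  have K_fin: "nuclear_norm (cumulant_operator M u (h + j) h j) < \<infinity>" for h j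
    by (rule ennreal_infsum_bounds(1)[OF Kj K])
  have N_fin: "nuclear_norm (hs_blinfun (C h)) < \<infinity>" for h
    using ennreal_infsum_bounds(1)[OF order_refl N, of h] by (simp add: power_less_top_ennreal)
  have s1: "(\<Sum>h\<in>F. \<kappa> h j) \<le> L1" if "finite F" for F j
    unfolding \<kappa>_def L1_def by (rule ennreal_infsum_bounds(2)[OF Kj K that])
  have s2: "(\<Sum>h\<in>F. (\<nu> h)\<^sup>2) \<le> L2" if "finite F" for F
    using ennreal_infsum_bounds(2)[OF order_refl N that] by (simp add: \<nu>_def L2_def power2_eq_square enn2real_mult)
  have s3: "(\<Sum>h\<in>F. (norm (C h))\<^sup>2) \<le> L2" if "finite F" for F
    unfolding L2_def by (rule autocov_square_sum_le[OF N that])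
  \<comment> \<open>The arithmetic-geometric inequality separates the two lags; each half is a
    translate of the same square summable family.\<close>
  have s4: "(\<Sum>h\<in>F. norm (C (h + j)) * norm (C (h - j))) \<le> L2" if F: "finite F" for F j
  proof -
    have "(\<Sum>h\<in>F. norm (C (h + j)) * norm (C (h - j))) \<le> (\<Sum>h\<in>F. ((norm (C (h + j)))\<^sup>2 + (norm (C (h - j)))\<^sup>2) / 2)"
    proof (rule sum_mono)
      fix h
      show "norm (C (h + j)) * norm (C (h - j)) \<le> ((norm (C (h + j)))\<^sup>2 + (norm (C (h - j)))\<^sup>2) / 2"
        using sum_squares_bound[of "norm (C (h + j))" "norm (C (h - j))"] by simp
    qed
    also have "\<dots> = ((\<Sum>h\<in>F. (norm (C (h + j)))\<^sup>2) + (\<Sum>h\<in>F. (norm (C (h - j)))\<^sup>2)) / 2"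
      by (simp add: sum.distrib flip: sum_divide_distrib)
    also have "\<dots> \<le> (L2 + L2) / 2"
      using sum_inj_translate_le[OF s3 F, of "\<lambda>h. h + j"] sum_inj_translate_le[OF s3 F, of "\<lambda>h. h - j"]
      by (intro divide_right_mono add_mono) (auto simp: inj_on_def)
    finally show ?thesis by simp
  qed
  define b where "b j h = \<kappa> h j + (\<nu> h)\<^sup>2 + norm (C (h + j)) * norm (C (h - j))" for j h
  have sb: "sum (b j) F \<le> L1 + 2 * L2" if "finite F" for F j
    using s1[OF that, of j] s2[OF that] s4[OF that, of j] by (simp add: b_def sum.distrib)
  have cov: "(\<integral>w. (u t w \<otimes>\<^sub>H u (t - j) w - C j) \<bullet> (u s w \<otimes>\<^sub>H u (s - j) w - C j) \<partial>M) \<le> b j (t - s)" for t s j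
    using integral_inner_mult_le[OF K_fin N_fin, of t s j] unfolding integral_inner_deviation by (simp add: b_def \<kappa>_def \<nu>_def)
  have L: "0 \<le> L1 + 2 * L2" by (simp add: L1_def L2_def)
  have sq: "(norm (sample_autocov (\<lambda>t. u t w) n j - (1 - of_int j / real n) *\<^sub>R C j))\<^sup>2 =
      (1 / real n)\<^sup>2 * (\<Sum>s=j+1..int n. \<Sum>t=j+1..int n. (u t w \<otimes>\<^sub>H u (t - j) w - C j) \<bullet> (u s w \<otimes>\<^sub>H u (s - j) w - C j))"
    if "0 \<le> j" "j < int n" for n j w
    unfolding sample_autocov_deviation[OF that] norm_scaleR power_mult_distrib
    by (simp add: power2_norm_eq_inner inner_sum_left inner_sum_right)
  show ?thesis
  proof (rule that[OF L])
    fix n :: nat and j :: int assume j: "0 \<le> j" "j < int n"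
    show "integrable M (\<lambda>w. (norm (sample_autocov (\<lambda>t. u t w) n j - (1 - of_int j / real n) *\<^sub>R C j))\<^sup>2)"
      unfolding sq[OF j] by (intro integrable_mult_right Bochner_Integration.integrable_sum integrable_inner_deviation)
    have "(\<integral>w. (norm (sample_autocov (\<lambda>t. u t w) n j - (1 - of_int j / real n) *\<^sub>R C j))\<^sup>2 \<partial>M) =
      (1 / real n)\<^sup>2 * (\<Sum>s=j+1..int n. \<Sum>t=j+1..int n. \<integral>w. (u t w \<otimes>\<^sub>H u (t - j) w - C j) \<bullet> (u s w \<otimes>\<^sub>H u (s - j) w - C j) \<partial>M)"
      unfolding sq[OF j] by (simp add: Bochner_Integration.integral_sum integrable_inner_deviation Bochner_Integration.integrable_sum)
    also have "\<dots> \<le> (1 / real n)\<^sup>2 * (\<Sum>s=j+1..int n. \<Sum>t=j+1..int n. b j (t - s))"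
      by (intro mult_left_mono sum_mono cov) auto
    also have "\<dots> \<le> (1 / real n)\<^sup>2 * (\<Sum>s=j+1..int n. L1 + 2 * L2)"
      by (intro mult_left_mono sum_mono sum_inj_translate_le[OF sb]) (auto simp: inj_on_def)
    also have "\<dots> \<le> (1 / real n)\<^sup>2 * (real n * (L1 + 2 * L2))"
      using j L by (intro mult_left_mono) (auto simp: mult_right_mono)
    also have "\<dots> = (L1 + 2 * L2) / real n" by (simp add: power2_eq_square)
    finally show "(\<integral>w. (norm (sample_autocov (\<lambda>t. u t w) n j - (1 - of_int j / real n) *\<^sub>R C j))\<^sup>2 \<partial>M) \<le> (L1 + 2 * L2) / real n" .
  qed
qed

end

subsection \<open>Fourier series with values in a Hilbert space\<close>

text \<open>Riesz-Fischer for Banach space values: a rapidly Cauchy subsequence converges almost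
  everywhere, and Fatou's lemma transfers the Cauchy estimate to its limit, which controls the whole
  sequence.\<close>

lemma L2_complete:
  fixes S :: "nat \<Rightarrow> 'x \<Rightarrow> 'b::{banach,second_countable_topology}"
  assumes [measurable]: "\<And>n. S n \<in> borel_measurable M"
    and cauchy: "\<And>e::real. e > 0 \<Longrightarrow> \<exists>N. \<forall>m\<ge>N. \<forall>n\<ge>N. (\<integral>\<^sup>+x. ennreal ((norm (S m x - S n x))\<^sup>2) \<partial>M) \<le> ennreal e"
  obtains F where "F \<in> borel_measurable M"
    and "(\<lambda>n. \<integral>\<^sup>+x. ennreal ((norm (F x - S n x))\<^sup>2) \<partial>M) \<longlonglongrightarrow> 0"
proof -
  have "\<exists>N. \<forall>m\<ge>N. \<forall>n\<ge>N. (\<integral>\<^sup>+x. ennreal ((norm (S m x - S n x))\<^sup>2) \<partial>M) \<le> ennreal ((1/4) ^ k)" for k :: nat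
    by (rule cauchy) simp
  then obtain N where N: "\<And>k m n. N k \<le> m \<Longrightarrow> N k \<le> n \<Longrightarrow>
      (\<integral>\<^sup>+x. ennreal ((norm (S m x - S n x))\<^sup>2) \<partial>M) \<le> ennreal ((1/4) ^ k)" by metis
  \<comment> \<open>Partial sums of \<open>N\<close> dominate every \<open>N j\<close> with
    \<open>j \<le> k\<close>, so both \<open>r k\<close> and \<open>r (Suc k)\<close> lie beyond
    \<open>N k\<close>.\<close>
  define r where "r k = (\<Sum>i\<le>k. N i)" for k
  have r: "N j \<le> r k" if "j \<le> k" for j k
    unfolding r_def using member_le_sum[of j "{..k}" N] that by auto
  define d where "d k x = S (r (Suc k)) x - S (r k) x" for k x
  have [measurable]: "d k \<in> borel_measurable M" for k unfolding d_def by measurable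
  \<comment> \<open>The weights \<open>2\<^sup>k\<close> give almost everywhere absolute convergence without assuming a finite measure.\<close>
  have "(\<integral>\<^sup>+x. (\<Sum>k. ennreal (2 ^ k * (norm (d k x))\<^sup>2)) \<partial>M) = (\<Sum>k. \<integral>\<^sup>+x. ennreal (2 ^ k * (norm (d k x))\<^sup>2) \<partial>M)"
    by (rule nn_integral_suminf) measurable
  also have "\<dots> \<le> (\<Sum>k. ennreal ((1/2) ^ k))"
  proof (rule suminf_le)
    fix k
    have "(\<integral>\<^sup>+x. ennreal (2 ^ k * (norm (d k x))\<^sup>2) \<partial>M) = ennreal (2 ^ k) * (\<integral>\<^sup>+x. ennreal ((norm (d k x))\<^sup>2) \<partial>M)"
      by (simp add: ennreal_mult nn_integral_cmult)
    also have "\<dots> \<le> ennreal (2 ^ k) * ennreal ((1/4) ^ k)"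
      unfolding d_def by (intro mult_left_mono N r) auto
    also have "\<dots> = ennreal ((1/2) ^ k)"
      by (simp add: power_mult_distrib[symmetric] flip: ennreal_mult)
    finally show "(\<integral>\<^sup>+x. ennreal (2 ^ k * (norm (d k x))\<^sup>2) \<partial>M) \<le> ennreal ((1/2) ^ k)" .
  qed auto
  also have "\<dots> = ennreal 2"
    by (rule suminf_ennreal_eq) (use geometric_sums[of "1/2::real"] in auto)
  also have "\<dots> < \<infinity>" by simp
  finally have "AE x in M. (\<Sum>k. ennreal (2 ^ k * (norm (d k x))\<^sup>2)) \<noteq> \<infinity>"
    by (intro nn_integral_PInf_AE) auto
  then have conv: "AE x in M. convergent (\<lambda>k. S (r k) x)"
  proof eventually_elim
    fix x assume "(\<Sum>k. ennreal (2 ^ k * (norm (d k x))\<^sup>2)) \<noteq> \<infinity>"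
    then have "summable (\<lambda>k. 2 ^ k * (norm (d k x))\<^sup>2)"
      by (intro summable_suminf_not_top) auto
    then have "summable (\<lambda>k. 2 ^ k * (norm (d k x))\<^sup>2 + (1/2) ^ k)"
      by (intro summable_add summable_geometric) auto
    then have "summable (\<lambda>k. d k x)"
    proof (rule summable_comparison_test[rotated])
      have "norm (d k x) \<le> 2 ^ k * (norm (d k x))\<^sup>2 + (1/2) ^ k" for k
      proof -
        define a where "a = norm (d k x)"
        have "0 \<le> (2 ^ k * a - 1)\<^sup>2" by simp
        then have "2 * (2 ^ k * a) \<le> 2 ^ k * (2 ^ k * a\<^sup>2) + 1" by (simp add: power2_eq_square algebra_simps)
        also have "\<dots> = 2 ^ k * (2 ^ k * a\<^sup>2 + (1/2) ^ k)" by (simp add: algebra_simps power_one_over)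
        finally have "2 ^ k * (2 * a) \<le> 2 ^ k * (2 ^ k * a\<^sup>2 + (1/2) ^ k)" by (simp only: mult_ac)
        then have "2 * a \<le> 2 ^ k * a\<^sup>2 + (1/2) ^ k" by (rule mult_left_le_imp_le) simp
        moreover have "0 \<le> a" by (simp add: a_def)
        ultimately show ?thesis unfolding a_def by linarith
      qed
      then show "\<exists>N. \<forall>k\<ge>N. norm (d k x) \<le> 2 ^ k * (norm (d k x))\<^sup>2 + (1/2) ^ k" by blast
    qed
    then have "convergent (\<lambda>n. \<Sum>k<n. d k x)" by (simp add: summable_iff_convergent)
    then have "convergent (\<lambda>n. S (r n) x - S (r 0) x)"
      unfolding d_def by (simp add: sum_lessThan_telescope[of "\<lambda>k. S (r k) x"])
    from convergent_add[OF this convergent_const[of "S (r 0) x"]]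
    show "convergent (\<lambda>k. S (r k) x)" by simp
  qed
  define F where "F x = lim (\<lambda>k. S (r k) x)" for x
  have [measurable]: "F \<in> borel_measurable M" unfolding F_def by measurable
  have lim: "AE x in M. (\<lambda>k. S (r k) x) \<longlonglongrightarrow> F x"
    using conv by eventually_elim (simp add: F_def convergent_LIMSEQ_iff)
  have bound: "(\<integral>\<^sup>+x. ennreal ((norm (F x - S n x))\<^sup>2) \<partial>M) \<le> ennreal ((1/4) ^ j)" if n: "N j \<le> n" for j n
  proof -
    have "(\<integral>\<^sup>+x. ennreal ((norm (F x - S n x))\<^sup>2) \<partial>M) =
        (\<integral>\<^sup>+x. liminf (\<lambda>k. ennreal ((norm (S (r k) x - S n x))\<^sup>2)) \<partial>M)"
      using lim
      by (intro nn_integral_cong_AE, eventually_elim)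
         (intro lim_imp_Liminf[symmetric] tendsto_intros, auto intro!: tendsto_intros)
    also have "\<dots> \<le> liminf (\<lambda>k. \<integral>\<^sup>+x. ennreal ((norm (S (r k) x - S n x))\<^sup>2) \<partial>M)"
      by (rule nn_integral_liminf) measurable
    also have "\<dots> \<le> ennreal ((1/4) ^ j)"
    proof (rule Liminf_le)
      show "\<forall>\<^sub>F k in sequentially. (\<integral>\<^sup>+x. ennreal ((norm (S (r k) x - S n x))\<^sup>2) \<partial>M) \<le> ennreal ((1/4) ^ j)"
        using eventually_ge_at_top[of j] by eventually_elim (intro N r n)
    qed simp
    finally show ?thesis .
  qed
  show ?thesis
  proof (rule that[of F])
    show "(\<lambda>n. \<integral>\<^sup>+x. ennreal ((norm (F x - S n x))\<^sup>2) \<partial>M) \<longlonglongrightarrow> 0"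
    proof (rule order_tendstoI)
      fix a :: ennreal assume "0 < a"
      have "(\<lambda>j. ennreal ((1/4) ^ j)) \<longlonglongrightarrow> ennreal 0"
        by (intro tendsto_ennrealI LIMSEQ_power_zero) simp
      from order_tendstoD(2)[OF this, of a] \<open>0 < a\<close> obtain j where "ennreal ((1/4) ^ j) < a"
        by (auto simp: eventually_sequentially)
      then show "\<forall>\<^sub>F n in sequentially. (\<integral>\<^sup>+x. ennreal ((norm (F x - S n x))\<^sup>2) \<partial>M) < a"
        using bound[of j] by (auto simp: eventually_sequentially intro: le_less_trans)
    qed auto
  qed measurable
qed

section \<open>Parseval's identity for trigonometric sums with operator coefficients\<close>

lemma norm_trig_sum:
  fixes A :: "int \<Rightarrow> 'v::real_inner"
  shows "(norm (\<Sum>j\<in>J. cscale (exp (- \<i> * of_int j * of_real \<omega>)) (complexify (A j))))\<^sup>2 =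
    (\<Sum>i\<in>J. \<Sum>j\<in>J. cos (of_int (i - j) * \<omega>) * (A i \<bullet> A j))"
proof -
  have c: "cscale (exp (- \<i> * of_int j * of_real \<omega>)) (complexify (A j)) =
      (cos (of_int j * \<omega>) *\<^sub>R A j, - sin (of_int j * \<omega>) *\<^sub>R A j)" for j
    by (simp add: cscale_def complexify_def Re_exp Im_exp)
  have "(norm (\<Sum>j\<in>J. cscale (exp (- \<i> * of_int j * of_real \<omega>)) (complexify (A j))))\<^sup>2 =
      (norm (\<Sum>j\<in>J. cos (of_int j * \<omega>) *\<^sub>R A j))\<^sup>2 + (norm (\<Sum>j\<in>J. - sin (of_int j * \<omega>) *\<^sub>R A j))\<^sup>2"
    unfolding c by (simp add: norm_prod_def fst_sum snd_sum)
  also have "\<dots> = (\<Sum>i\<in>J. \<Sum>j\<in>J. cos (of_int (i - j) * \<omega>) * (A i \<bullet> A j))"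
    unfolding power2_norm_eq_inner
    by (simp add: inner_sum_left inner_sum_right sum_negf sum.distrib[symmetric] sum_distrib_left,
        intro sum.cong refl)
      (simp add: inner_commute left_diff_distrib cos_diff algebra_simps)
  finally show ?thesis .
qed

lemma has_bochner_integral_cos:
  "has_bochner_integral lborel (\<lambda>\<omega>. indicator {-pi..pi} \<omega> *\<^sub>R cos (of_int m * \<omega>)) (if m = 0 then 2 * pi else 0)"
proof (cases "m = 0")
  case True
  have "has_bochner_integral lborel (indicator {-pi..pi} :: real \<Rightarrow> real) (measure lborel {-pi..pi})"
    by (rule has_bochner_integral_real_indicator) auto
  then show ?thesis using True by simp
next
  case False
  have "has_bochner_integral lborel (\<lambda>\<omega>. indicator {-pi..pi} \<omega> *\<^sub>R cos (of_int m * \<omega>))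
      (sin (of_int m * pi) / of_int m - sin (of_int m * (-pi)) / of_int m)"
  proof (rule has_bochner_integral_FTC_Icc)
    fix x :: real
    show "((\<lambda>\<omega>. sin (of_int m * \<omega>) / of_int m) has_vector_derivative cos (of_int m * x)) (at x within {-pi..pi})"
      using False by (auto intro!: derivative_eq_intros simp flip: has_real_derivative_iff_has_vector_derivative)
  qed (auto intro!: continuous_intros)
  then show ?thesis using False by (simp add: sin_integer_2pi mult.commute)
qed

text \<open>The squared norm is a double sum of cosines of frequency \<open>i - j\<close>, and
  integration over a full period leaves only the diagonal.\<close>

lemma has_bochner_integral_trig_sum:
  fixes A :: "int \<Rightarrow> 'v::real_inner"
  assumes "finite J"
  shows "has_bochner_integral lborel (\<lambda>\<omega>. indicator {-pi..pi} \<omega> *\<^sub>R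
      (norm (\<Sum>j\<in>J. cscale (exp (- \<i> * of_int j * of_real \<omega>)) (complexify (A j))))\<^sup>2)
    (2 * pi * (\<Sum>j\<in>J. (norm (A j))\<^sup>2))"
proof -
  have "has_bochner_integral lborel
      (\<lambda>\<omega>. \<Sum>i\<in>J. \<Sum>j\<in>J. (indicator {-pi..pi} \<omega> *\<^sub>R cos (of_int (i - j) * \<omega>)) * (A i \<bullet> A j))
      (\<Sum>i\<in>J. \<Sum>j\<in>J. (if i - j = 0 then 2 * pi else 0) * (A i \<bullet> A j))"
    by (intro has_bochner_integral_sum has_bochner_integral_mult_left has_bochner_integral_cos)
  also have "(\<Sum>i\<in>J. \<Sum>j\<in>J. (if i - j = 0 then 2 * pi else 0) * (A i \<bullet> A j)) = 2 * pi * (\<Sum>j\<in>J. (norm (A j))\<^sup>2)"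
    using assms by (simp add: if_distrib[of "\<lambda>x. x * _"] power2_norm_eq_inner sum_distrib_left cong: if_cong)
  finally show ?thesis
    unfolding norm_trig_sum by (simp add: sum_distrib_left mult.assoc)
qed

lemma sum_symmetric_int:
  fixes f :: "int \<Rightarrow> real"
  assumes "\<And>j. f (- j) = f j"
  shows "(\<Sum>j\<in>{- int N..int N} - {0}. f j) = 2 * (\<Sum>i=1..N. f (int i))"
proof -
  have eq: "{- int N..int N} - {0} = int ` {1..N} \<union> (\<lambda>i. - int i) ` {1..N}"
  proof (intro set_eqI iffI)
    fix j assume j: "j \<in> {- int N..int N} - {0}"
    show "j \<in> int ` {1..N} \<union> (\<lambda>i. - int i) ` {1..N}"
    proof (cases "j > 0")
      case True
      then show ?thesis using j by (intro UnI1 image_eqI[of _ _ "nat j"]) auto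
    next
      case False
      then show ?thesis using j by (intro UnI2 image_eqI[of _ _ "nat (- j)"]) auto
    qed
  qed auto
  have "(\<Sum>j\<in>{- int N..int N} - {0}. f j) = (\<Sum>j\<in>int ` {1..N}. f j) + (\<Sum>j\<in>(\<lambda>i. - int i) ` {1..N}. f j)"
    unfolding eq by (rule sum.union_disjoint) auto
  also have "\<dots> = (\<Sum>i=1..N. f (int i)) + (\<Sum>i=1..N. f (- int i))"
    by (simp add: sum.reindex inj_on_def)
  finally show ?thesis by (simp add: assms)
qed

text \<open>Since \<open>k 0 = 1\<close>, subtracting the lag 0 covariance deletes exactly the lag 0
  term, and Parseval applies to the rest. Negative lags repeat the positive ones because
  \<open>k\<close> is even and the adjoint preserves the norm.\<close>

lemma sample_Q2_eq:
  assumes n: "n \<ge> 1" and k0: "k 0 = 1" and ks: "\<And>x. k (- x) = k x"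
  shows "sample_Q2 k b x n = 2 * (\<Sum>j=1..n-1. (k (real j / b))\<^sup>2 * (norm (sample_autocov x n (int j)))\<^sup>2)"
proof -
  define J where "J = {- int (n - 1)..int (n - 1)}"
  have J: "{j. \<bar>j\<bar> < int n} = J" "finite J" "0 \<in> J" using n by (auto simp: J_def)
  define A where "A j = k (real_of_int j / b) *\<^sub>R sample_autocov x n j" for j
  have cs: "k (real_of_int j / b) *\<^sub>R cscale z (complexify (sample_autocov x n j)) = cscale z (complexify (A j))" for j z
    by (simp add: A_def cscale_def complexify_def)
  have diff: "sample_spectral_density k b x n \<omega> - (1 / (2 * pi)) *\<^sub>R complexify (sample_autocov x n 0) =
     (1 / (2 * pi)) *\<^sub>R (\<Sum>j\<in>J - {0}. cscale (exp (- \<i> * of_int j * of_real \<omega>)) (complexify (A j)))" for \<omega>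
  proof -
    have "cscale 1 (complexify (A 0)) = complexify (sample_autocov x n 0)"
      by (simp add: A_def cscale_def complexify_def k0)
    then show ?thesis
      unfolding sample_spectral_density_def J(1) cs
      by (subst sum.remove[OF J(2,3)]) (simp add: scaleR_add_right)
  qed
  have sym: "(norm (A (- j)))\<^sup>2 = (norm (A j))\<^sup>2" for j
    using ks[of "real_of_int j / b"] by (simp add: A_def sample_autocov_def Let_def)
  have "(LINT \<omega>:{-pi..pi}|lborel. (norm (sample_spectral_density k b x n \<omega> - (1 / (2 * pi)) *\<^sub>R complexify (sample_autocov x n 0)))\<^sup>2)
    = (1 / (2 * pi))\<^sup>2 * (2 * pi * (\<Sum>j\<in>J - {0}. (norm (A j))\<^sup>2))"
    using has_bochner_integral_mult_right[OF has_bochner_integral_trig_sum[of "J - {0}" A], of "(1 / (2 * pi))\<^sup>2"] J(2)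
    unfolding diff norm_scaleR power_mult_distrib set_lebesgue_integral_def
    by (intro has_bochner_integral_integral_eq) (simp add: power_divide mult_ac)
  then have "sample_Q2 k b x n = (\<Sum>j\<in>J - {0}. (norm (A j))\<^sup>2)"
    unfolding sample_Q2_def by (simp add: power2_eq_square)
  also have "\<dots> = 2 * (\<Sum>j=1..n-1. (norm (A (int j)))\<^sup>2)"
    unfolding J_def by (rule sum_symmetric_int) (rule sym)
  finally show ?thesis by (simp add: A_def power_mult_distrib)
qed

lemma power2_norm_diff_le:
  fixes a b :: "'a::real_normed_vector"
  shows "(norm (a - b))\<^sup>2 \<le> 2 * (norm a)\<^sup>2 + 2 * (norm b)\<^sup>2"
proof -
  have "(norm (a - b))\<^sup>2 \<le> (norm a + norm b)\<^sup>2" by (intro power_mono norm_triangle_ineq4) auto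
  also have "\<dots> \<le> 2 * (norm a)\<^sup>2 + 2 * (norm b)\<^sup>2"
    using sum_squares_bound[of "norm a" "norm b"] by (simp add: power2_sum)
  finally show ?thesis .
qed

text \<open>Continuity of the L2 norm. The difference of two squares is traded for a large multiple
  of the squared distance, whose integral vanishes in the limit, plus a small multiple of the fixed
  integral \<open>I\<close>.\<close>

lemma tendsto_integral_square_norm:
  fixes S :: "nat \<Rightarrow> 'x \<Rightarrow> 'b::{banach,second_countable_topology}"
  assumes [measurable]: "\<And>n. S n \<in> borel_measurable M" "F \<in> borel_measurable M"
    and S: "\<And>n. integrable M (\<lambda>x. (norm (S n x))\<^sup>2)" and F: "integrable M (\<lambda>x. (norm (F x))\<^sup>2)"
    and lim: "(\<lambda>n. \<integral>x. (norm (F x - S n x))\<^sup>2 \<partial>M) \<longlonglongrightarrow> 0"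
  shows "(\<lambda>n. \<integral>x. (norm (S n x))\<^sup>2 \<partial>M) \<longlonglongrightarrow> (\<integral>x. (norm (F x))\<^sup>2 \<partial>M)"
proof (rule LIMSEQ_I)
  fix r :: real assume r: "0 < r"
  define I where "I = (\<integral>x. (norm (F x))\<^sup>2 \<partial>M)"
  have I: "0 \<le> I" by (simp add: I_def)
  \<comment> \<open>Chosen so that \<open>e * I \<le> r / 2\<close>; the added 1 keeps the
    denominator positive when \<open>I = 0\<close>.\<close>
  define e where "e = r / (2 * (I + 1))"
  have e: "0 < e" using r I by (simp add: e_def)
  \<comment> \<open>AM-GM with weight \<open>e\<close>\<close>
  have le: "\<bar>(norm b)\<^sup>2 - (norm a)\<^sup>2\<bar> \<le> (1 + 1 / e) * (norm (a - b))\<^sup>2 + e * (norm a)\<^sup>2" for a b :: 'b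
  proof -
    define d where "d = norm b - norm a"
    have d: "d\<^sup>2 \<le> (norm (a - b))\<^sup>2"
      using norm_triangle_ineq3[of b a] unfolding d_def norm_minus_commute[of a b] by (metis abs_ge_zero power2_abs power_mono)
    have "(norm b)\<^sup>2 - (norm a)\<^sup>2 = d\<^sup>2 + 2 * (norm a * d)" by (simp add: d_def power2_eq_square algebra_simps)
    moreover have "2 * \<bar>norm a * d\<bar> \<le> d\<^sup>2 / e + e * (norm a)\<^sup>2"
    proof -
      have "0 \<le> (\<bar>d\<bar> - e * norm a)\<^sup>2" by simp
      then have "2 * \<bar>norm a * d\<bar> * e \<le> d\<^sup>2 + e * (norm a)\<^sup>2 * e"
        by (simp add: power2_eq_square abs_mult algebra_simps)
      then show ?thesis using e by (simp add: field_simps)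
    qed
    moreover have "(1 + 1 / e) * d\<^sup>2 = d\<^sup>2 + d\<^sup>2 / e" by (simp add: distrib_right)
    moreover have "norm a * d \<le> \<bar>norm a * d\<bar>" "- (norm a * d) \<le> \<bar>norm a * d\<bar>" by linarith+
    ultimately have "\<bar>(norm b)\<^sup>2 - (norm a)\<^sup>2\<bar> \<le> (1 + 1 / e) * d\<^sup>2 + e * (norm a)\<^sup>2"
      using zero_le_power2[of d] by linarith
    also have "\<dots> \<le> (1 + 1 / e) * (norm (a - b))\<^sup>2 + e * (norm a)\<^sup>2"
      using d e by (intro add_right_mono mult_left_mono) auto
    finally show ?thesis .
  qed
  have D: "integrable M (\<lambda>x. (norm (F x - S n x))\<^sup>2)" for n
  proof (rule Bochner_Integration.integrable_bound)
    show "integrable M (\<lambda>x. 2 * (norm (F x))\<^sup>2 + 2 * (norm (S n x))\<^sup>2)" using F S by simp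
    show "AE x in M. norm ((norm (F x - S n x))\<^sup>2) \<le> norm (2 * (norm (F x))\<^sup>2 + 2 * (norm (S n x))\<^sup>2)"
      by (intro AE_I2) (simp add: power2_norm_diff_le add_nonneg_nonneg)
  qed measurable
  have "\<forall>\<^sub>F n in sequentially. (\<integral>x. (norm (F x - S n x))\<^sup>2 \<partial>M) < r / (2 * (1 + 1 / e))"
    by (rule order_tendstoD(2)[OF lim]) (use r e in \<open>simp add: add_pos_pos\<close>)
  then obtain N where N: "\<And>n. n \<ge> N \<Longrightarrow> (\<integral>x. (norm (F x - S n x))\<^sup>2 \<partial>M) < r / (2 * (1 + 1 / e))"
    by (auto simp: eventually_sequentially)
  have "norm ((\<integral>x. (norm (S n x))\<^sup>2 \<partial>M) - I) < r" if n: "n \<ge> N" for n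
  proof -
    have "norm ((\<integral>x. (norm (S n x))\<^sup>2 \<partial>M) - I) = norm (\<integral>x. (norm (S n x))\<^sup>2 - (norm (F x))\<^sup>2 \<partial>M)"
      using S F by (simp add: I_def)
    also have "\<dots> \<le> (\<integral>x. norm ((norm (S n x))\<^sup>2 - (norm (F x))\<^sup>2) \<partial>M)"
      by (rule integral_norm_bound)
    also have "\<dots> \<le> (\<integral>x. (1 + 1 / e) * (norm (F x - S n x))\<^sup>2 + e * (norm (F x))\<^sup>2 \<partial>M)"
      using S F D le by (intro integral_mono) auto
    also have "\<dots> = (1 + 1 / e) * (\<integral>x. (norm (F x - S n x))\<^sup>2 \<partial>M) + e * I"
      using F D by (simp add: I_def)
    also have "\<dots> < (1 + 1 / e) * (r / (2 * (1 + 1 / e))) + r / 2"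
    proof (rule add_less_le_mono)
      show "(1 + 1 / e) * (\<integral>x. (norm (F x - S n x))\<^sup>2 \<partial>M) < (1 + 1 / e) * (r / (2 * (1 + 1 / e)))"
        using N[OF n] e by (intro mult_strict_left_mono) (auto simp: add_pos_pos)
      show "e * I \<le> r / 2" using r I by (simp add: e_def field_simps)
    qed
    also have "\<dots> = r" using e by (simp add: add_pos_pos less_imp_neq[symmetric] field_simps)
    finally show ?thesis .
  qed
  then show "\<exists>N. \<forall>n\<ge>N. norm ((\<integral>x. (norm (S n x))\<^sup>2 \<partial>M) - (\<integral>x. (norm (F x))\<^sup>2 \<partial>M)) < r"
    unfolding I_def by blast
qed

lemma borel_measurable_cscale_exp [measurable]:
  fixes A :: "'v::{real_normed_vector,second_countable_topology}"
  shows "(\<lambda>\<omega>. cscale (exp (- \<i> * of_int j * of_real \<omega>)) (complexify A)) \<in> borel_measurable borel"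
proof -
  have "(\<lambda>\<omega>. cscale (exp (- \<i> * of_int j * of_real \<omega>)) (complexify A)) =
      (\<lambda>\<omega>. (cos (of_int j * \<omega>) *\<^sub>R A, - sin (of_int j * \<omega>) *\<^sub>R A))"
    by (auto simp: fun_eq_iff cscale_def complexify_def Re_exp Im_exp)
  then show ?thesis
    by (simp only:) (intro borel_measurable_continuous_onI continuous_intros)
qed

lemma tendsto_ennreal_sandwich:
  assumes "\<And>n. (f n :: ennreal) \<le> g n" "g \<longlonglongrightarrow> 0"
  shows "f \<longlonglongrightarrow> 0"
  by (rule tendsto_sandwich[OF _ _ tendsto_const assms(2)]) (use assms(1) in auto)

section \<open>Spectral density and population quadratic form\<close>

context centered_stationary
begin

definition partial_spectral_sum :: "nat \<Rightarrow> real \<Rightarrow> ('a, 'a) hs \<times> ('a, 'a) hs" where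
  "partial_spectral_sum N \<omega> = (1 / (2 * pi)) *\<^sub>R
     (\<Sum>j=-int N..int N. cscale (exp (- \<i> * of_int j * of_real \<omega>)) (complexify (C j)))"

lemma borel_measurable_partial_spectral_sum [measurable]: "partial_spectral_sum N \<in> borel_measurable borel"
  unfolding partial_spectral_sum_def by measurable

lemma has_bochner_integral_spectral_sum:
  assumes "finite J"
  shows "has_bochner_integral lborel (\<lambda>\<omega>. indicator {-pi..pi} \<omega> *\<^sub>R
      (norm ((1 / (2 * pi)) *\<^sub>R (\<Sum>j\<in>J. cscale (exp (- \<i> * of_int j * of_real \<omega>)) (complexify (C j)))))\<^sup>2)
    ((1 / (2 * pi)) * (\<Sum>j\<in>J. (norm (C j))\<^sup>2))"
proof -
  have "(1 / (2 * pi)) * (\<Sum>j\<in>J. (norm (C j))\<^sup>2) = (1 / (2 * pi))\<^sup>2 * (2 * pi * (\<Sum>j\<in>J. (norm (C j))\<^sup>2))"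
    by (simp add: power2_eq_square)
  then show ?thesis
    using has_bochner_integral_mult_right[OF has_bochner_integral_trig_sum[OF assms, of C], of "(1 / (2 * pi))\<^sup>2"]
    by (simp add: power_divide power_mult_distrib mult_ac)
qed

text \<open>By Parseval the squared L2 distance of two partial sums is an increment of
  \<open>a\<close> divided by \<open>2 * pi\<close>, and \<open>a\<close> converges, being monotone
  and bounded. Completeness then supplies the density.\<close>

lemma spectral_density_exists:
  assumes N: "(\<Sum>\<^sub>\<infinity>j. (nuclear_norm (hs_blinfun (C j)))\<^sup>2) < \<infinity>"
  shows "\<exists>F. is_spectral_density M u F"
proof -
  define a where "a n = (\<Sum>j=-int n..int n. (norm (C j))\<^sup>2)" for n
  \<comment> \<open>The cutoff turns integrals over the interval into integrals over the whole line,
    to which \<open>L2_complete\<close> applies.\<close>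
  define f where "f n \<omega> = indicator {-pi..pi} \<omega> *\<^sub>R partial_spectral_sum n \<omega>" for n \<omega>
  have f_meas [measurable]: "f n \<in> borel_measurable lborel" for n
    unfolding f_def by measurable
  have mono: "incseq a"
    unfolding a_def incseq_def by (auto intro!: sum_mono2)
  have conv: "convergent a"
  proof (rule Bseq_mono_convergent[OF BseqI'])
    show "norm (a n) \<le> enn2real (\<Sum>\<^sub>\<infinity>j. (nuclear_norm (hs_blinfun (C j)))\<^sup>2)" for n
      using autocov_square_sum_le[OF N, of "{-int n..int n}"] by (simp add: a_def sum_nonneg)
  qed (use mono in \<open>auto simp: incseq_def\<close>)
  then have Ca: "Cauchy a" by (rule convergent_Cauchy)
  have nn: "(\<integral>\<^sup>+\<omega>. ennreal ((norm (f m \<omega> - f n \<omega>))\<^sup>2) \<partial>lborel) = ennreal ((1 / (2 * pi)) * (a m - a n))"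
    if "n \<le> m" for m n
  proof -
    let ?J = "{-int m..int m} - {-int n..int n}"
    have "f m \<omega> - f n \<omega> = indicator {-pi..pi} \<omega> *\<^sub>R
        ((1 / (2 * pi)) *\<^sub>R (\<Sum>j\<in>?J. cscale (exp (- \<i> * of_int j * of_real \<omega>)) (complexify (C j))))" for \<omega>
      unfolding f_def partial_spectral_sum_def using that by (subst sum_diff) (auto simp: scaleR_diff_right)
    then have eq: "(norm (f m \<omega> - f n \<omega>))\<^sup>2 = indicator {-pi..pi} \<omega> *\<^sub>R
        (norm ((1 / (2 * pi)) *\<^sub>R (\<Sum>j\<in>?J. cscale (exp (- \<i> * of_int j * of_real \<omega>)) (complexify (C j)))))\<^sup>2" for \<omega>
      by (simp add: indicator_def)
    have s: "(\<Sum>j\<in>?J. (norm (C j))\<^sup>2) = a m - a n"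
      unfolding a_def using that by (subst sum_diff) auto
    show ?thesis
      unfolding eq
      by (subst nn_integral_eq_integral)
         (use has_bochner_integral_spectral_sum[of ?J] s in \<open>auto simp: has_bochner_integral_iff\<close>)
  qed
  have cauchy: "\<exists>N. \<forall>m\<ge>N. \<forall>n\<ge>N. (\<integral>\<^sup>+\<omega>. ennreal ((norm (f m \<omega> - f n \<omega>))\<^sup>2) \<partial>lborel) \<le> ennreal e" if "e > 0" for e :: real
  proof -
    obtain N where N: "\<And>m n. m \<ge> N \<Longrightarrow> n \<ge> N \<Longrightarrow> \<bar>a m - a n\<bar> < 2 * pi * e"
      using Ca \<open>e > 0\<close> unfolding Cauchy_iff by (metis mult_pos_pos pi_gt_zero real_norm_def zero_less_numeral)
    have le: "(\<integral>\<^sup>+\<omega>. ennreal ((norm (f m \<omega> - f n \<omega>))\<^sup>2) \<partial>lborel) \<le> ennreal e" if "m \<ge> N" "n \<ge> N" "n \<le> m" for m n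
    proof -
      have "a m - a n \<le> 2 * pi * e" using N[OF that(1,2)] by linarith
      then have "(1 / (2 * pi)) * (a m - a n) \<le> e" by (simp add: field_simps)
      then show ?thesis unfolding nn[OF that(3)] by (rule ennreal_leI)
    qed
    show ?thesis
    proof (intro exI[of _ N] allI impI)
      fix m n assume "m \<ge> N" "n \<ge> N"
      then show "(\<integral>\<^sup>+\<omega>. ennreal ((norm (f m \<omega> - f n \<omega>))\<^sup>2) \<partial>lborel) \<le> ennreal e"
        using le[of m n] le[of n m] by (cases "n \<le> m") (simp_all add: norm_minus_commute)
    qed
  qed
  obtain F where F [measurable]: "F \<in> borel_measurable lborel"
    and lim: "(\<lambda>n. \<integral>\<^sup>+\<omega>. ennreal ((norm (F \<omega> - f n \<omega>))\<^sup>2) \<partial>lborel) \<longlonglongrightarrow> 0"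
    using L2_complete[of f lborel, OF f_meas cauchy] by blast
  have ind: "indicator {-pi..pi} \<omega> *\<^sub>R (norm (F \<omega> - partial_spectral_sum n \<omega>))\<^sup>2 \<le> (norm (F \<omega> - f n \<omega>))\<^sup>2" for n \<omega>
    by (simp add: f_def indicator_def)
  have lim2: "(\<lambda>n. \<integral>\<^sup>+\<omega>. ennreal (indicator {-pi..pi} \<omega> *\<^sub>R (norm (F \<omega> - partial_spectral_sum n \<omega>))\<^sup>2) \<partial>lborel) \<longlonglongrightarrow> 0"
    by (rule tendsto_ennreal_sandwich[OF _ lim]) (intro nn_integral_mono ennreal_leI ind)
  have "is_spectral_density M u F"
    unfolding is_spectral_density_def
  proof (intro conjI)
    show "F \<in> borel_measurable borel" using F by simp
    \<comment> \<open>One index at finite distance suffices: \<open>F\<close> is square integrable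
      on the interval because \<open>F - f n\<close> and \<open>f n\<close> are.\<close>
    obtain n where n: "(\<integral>\<^sup>+\<omega>. ennreal ((norm (F \<omega> - f n \<omega>))\<^sup>2) \<partial>lborel) < \<infinity>"
      using order_tendstoD(2)[OF lim, of \<infinity>] by (auto simp: eventually_sequentially)
    have i1: "integrable lborel (\<lambda>\<omega>. (norm (F \<omega> - f n \<omega>))\<^sup>2)"
      using n by (intro integrableI_nonneg) auto
    have i2: "integrable lborel (\<lambda>\<omega>. (norm (f n \<omega>))\<^sup>2)"
    proof -
      have "(norm (f n \<omega>))\<^sup>2 = indicator {-pi..pi} \<omega> *\<^sub>R (norm (partial_spectral_sum n \<omega>))\<^sup>2" for \<omega>
        by (simp add: f_def indicator_def)
      then show ?thesis
        using has_bochner_integral_spectral_sum[of "{-int n..int n}"]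
        by (simp only: partial_spectral_sum_def) (auto simp: has_bochner_integral_iff)
    qed
    show "set_integrable lborel {-pi..pi} (\<lambda>\<omega>. (norm (F \<omega>))\<^sup>2)"
      unfolding set_integrable_def
    proof (rule Bochner_Integration.integrable_bound)
      show "integrable lborel (\<lambda>\<omega>. 2 * (norm (F \<omega> - f n \<omega>))\<^sup>2 + 2 * (norm (f n \<omega>))\<^sup>2)"
        using i1 i2 by simp
      have "(norm p)\<^sup>2 \<le> 2 * (norm (p - q))\<^sup>2 + 2 * (norm q)\<^sup>2" for p q :: "('a, 'a) hs \<times> ('a, 'a) hs"
        using power2_norm_diff_le[of "p - q" "- q"] by simp
      then show "AE \<omega> in lborel. norm (indicator {-pi..pi} \<omega> *\<^sub>R (norm (F \<omega>))\<^sup>2) \<le> norm (2 * (norm (F \<omega> - f n \<omega>))\<^sup>2 + 2 * (norm (f n \<omega>))\<^sup>2)"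
        by (intro AE_I2) (simp add: indicator_def add_nonneg_nonneg)
    qed measurable
    have "(LINT \<omega>:{-pi..pi}|lborel. (norm (F \<omega> - partial_spectral_sum n \<omega>))\<^sup>2) =
        enn2real (\<integral>\<^sup>+\<omega>. ennreal (indicator {-pi..pi} \<omega> *\<^sub>R (norm (F \<omega> - partial_spectral_sum n \<omega>))\<^sup>2) \<partial>lborel)" for n
      unfolding set_lebesgue_integral_def by (rule integral_eq_nn_integral) auto
    moreover have "(\<lambda>n. enn2real (\<integral>\<^sup>+\<omega>. ennreal (indicator {-pi..pi} \<omega> *\<^sub>R (norm (F \<omega> - partial_spectral_sum n \<omega>))\<^sup>2) \<partial>lborel)) \<longlonglongrightarrow> enn2real 0"
      by (intro tendsto_enn2real) (use lim2 in simp_all)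
    ultimately show "(\<lambda>N. LINT \<omega>:{-pi..pi}|lborel. (norm (F \<omega> - (1 / (2 * pi)) *\<^sub>R
        (\<Sum>j=-int N..int N. cscale (exp (- \<i> * of_int j * of_real \<omega>)) (complexify (C j)))))\<^sup>2) \<longlonglongrightarrow> 0"
      by (simp add: partial_spectral_sum_def)
  qed
  then show ?thesis by blast
qed

text \<open>Only the L2 distance of the chosen density from the partial sums enters. Subtracting the
  same lag 0 term \<open>c\<close> from both leaves this distance unchanged and removes
  \<open>j = 0\<close> from Parseval's sum.\<close>

lemma population_Q2_limit:
  assumes N: "(\<Sum>\<^sub>\<infinity>j. (nuclear_norm (hs_blinfun (C j)))\<^sup>2) < \<infinity>"
  shows "(\<lambda>n. 2 * (\<Sum>i=1..n. (norm (C (int i)))\<^sup>2)) \<longlonglongrightarrow> population_Q2 M u"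
proof -
  define F where "F = spectral_density M u"
  have F: "is_spectral_density M u F"
    unfolding F_def spectral_density_def by (rule someI_ex[OF spectral_density_exists[OF N]])
  then have [measurable]: "F \<in> borel_measurable borel" by (simp add: is_spectral_density_def)
  define I where "I = {-pi..pi}"
  have [measurable]: "I \<in> sets borel" by (simp add: I_def)
  define c where "c = (1 / (2 * pi)) *\<^sub>R complexify (C 0)"
  define G where "G \<omega> = indicator I \<omega> *\<^sub>R (F \<omega> - c)" for \<omega>
  define T where "T n \<omega> = indicator I \<omega> *\<^sub>R (partial_spectral_sum n \<omega> - c)" for n \<omega>
  have sqI: "(norm (indicator I \<omega> *\<^sub>R v))\<^sup>2 = indicator I \<omega> *\<^sub>R (norm v)\<^sup>2" for \<omega> and v :: "('a, 'a) hs \<times> ('a, 'a) hs"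
    by (simp add: indicator_def)
  have diff: "partial_spectral_sum n \<omega> - c = (1 / (2 * pi)) *\<^sub>R
      (\<Sum>j\<in>{-int n..int n} - {0}. cscale (exp (- \<i> * of_int j * of_real \<omega>)) (complexify (C j)))" for n \<omega>
    unfolding partial_spectral_sum_def c_def
    by (subst sum.remove[of _ 0]) (auto simp: scaleR_add_right cscale_def complexify_def)
  have T: "has_bochner_integral lborel (\<lambda>\<omega>. (norm (T n \<omega>))\<^sup>2) ((1 / (2 * pi)) * (\<Sum>j\<in>{-int n..int n} - {0}. (norm (C j))\<^sup>2))" for n
    using has_bochner_integral_spectral_sum[of "{-int n..int n} - {0}"] unfolding T_def sqI diff by (simp add: I_def)
  have "(\<lambda>n. \<integral>\<omega>. (norm (T n \<omega>))\<^sup>2 \<partial>lborel) \<longlonglongrightarrow> (\<integral>\<omega>. (norm (G \<omega>))\<^sup>2 \<partial>lborel)"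
  proof (rule tendsto_integral_square_norm)
    show "integrable lborel (\<lambda>\<omega>. (norm (T n \<omega>))\<^sup>2)" for n
      using T by (auto simp: has_bochner_integral_iff)
    show "integrable lborel (\<lambda>\<omega>. (norm (G \<omega>))\<^sup>2)"
    proof (rule Bochner_Integration.integrable_bound)
      have "integrable lborel (indicator I :: real \<Rightarrow> real)" by (simp add: I_def)
      then show "integrable lborel (\<lambda>\<omega>. 2 * (indicator I \<omega> *\<^sub>R (norm (F \<omega>))\<^sup>2) + 2 * (norm c)\<^sup>2 * indicator I \<omega>)"
        using F by (intro Bochner_Integration.integrable_add integrable_mult_right)
          (auto simp: is_spectral_density_def set_integrable_def I_def)
      show "AE \<omega> in lborel. norm ((norm (G \<omega>))\<^sup>2) \<le> norm (2 * (indicator I \<omega> *\<^sub>R (norm (F \<omega>))\<^sup>2) + 2 * (norm c)\<^sup>2 * indicator I \<omega>)"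
        by (intro AE_I2) (simp add: G_def indicator_def power2_norm_diff_le)
    qed (simp add: G_def)
    have "(norm (G \<omega> - T n \<omega>))\<^sup>2 = indicator I \<omega> *\<^sub>R (norm (F \<omega> - partial_spectral_sum n \<omega>))\<^sup>2" for n \<omega>
      by (simp add: G_def T_def indicator_def)
    then show "(\<lambda>n. \<integral>\<omega>. (norm (G \<omega> - T n \<omega>))\<^sup>2 \<partial>lborel) \<longlonglongrightarrow> 0"
      using F by (simp add: is_spectral_density_def set_lebesgue_integral_def I_def partial_spectral_sum_def)
  qed (auto simp: G_def T_def)
  then have "(\<lambda>n. (1 / (2 * pi)) * (\<Sum>j\<in>{-int n..int n} - {0}. (norm (C j))\<^sup>2)) \<longlonglongrightarrow> (\<integral>\<omega>. (norm (G \<omega>))\<^sup>2 \<partial>lborel)"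
    using has_bochner_integral_integral_eq[OF T] by simp
  from tendsto_mult[OF tendsto_const[of "2 * pi"] this]
  have "(\<lambda>n. \<Sum>j\<in>{-int n..int n} - {0}. (norm (C j))\<^sup>2) \<longlonglongrightarrow> 2 * pi * (\<integral>\<omega>. (norm (G \<omega>))\<^sup>2 \<partial>lborel)"
    by simp
  moreover have "2 * pi * (\<integral>\<omega>. (norm (G \<omega>))\<^sup>2 \<partial>lborel) = population_Q2 M u"
    unfolding population_Q2_def set_lebesgue_integral_def G_def sqI by (simp add: I_def F_def c_def)
  moreover have "(\<Sum>j\<in>{-int n..int n} - {0}. (norm (C j))\<^sup>2) = 2 * (\<Sum>i=1..n. (norm (C (int i)))\<^sup>2)" for n
    by (rule sum_symmetric_int) (simp add: autocov_minus)
  ultimately show ?thesis by simp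
qed

end

subsection \<open>Riemann sums of the kernel\<close>

lemma integrable_powr_atLeast:
  fixes e :: real
  assumes "e < -1"
  shows "integrable lborel (\<lambda>x. x powr e * indicator {1..} x)"
proof (rule integrableI_nonneg)
  have "((\<lambda>x. x powr (e + 1) / (e + 1)) \<longlongrightarrow> 0 / (e + 1)) at_top"
    using assms by (intro tendsto_divide tendsto_neg_powr filterlim_ident tendsto_const) auto
  then have lim: "((\<lambda>x. x powr (e + 1) / (e + 1)) \<longlongrightarrow> 0) at_top" by simp
  have "(\<integral>\<^sup>+x. ennreal (x powr e) * indicator {1..} x \<partial>lborel) = ennreal (0 - 1 powr (e + 1) / (e + 1))"
    using lim by (rule nn_integral_FTC_atLeast[rotated 3])
      (use assms in \<open>auto intro!: derivative_eq_intros\<close>)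
  also have "(\<integral>\<^sup>+x. ennreal (x powr e) * indicator {1..} x \<partial>lborel) = (\<integral>\<^sup>+x. ennreal (x powr e * indicator {1..} x) \<partial>lborel)"
    by (intro nn_integral_cong) (simp add: indicator_def)
  finally show "(\<integral>\<^sup>+x. ennreal (x powr e * indicator {1..} x) \<partial>lborel) < \<infinity>" by simp
qed auto

text \<open>Dominating a Riemann sum cell by cell calls for a decreasing majorant, which
  \<open>(k x)\<^sup>2\<close> itself need not be. The envelope is capped at 1 near the origin and
  decays like \<open>x powr (- 2 * \<alpha>)\<close>, which is integrable at infinity as
  \<open>2 * \<alpha> > 1\<close>.\<close>

lemma decreasing_envelope:
  fixes k :: "real \<Rightarrow> real"
  assumes k1: "\<And>x. k x \<in> {-1..1}" and \<alpha>: "\<alpha> > 1 / 2" and O: "k \<in> O[at_top](\<lambda>x. x powr (- \<alpha>))"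
  obtains e where "\<And>x y. 0 < x \<Longrightarrow> x \<le> y \<Longrightarrow> e y \<le> e x" "\<And>x. 0 < x \<Longrightarrow> (k x)\<^sup>2 \<le> e x"
    "integrable lborel (\<lambda>x. indicator {0<..} x * e x :: real)"
proof -
  obtain c0 where c0: "c0 > 0" "eventually (\<lambda>x. norm (k x) \<le> c0 * norm (x powr (- \<alpha>))) at_top"
    using O by (rule landau_o.bigE)
  obtain x0 where x0: "\<And>x. x \<ge> x0 \<Longrightarrow> \<bar>k x\<bar> \<le> c0 * x powr (- \<alpha>)"
    using c0(2) by (auto simp: eventually_at_top_linorder)
  define x1 where "x1 = max x0 1"
  \<comment> \<open>The first entry covers \<open>x \<ge> x1\<close>; below \<open>x1\<close> the
    second makes the power term at least 1, which already bounds
    \<open>(k x)\<^sup>2\<close>.\<close>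
  define c where "c = max (c0\<^sup>2) (x1 powr (2 * \<alpha>))"
  have c: "c \<ge> c0\<^sup>2" "c \<ge> x1 powr (2 * \<alpha>)" by (auto simp: c_def)
  then have c_nonneg: "c \<ge> 0" using zero_le_power2[of c0] by linarith
  define e where "e x = min 1 (c * x powr (- 2 * \<alpha>))" for x
  have one: "(k x)\<^sup>2 \<le> 1" for x using k1[of x] by (simp add: abs_square_le_1 abs_le_iff)
  have le: "(k x)\<^sup>2 \<le> c * x powr (- 2 * \<alpha>)" if x: "x > 0" for x
  proof (cases "x \<ge> x1")
    case True
    then have "\<bar>k x\<bar>\<^sup>2 \<le> (c0 * x powr (- \<alpha>))\<^sup>2" using x0[of x] by (intro power_mono) (auto simp: x1_def)
    also have "\<dots> = c0\<^sup>2 * x powr (- 2 * \<alpha>)" using x by (simp add: power_mult_distrib powr_power mult.commute)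
    also have "\<dots> \<le> c * x powr (- 2 * \<alpha>)" using c by (intro mult_right_mono) auto
    finally show ?thesis by simp
  next
    case False
    have "1 = x1 powr (2 * \<alpha>) * x1 powr (- 2 * \<alpha>)" using x False by (simp add: powr_minus)
    also have "\<dots> \<le> c * x powr (- 2 * \<alpha>)"
      using c c_nonneg x False \<alpha> by (intro mult_mono powr_mono2') auto
    finally show ?thesis using one[of x] by linarith
  qed
  show ?thesis
  proof (rule that[of e])
    show "e y \<le> e x" if "0 < x" "x \<le> y" for x y
      unfolding e_def using that c_nonneg \<alpha>
      by (intro min.mono mult_left_mono powr_mono2') auto
    show "(k x)\<^sup>2 \<le> e x" if "0 < x" for x
      unfolding e_def using le[OF that] one[of x] by simp
    show "integrable lborel (\<lambda>x. indicator {0<..} x * e x)"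
    proof (rule Bochner_Integration.integrable_bound)
      have "integrable lborel (indicator {0..1} :: real \<Rightarrow> real)" by simp
      then show "integrable lborel (\<lambda>x. indicator {0..1} x + c * (x powr (- 2 * \<alpha>) * indicator {1..} x))"
        using integrable_powr_atLeast[of "- 2 * \<alpha>"] \<alpha> by (intro Bochner_Integration.integrable_add integrable_mult_right) auto
      show "AE x in lborel. norm (indicator {0<..} x * e x) \<le> norm (indicator {0..1} x + c * (x powr (- 2 * \<alpha>) * indicator {1..} x))"
        using c_nonneg by (intro AE_I2) (auto simp: e_def indicator_def)
    qed (auto simp: e_def)
  qed
qed

text \<open>Turns a sum over lags, divided by \<open>b\<close>, into an integral accessible to
  dominated convergence. Each value belongs to the right endpoint of its cell, where a decreasing
  envelope is smallest on the cell.\<close>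

definition grid_step :: "real \<Rightarrow> nat \<Rightarrow> (nat \<Rightarrow> real) \<Rightarrow> real \<Rightarrow> real" where
  "grid_step b N a z = (\<Sum>j=1..N. indicator {real (j - 1) / b<..real j / b} z * a j)"

lemma borel_measurable_grid_step [measurable]: "grid_step b N a \<in> borel_measurable borel"
  unfolding grid_step_def by measurable

lemma has_bochner_integral_grid_step:
  assumes "b > 0"
  shows "has_bochner_integral lborel (grid_step b N a) ((\<Sum>j=1..N. a j) / b)"
proof -
  have "has_bochner_integral lborel (indicator {real (j - 1) / b<..real j / b} :: real \<Rightarrow> real) (1 / b)" if "j \<ge> 1" for j
  proof -
    have le: "real (j - 1) / b \<le> real j / b" using assms by (intro divide_right_mono) auto
    have "has_bochner_integral lborel (indicator {real (j - 1) / b<..real j / b} :: real \<Rightarrow> real)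
        (measure lborel {real (j - 1) / b<..real j / b})"
      by (rule has_bochner_integral_real_indicator) (simp_all add: emeasure_lborel_Ioc[OF le] del: One_nat_def)
    also have "measure lborel {real (j - 1) / b<..real j / b} = 1 / b"
      unfolding measure_lborel_Ioc[OF le] using assms that by (simp add: of_nat_diff field_simps)
    finally show ?thesis .
  qed
  then have "has_bochner_integral lborel (\<lambda>z. \<Sum>j=1..N. indicator {real (j - 1) / b<..real j / b} z * a j) (\<Sum>j=1..N. 1 / b * a j)"
    by (intro has_bochner_integral_sum has_bochner_integral_mult_left) auto
  then show ?thesis by (simp add: grid_step_def[abs_def] sum_divide_distrib)
qed

lemma grid_step_nonpos: "b > 0 \<Longrightarrow> z \<le> 0 \<Longrightarrow> grid_step b N a z = 0"
  unfolding grid_step_def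
proof (intro sum.neutral ballI)
  fix j assume "b > 0" "z \<le> 0"
  then have "z \<le> real (j - 1) / b" by (meson divide_nonneg_pos of_nat_0_le_iff order_trans)
  then show "indicator {real (j - 1) / b<..real j / b} z * a j = 0" by simp
qed

lemma grid_step_pos:
  assumes b: "b > 0" and z: "z > 0"
  shows "grid_step b N a z = (if nat \<lceil>z * b\<rceil> \<le> N then a (nat \<lceil>z * b\<rceil>) else 0)"
proof -
  have pos: "0 < \<lceil>z * b\<rceil>" using b z by simp
  have "indicator {real (j - 1) / b<..real j / b} z = (if j = nat \<lceil>z * b\<rceil> then 1 else 0 :: real)" if "j \<ge> 1" for j
  proof -
    have "z \<in> {real (j - 1) / b<..real j / b} \<longleftrightarrow> real j - 1 < z * b \<and> z * b \<le> real j"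
      using b that by (simp add: pos_divide_less_eq pos_le_divide_eq of_nat_diff)
    also have "\<dots> \<longleftrightarrow> \<lceil>z * b\<rceil> = int j" by (simp add: ceiling_eq_iff)
    also have "\<dots> \<longleftrightarrow> j = nat \<lceil>z * b\<rceil>" using pos by auto
    finally show ?thesis by (simp add: indicator_def)
  qed
  then have "grid_step b N a z = (\<Sum>j=1..N. if j = nat \<lceil>z * b\<rceil> then a j else 0)"
    unfolding grid_step_def by (intro sum.cong refl) auto
  then show ?thesis using pos by (simp add: Suc_le_eq)
qed

lemma grid_step_le_envelope:
  assumes e: "\<And>x y. 0 < x \<Longrightarrow> x \<le> y \<Longrightarrow> e y \<le> e x" "\<And>x. 0 < x \<Longrightarrow> 0 \<le> (e x :: real)"
    and b: "b > 0" and a: "\<And>j. 1 \<le> j \<Longrightarrow> j \<le> N \<Longrightarrow> \<bar>a j\<bar> \<le> e (real j / b)"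
  shows "\<bar>grid_step b N a z\<bar> \<le> indicator {0<..} z * e z"
proof (cases "z > 0")
  case True
  have J: "1 \<le> nat \<lceil>z * b\<rceil>" using True b by (simp add: Suc_le_eq)
  have "z \<le> real (nat \<lceil>z * b\<rceil>) / b" using b True by (simp add: pos_le_divide_eq)
  then have "e (real (nat \<lceil>z * b\<rceil>) / b) \<le> e z" using True by (intro e)
  then show ?thesis using True b a[OF J] e(2)[OF True] by (auto simp: grid_step_pos intro: order_trans)
qed (use b in \<open>simp add: grid_step_nonpos\<close>)

text \<open>Integrating the pointwise domination gives a bound linear in \<open>b\<close> and
  uniform in \<open>N\<close>. With \<open>b = p n\<close> this is the growth rate of the squared
  kernel sums.\<close>

lemma sum_le_envelope_integral:
  assumes e: "\<And>x y. 0 < x \<Longrightarrow> x \<le> y \<Longrightarrow> e y \<le> e x" "\<And>x. 0 < x \<Longrightarrow> 0 \<le> (e x :: real)"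
    and int: "integrable lborel (\<lambda>x. indicator {0<..} x * e x)"
    and b: "b > 0" and a: "\<And>j. 1 \<le> j \<Longrightarrow> j \<le> N \<Longrightarrow> \<bar>a j\<bar> \<le> e (real j / b)"
  shows "(\<Sum>j=1..N. a j) \<le> b * (\<integral>x. indicator {0<..} x * e x \<partial>lborel)"
proof -
  have "(\<Sum>j=1..N. a j) / b = (\<integral>x. grid_step b N a x \<partial>lborel)"
    using has_bochner_integral_integral_eq[OF has_bochner_integral_grid_step[OF b]] by simp
  also have "\<dots> \<le> (\<integral>x. indicator {0<..} x * e x \<partial>lborel)"
  proof (intro integral_mono int)
    show "integrable lborel (grid_step b N a)"
      using has_bochner_integral_grid_step[OF b, of N a] by (simp add: has_bochner_integral_iff)
    show "grid_step b N a x \<le> indicator {0<..} x * e x" for x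
      using grid_step_le_envelope[where e = e and a = a and N = N and z = x, OF e b a] by simp
  qed
  finally show ?thesis using b by (simp add: pos_divide_le_eq mult.commute)
qed

lemma tendsto_ceiling_grid:
  fixes p :: "nat \<Rightarrow> real"
  assumes "filterlim p at_top sequentially"
  shows "(\<lambda>n. real_of_int \<lceil>z * p n\<rceil> / p n) \<longlonglongrightarrow> z"
proof (rule tendsto_sandwich)
  have pos: "eventually (\<lambda>n. p n > 0) sequentially" using assms by (simp add: filterlim_at_top_dense)
  show "eventually (\<lambda>n. z \<le> real_of_int \<lceil>z * p n\<rceil> / p n) sequentially"
    using pos by eventually_elim (simp add: pos_le_divide_eq)
  show "eventually (\<lambda>n. real_of_int \<lceil>z * p n\<rceil> / p n \<le> z + 1 / p n) sequentially"
    using pos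
  proof eventually_elim
    fix n assume "p n > 0"
    moreover have "real_of_int \<lceil>z * p n\<rceil> \<le> z * p n + 1" by linarith
    ultimately show "real_of_int \<lceil>z * p n\<rceil> / p n \<le> z + 1 / p n" by (simp add: field_simps)
  qed
  have "(\<lambda>n. 1 / p n) \<longlonglongrightarrow> 0" by (rule tendsto_divide_0[OF tendsto_const]) (use assms in \<open>simp add: filterlim_at_top_imp_at_infinity\<close>)
  from tendsto_add[OF tendsto_const[of z] this] show "(\<lambda>n. z + 1 / p n) \<longlonglongrightarrow> z" by simp
qed simp

section \<open>Asymptotics of the centering and the scaling\<close>

locale kernel =
  fixes k :: "real \<Rightarrow> real" and p :: "nat \<Rightarrow> real" and \<alpha> :: real
  assumes k_range: "\<And>x. k x \<in> {-1..1}"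
    and k_sym: "\<And>x. k (- x) = k x"
    and k_cont0: "isCont k 0"
    and k_cont: "finite {x. \<not> isCont k x}"
    and k0: "k 0 = 1"
    and \<alpha>: "\<alpha> > 1 / 2"
    and k_decay: "k \<in> O[at_top](\<lambda>x. x powr (- \<alpha>))"
    and p_pos: "\<And>n. n \<ge> 1 \<Longrightarrow> p n > 0"
    and p_top: "filterlim p at_top sequentially"
    and p_small: "(\<lambda>n. p n / real n) \<longlonglongrightarrow> 0"
begin

lemma k_square_le_1: "(k x)\<^sup>2 \<le> 1"
  using k_range[of x] by (simp add: abs_square_le_1 abs_le_iff)

lemma borel_measurable_k [measurable]: "k \<in> borel_measurable borel"
proof (rule borel_measurable_continuous_countable_exceptions)
  show "countable {x. \<not> isCont k x}" using k_cont by (rule countable_finite)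
  show "continuous_on (- {x. \<not> isCont k x}) k"
    by (intro continuous_at_imp_continuous_on) auto
qed

lemma sum_k_square_bound:
  obtains B where "B \<ge> 0" "\<And>n N. n \<ge> 1 \<Longrightarrow> (\<Sum>j=1..N. (k (real j / p n))\<^sup>2) \<le> p n * B"
proof -
  obtain e where e: "\<And>x y. 0 < x \<Longrightarrow> x \<le> y \<Longrightarrow> e y \<le> e x" "\<And>x. 0 < x \<Longrightarrow> (k x)\<^sup>2 \<le> e x"
    "integrable lborel (\<lambda>x. indicator {0<..} x * e x :: real)"
    using decreasing_envelope[OF k_range \<alpha> k_decay] by blast
  have e0: "0 \<le> e x" if "0 < x" for x using e(2)[OF that] zero_le_power2[of "k x"] by linarith
  show ?thesis
  proof (rule that)
    show "0 \<le> (\<integral>x. indicator {0<..} x * e x \<partial>lborel)"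
      using e0 by (intro integral_nonneg_AE AE_I2) (simp add: indicator_def)
    show "(\<Sum>j=1..N. (k (real j / p n))\<^sup>2) \<le> p n * (\<integral>x. indicator {0<..} x * e x \<partial>lborel)" if "n \<ge> 1" for n N
      by (rule sum_le_envelope_integral[where e = e])
        (use e e0 p_pos[OF that] in auto)
  qed
qed

lemma centering_nonneg: "0 \<le> centering k b n"
  unfolding centering_def by (intro sum_nonneg mult_nonneg_nonneg) (auto simp: divide_le_eq_1)

lemma centering_limit: "(\<lambda>n. centering k (p n) n / real n) \<longlonglongrightarrow> 0"
proof -
  obtain B where B: "B \<ge> 0" "\<And>n N. n \<ge> 1 \<Longrightarrow> (\<Sum>j=1..N. (k (real j / p n))\<^sup>2) \<le> p n * B"
    using sum_k_square_bound by blast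
  have le: "centering k (p n) n / real n \<le> p n / real n * B" if "n \<ge> 1" for n
  proof -
    have "centering k (p n) n \<le> (\<Sum>j=1..n-1. (k (real j / p n))\<^sup>2)"
      unfolding centering_def by (intro sum_mono mult_left_le_one_le) (auto simp: divide_le_eq_1)
    also have "\<dots> \<le> p n * B" by (rule B(2)[OF that])
    finally show ?thesis by (simp add: divide_right_mono)
  qed
  show ?thesis
  proof (rule tendsto_sandwich[OF _ _ tendsto_const])
    show "\<forall>\<^sub>F n in sequentially. 0 \<le> centering k (p n) n / real n" by (simp add: centering_nonneg)
    show "\<forall>\<^sub>F n in sequentially. centering k (p n) n / real n \<le> p n / real n * B"
      using eventually_ge_at_top[of 1] by eventually_elim (rule le)
    show "(\<lambda>n. p n / real n * B) \<longlonglongrightarrow> 0" using tendsto_mult[OF p_small tendsto_const[of B]] by simp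
  qed
qed

text \<open>The scaling over \<open>p n\<close> is the integral of step functions tending almost
  everywhere to \<open>k ^ 4\<close> on the half line: the lag whose cell contains \<open>z\<close>
  is \<open>z * p n\<close> rounded up, hence negligible against \<open>n\<close>, so both weights
  tend to 1. The envelope dominates, as \<open>k ^ 4 \<le> k\<^sup>2\<close>.\<close>

lemma
  shows scaling_limit: "(\<lambda>n. scaling k (p n) n / p n) \<longlonglongrightarrow> (LINT z:{0..}|lborel. k z ^ 4)"
    and integral_k_power4_pos: "0 < (LINT z:{0..}|lborel. k z ^ 4)"
proof -
  obtain e where e: "\<And>x y. 0 < x \<Longrightarrow> x \<le> y \<Longrightarrow> e y \<le> e x" "\<And>x. 0 < x \<Longrightarrow> (k x)\<^sup>2 \<le> e x"
    "integrable lborel (\<lambda>x. indicator {0<..} x * e x :: real)"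
    using decreasing_envelope[OF k_range \<alpha> k_decay] by blast
  have e0: "0 \<le> e x" if "0 < x" for x using e(2)[OF that] zero_le_power2[of "k x"] by linarith
  have k4: "k x ^ 4 \<le> (k x)\<^sup>2" for x
  proof -
    have "k x ^ 4 = (k x)\<^sup>2 * (k x)\<^sup>2" by (simp add: power_numeral_reduce power2_eq_square)
    also have "\<dots> \<le> (k x)\<^sup>2" using k_square_le_1 by (intro mult_left_le) auto
    finally show ?thesis .
  qed
  define a where "a n j = (1 - real j / real n) * (1 - real (j + 1) / real n) * k (real j / p n) ^ 4" for n j
  define f where "f z = indicator {0..} z * k z ^ 4" for z
  have a_le: "\<bar>a n j\<bar> \<le> e (real j / p n)" if "n \<ge> 1" "1 \<le> j" "j \<le> n - 2" for n j
  proof -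
    have "real j / real n \<le> 1" "real (j + 1) / real n \<le> 1" using that by (auto simp: divide_le_eq_1)
    then have "\<bar>(1 - real j / real n) * (1 - real (j + 1) / real n)\<bar> \<le> 1"
      unfolding abs_mult by (intro mult_le_one) auto
    then have "\<bar>a n j\<bar> \<le> k (real j / p n) ^ 4"
      unfolding a_def abs_mult[of _ "k _ ^ 4"] using mult_right_mono[of _ 1 "\<bar>k (real j / p n) ^ 4\<bar>"] by simp
    also have "\<dots> \<le> (k (real j / p n))\<^sup>2" by (rule k4)
    also have "\<dots> \<le> e (real j / p n)" using p_pos[of n] that by (intro e(2)) auto
    finally show ?thesis .
  qed
  have sc: "(\<integral>z. grid_step (p n) (n - 2) (a n) z \<partial>lborel) = scaling k (p n) n / p n" if "n \<ge> 1" for n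
    using has_bochner_integral_integral_eq[OF has_bochner_integral_grid_step[OF p_pos[OF that]], of "n - 2" "a n"]
    by (simp add: scaling_def a_def)
  \<comment> \<open>The index is shifted because \<open>p 0\<close> may fail to be positive, while
    domination is required at every index.\<close>
  have lim: "(\<lambda>n. grid_step (p (Suc n)) (Suc n - 2) (a (Suc n)) z) \<longlonglongrightarrow> f z"
    if z: "z \<notin> {0} \<union> {x. \<not> isCont k x}" for z
  proof (cases "z > 0")
    case False
    then show ?thesis using z p_pos[of "Suc _"] by (simp add: grid_step_nonpos f_def)
  next
    case True
    define J where "J n = nat \<lceil>z * p n\<rceil>" for n
    have J1: "(\<lambda>n. real (J n) / p n) \<longlonglongrightarrow> z"
    proof (rule Lim_transform_eventually[OF tendsto_ceiling_grid[OF p_top]])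
      show "\<forall>\<^sub>F n in sequentially. real_of_int \<lceil>z * p n\<rceil> / p n = real (J n) / p n"
        using eventually_ge_at_top[of 1]
      proof eventually_elim
        fix n :: nat assume "1 \<le> n"
        then have "0 < z * p n" using p_pos[of n] True by simp
        then show "real_of_int \<lceil>z * p n\<rceil> / p n = real (J n) / p n" by (simp add: J_def)
      qed
    qed
    have "(\<lambda>n. real (J n) / p n * (p n / real n)) \<longlonglongrightarrow> z * 0" by (rule tendsto_mult[OF J1 p_small])
    moreover have "\<forall>\<^sub>F n in sequentially. real (J n) / p n * (p n / real n) = real (J n) / real n"
      using eventually_ge_at_top[of 1]
    proof eventually_elim
      fix n :: nat assume "1 \<le> n"
      then show "real (J n) / p n * (p n / real n) = real (J n) / real n" using p_pos[of n] by simp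
    qed
    ultimately have J2: "(\<lambda>n. real (J n) / real n) \<longlonglongrightarrow> 0"
      using Lim_transform_eventually by fastforce
    have J3: "(\<lambda>n. real (J n + 1) / real n) \<longlonglongrightarrow> 0"
      using tendsto_add[OF J2 lim_1_over_n] by (simp add: add_divide_distrib add.commute)
    have "(\<lambda>n. a n (J n)) \<longlonglongrightarrow> (1 - 0) * (1 - 0) * k z ^ 4"
      unfolding a_def
      by (intro tendsto_mult tendsto_diff tendsto_const J2 J3 tendsto_power isCont_tendsto_compose[OF _ J1]) (use z in auto)
    then have A: "(\<lambda>n. a n (J n)) \<longlonglongrightarrow> f z" using True by (simp add: f_def)
    \<comment> \<open>The extra \<open>1 / n\<close> yields \<open>J n + 2 < n\<close>, which puts
      the lag inside the range up to \<open>n - 2\<close> of the scaling.\<close>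
    have "(\<lambda>n. real (J n + 1) / real n + 1 / real n) \<longlonglongrightarrow> 0 + 0" by (intro tendsto_add J3 lim_1_over_n)
    then have "\<forall>\<^sub>F n in sequentially. real (J n + 1) / real n + 1 / real n < 1" by (rule order_tendstoD) simp
    then have "\<forall>\<^sub>F n in sequentially. a n (J n) = grid_step (p n) (n - 2) (a n) z"
      using eventually_ge_at_top[of 1]
    proof eventually_elim
      fix n :: nat assume n: "real (J n + 1) / real n + 1 / real n < 1" "1 \<le> n"
      then have "real (J n + 2) < real n" by (simp add: field_simps)
      then have "J n + 2 < n" by linarith
      then have "nat \<lceil>z * p n\<rceil> \<le> n - 2" unfolding J_def by linarith
      then show "a n (J n) = grid_step (p n) (n - 2) (a n) z"
        unfolding J_def grid_step_pos[OF p_pos[OF n(2)] True] by (simp only: if_True)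
    qed
    from Lim_transform_eventually[OF A this] show ?thesis by (rule LIMSEQ_Suc)
  qed
  have fin: "finite ({0} \<union> {x. \<not> isCont k x})" using k_cont by simp
  have meas: "f \<in> borel_measurable lborel" unfolding f_def by measurable
  have "integrable lborel f \<and>
    (\<lambda>n. \<integral>z. grid_step (p (Suc n)) (Suc n - 2) (a (Suc n)) z \<partial>lborel) \<longlonglongrightarrow> (\<integral>z. f z \<partial>lborel)"
  proof (intro conjI)
    have AE: "AE z in lborel. (\<lambda>n. grid_step (p (Suc n)) (Suc n - 2) (a (Suc n)) z) \<longlonglongrightarrow> f z"
      using AE_not_in[OF finite_imp_null_set_lborel[OF fin]] by eventually_elim (rule lim)
    have gm: "grid_step (p (Suc n)) (Suc n - 2) (a (Suc n)) \<in> borel_measurable lborel" for n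
      by simp
    have bd: "AE z in lborel. norm (grid_step (p (Suc n)) (Suc n - 2) (a (Suc n)) z) \<le> indicator {0<..} z * e z" for n
      unfolding real_norm_def by (intro AE_I2 grid_step_le_envelope[where e = e] e(1) e0 p_pos a_le) auto
    show "integrable lborel f" by (rule integrable_dominated_convergence[OF meas gm e(3) AE bd])
    show "(\<lambda>n. \<integral>z. grid_step (p (Suc n)) (Suc n - 2) (a (Suc n)) z \<partial>lborel) \<longlonglongrightarrow> (\<integral>z. f z \<partial>lborel)"
      by (rule integral_dominated_convergence[OF meas gm e(3) AE bd])
  qed
  then have int_f: "integrable lborel f" and conv: "(\<lambda>n. scaling k (p (Suc n)) (Suc n) / p (Suc n)) \<longlonglongrightarrow> (\<integral>z. f z \<partial>lborel)"
    using sc[of "Suc _"] by simp_all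
  have D: "(LINT z:{0..}|lborel. k z ^ 4) = (\<integral>z. f z \<partial>lborel)"
    by (simp add: set_lebesgue_integral_def f_def)
  show "(\<lambda>n. scaling k (p n) n / p n) \<longlonglongrightarrow> (LINT z:{0..}|lborel. k z ^ 4)"
    unfolding D by (rule LIMSEQ_imp_Suc[OF conv])
  \<comment> \<open>Positivity: near 0 the kernel exceeds 1/2, so the integral is at least
    \<open>(d / 2) * (1 / 2) ^ 4\<close>.\<close>
  have "\<forall>\<^sub>F x in at 0. k x > 1 / 2"
    using k_cont0 unfolding isCont_def by (rule order_tendstoD) (simp add: k0)
  then obtain d where d: "d > 0" "\<And>x. x \<noteq> 0 \<Longrightarrow> \<bar>x\<bar> < d \<Longrightarrow> k x > 1 / 2"
    unfolding eventually_at by (auto simp: dist_real_def)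
  have "0 < (d / 2) * (1 / 2) ^ 4" using d by simp
  also have "\<dots> = (\<integral>z. indicator {0..d / 2} z * (1 / 2) ^ 4 \<partial>lborel)" using d by simp
  also have "\<dots> \<le> (\<integral>z. f z \<partial>lborel)"
  proof (rule integral_mono[OF _ int_f])
    have "integrable lborel (indicator {0..d / 2} :: real \<Rightarrow> real)"
      by (rule integrable_real_indicator) (simp_all add: emeasure_lborel_Icc_eq)
    then show "integrable lborel (\<lambda>z. indicator {0..d / 2} z * (1 / 2) ^ 4 :: real)" by (rule integrable_mult_left)
    fix z
    show "indicator {0..d / 2} z * (1 / 2) ^ 4 \<le> f z"
    proof (cases "z \<in> {0..d / 2}")
      case True
      have "1 / 2 \<le> k z" using d True k0 by (cases "z = 0") (auto intro!: less_imp_le)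
      then have "(1 / 2) ^ 4 \<le> k z ^ 4" by (intro power_mono) auto
      then show ?thesis using True by (simp add: f_def)
    qed (simp add: f_def)
  qed
  finally show "0 < (LINT z:{0..}|lborel. k z ^ 4)" unfolding D .
qed

end

subsection \<open>Convergence in probability\<close>

text \<open>Chebyshev's argument around a moving deterministic centre, which accommodates bias: once
  \<open>x n\<close> is within \<open>\<epsilon> / 2\<close> of \<open>c\<close>, Markov's
  inequality for the majorant \<open>Y n\<close> handles the other half.\<close>

lemma tendsto_in_probability_square_bound:
  assumes M: "prob_space M" and x: "x \<longlonglongrightarrow> c"
    and int: "\<And>n. n \<ge> 1 \<Longrightarrow> integrable M (Y n)"
    and le: "\<And>n w. n \<ge> 1 \<Longrightarrow> (X n w - x n)\<^sup>2 \<le> Y n w"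
    and lim: "(\<lambda>n. \<integral>w. Y n w \<partial>M) \<longlonglongrightarrow> 0"
  shows "tendsto_in_probability M X c"
  unfolding tendsto_in_probability_def
proof (intro allI impI)
  interpret prob_space M by fact
  fix \<epsilon> :: real assume \<epsilon>: "0 < \<epsilon>"
  have bound: "measure M {w \<in> space M. \<bar>X n w - c\<bar> > \<epsilon>} \<le> (\<integral>w. Y n w \<partial>M) / (\<epsilon> / 2)\<^sup>2"
    if n: "n \<ge> 1" "\<bar>x n - c\<bar> < \<epsilon> / 2" for n
  proof -
    have [measurable]: "Y n \<in> borel_measurable M" using int[OF n(1)] by auto
    have "{w \<in> space M. \<bar>X n w - c\<bar> > \<epsilon>} \<subseteq> {w \<in> space M. Y n w \<ge> (\<epsilon> / 2)\<^sup>2}"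
    proof safe
      fix w assume "\<bar>X n w - c\<bar> > \<epsilon>"
      then have "\<epsilon> / 2 \<le> \<bar>X n w - x n\<bar>" using n(2) by linarith
      then have "(\<epsilon> / 2)\<^sup>2 \<le> \<bar>X n w - x n\<bar>\<^sup>2" using \<epsilon> by (intro power_mono) auto
      then show "(\<epsilon> / 2)\<^sup>2 \<le> Y n w" using le[OF n(1), of w] by simp
    qed
    then have "measure M {w \<in> space M. \<bar>X n w - c\<bar> > \<epsilon>} \<le> measure M {w \<in> space M. Y n w \<ge> (\<epsilon> / 2)\<^sup>2}"
      by (intro finite_measure_mono) measurable
    also have "\<dots> \<le> (\<integral>w. Y n w \<partial>M) / (\<epsilon> / 2)\<^sup>2"
      using \<epsilon> order_trans[OF zero_le_power2 le[OF n(1)]]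
      by (intro integral_Markov_inequality_measure[where A = "{}"] int n) auto
    finally show ?thesis .
  qed
  have near: "\<forall>\<^sub>F n in sequentially. \<bar>x n - c\<bar> < \<epsilon> / 2"
    using tendstoD[OF x, of "\<epsilon> / 2"] \<epsilon> by (simp add: dist_real_def)
  show "(\<lambda>n. measure M {w \<in> space M. \<bar>X n w - c\<bar> > \<epsilon>}) \<longlonglongrightarrow> 0"
  proof (rule tendsto_sandwich[OF _ _ tendsto_const])
    show "\<forall>\<^sub>F n in sequentially. measure M {w \<in> space M. \<bar>X n w - c\<bar> > \<epsilon>} \<le> (\<integral>w. Y n w \<partial>M) / (\<epsilon> / 2)\<^sup>2"
      using eventually_ge_at_top[of 1] near by eventually_elim (rule bound)
    show "(\<lambda>n. (\<integral>w. Y n w \<partial>M) / (\<epsilon> / 2)\<^sup>2) \<longlonglongrightarrow> 0"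
      using tendsto_divide[OF lim tendsto_const[of "(\<epsilon> / 2)\<^sup>2"]] \<epsilon> by simp
  qed simp
qed

lemma tendsto_in_probability_deterministic:
  assumes "prob_space M" "x \<longlonglongrightarrow> c"
  shows "tendsto_in_probability M (\<lambda>n w. x n) c"
  by (rule tendsto_in_probability_square_bound[where Y = "\<lambda>n w. 0", OF assms]) auto

text \<open>Continuous mapping at a constant limit; with two arguments at a time the statistic can
  be assembled operation by operation.\<close>

lemma tendsto_in_probability_continuous2:
  fixes f :: "real \<Rightarrow> real \<Rightarrow> real"
  assumes M: "prob_space M"
    and [measurable]: "\<And>n. X n \<in> borel_measurable M" "\<And>n. Y n \<in> borel_measurable M"
    and X: "tendsto_in_probability M X a" and Y: "tendsto_in_probability M Y b"
    and f: "isCont (\<lambda>p. f (fst p) (snd p)) (a, b)"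
  shows "tendsto_in_probability M (\<lambda>n w. f (X n w) (Y n w)) (f a b)"
  unfolding tendsto_in_probability_def
proof (intro allI impI)
  interpret prob_space M by fact
  fix \<epsilon> :: real assume "0 < \<epsilon>"
  then obtain d where d: "d > 0" "\<And>q. dist q (a, b) < d \<Longrightarrow> dist (f (fst q) (snd q)) (f a b) < \<epsilon>"
    using f unfolding continuous_at_eps_delta by (metis fst_conv snd_conv)
  \<comment> \<open>Thirds instead of halves, because the complementary events carry non-strict
    bounds and the sum must stay below \<open>d\<close>.\<close>
  have near: "\<bar>f s t - f a b\<bar> < \<epsilon>" if "\<bar>s - a\<bar> \<le> d / 3" "\<bar>t - b\<bar> \<le> d / 3" for s t
  proof -
    have "dist (s, t) (a, b) \<le> \<bar>s - a\<bar> + \<bar>t - b\<bar>"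
      unfolding dist_Pair_Pair dist_real_def by (rule real_le_lsqrt) (auto simp: power2_sum)
    also have "\<dots> < d" using that d(1) by linarith
    finally show ?thesis using d(2)[of "(s, t)"] by (simp add: dist_real_def)
  qed
  let ?P = "\<lambda>n. measure M {w \<in> space M. \<bar>X n w - a\<bar> > d / 3} + measure M {w \<in> space M. \<bar>Y n w - b\<bar> > d / 3}"
  have "?P \<longlonglongrightarrow> 0 + 0"
    by (intro tendsto_add X[unfolded tendsto_in_probability_def, rule_format]
        Y[unfolded tendsto_in_probability_def, rule_format]) (use d(1) in auto)
  then have lim: "?P \<longlonglongrightarrow> 0" by simp
  have le: "measure M {w \<in> space M. \<bar>f (X n w) (Y n w) - f a b\<bar> > \<epsilon>} \<le> ?P n" for n
  proof -
    have "{w \<in> space M. \<bar>f (X n w) (Y n w) - f a b\<bar> > \<epsilon>} \<subseteq>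
        {w \<in> space M. \<bar>X n w - a\<bar> > d / 3} \<union> {w \<in> space M. \<bar>Y n w - b\<bar> > d / 3}"
      using near by (force simp: not_le[symmetric])
    then have "measure M {w \<in> space M. \<bar>f (X n w) (Y n w) - f a b\<bar> > \<epsilon>} \<le>
        measure M ({w \<in> space M. \<bar>X n w - a\<bar> > d / 3} \<union> {w \<in> space M. \<bar>Y n w - b\<bar> > d / 3})"
      by (intro finite_measure_mono) measurable
    also have "\<dots> \<le> ?P n" by (intro measure_Un_le) measurable
    finally show ?thesis .
  qed
  show "(\<lambda>n. measure M {w \<in> space M. \<bar>f (X n w) (Y n w) - f a b\<bar> > \<epsilon>}) \<longlonglongrightarrow> 0"
    by (rule tendsto_sandwich[OF _ _ tendsto_const lim]) (use le in auto)
qed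

lemma tendsto_in_probability_cong:
  assumes "\<And>n w. n \<ge> 1 \<Longrightarrow> X n w = Y n w" and X: "tendsto_in_probability M X c"
  shows "tendsto_in_probability M Y c"
  unfolding tendsto_in_probability_def
proof (intro allI impI)
  fix \<epsilon> :: real assume "0 < \<epsilon>"
  then have "(\<lambda>n. measure M {w \<in> space M. \<bar>X n w - c\<bar> > \<epsilon>}) \<longlonglongrightarrow> 0"
    using X by (simp add: tendsto_in_probability_def)
  then show "(\<lambda>n. measure M {w \<in> space M. \<bar>Y n w - c\<bar> > \<epsilon>}) \<longlonglongrightarrow> 0"
  proof (rule Lim_transform_eventually)
    show "\<forall>\<^sub>F n in sequentially. measure M {w \<in> space M. \<bar>X n w - c\<bar> > \<epsilon>} = measure M {w \<in> space M. \<bar>Y n w - c\<bar> > \<epsilon>}"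
      using eventually_ge_at_top[of 1] by eventually_elim (simp add: assms(1))
  qed
qed

text \<open>Tannery's theorem with majorant \<open>c\<close>. The truncation at \<open>n - 1\<close>
  is absorbed into the terms, and index \<open>i\<close> stands for lag
  \<open>Suc i\<close>.\<close>

lemma weighted_sum_limit:
  fixes c :: "nat \<Rightarrow> real"
  assumes c: "\<And>j. 0 \<le> c j" and lim: "(\<lambda>n. \<Sum>j=1..n. c j) \<longlonglongrightarrow> s"
    and w: "\<And>n j. 1 \<le> j \<Longrightarrow> j \<le> n \<Longrightarrow> \<bar>w n j\<bar> \<le> 1" "\<And>j. (\<lambda>n. w n j) \<longlonglongrightarrow> 1"
  shows "(\<lambda>n. \<Sum>j=1..n-1. w n j * c j) \<longlonglongrightarrow> s"
proof -
  define a where "a i n = (if Suc i \<le> n - 1 then w n (Suc i) * c (Suc i) else 0)" for i n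
  have sums: "(\<lambda>i. c (Suc i)) sums s"
    unfolding sums_def using lim by (simp add: sum.atLeast_Suc_atMost_Suc_shift[symmetric] lessThan_Suc_atMost atLeast0LessThan sum.atLeast1_atMost_eq)
  have "(\<lambda>n. \<Sum>i. a i n) \<longlonglongrightarrow> (\<Sum>i. c (Suc i))"
  proof (rule conjunct2[OF conjunct2[OF tannerys_theorem[where M = "\<lambda>i. c (Suc i)"]]])
    fix i
    have "\<forall>\<^sub>F n in sequentially. w n (Suc i) * c (Suc i) = a i n"
      using eventually_ge_at_top[of "i + 2"] by eventually_elim (auto simp: a_def)
    moreover have "(\<lambda>n. w n (Suc i) * c (Suc i)) \<longlonglongrightarrow> 1 * c (Suc i)" by (intro tendsto_mult w tendsto_const)
    ultimately show "(\<lambda>n. a i n) \<longlonglongrightarrow> c (Suc i)" using Lim_transform_eventually by fastforce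
  next
    have "norm (a i n) \<le> c (Suc i)" for i n
      using mult_right_mono[OF w(1)[of "Suc i" n] c[of "Suc i"]] c[of "Suc i"] by (auto simp: a_def abs_mult)
    then show "\<forall>\<^sub>F (i, n) in at_top \<times>\<^sub>F sequentially. norm (a i n) \<le> c (Suc i)"
      by (intro always_eventually) auto
    show "summable (\<lambda>i. c (Suc i))" using sums by (rule sums_summable)
  qed simp
  moreover have "(\<Sum>i. a i n) = (\<Sum>j=1..n-1. w n j * c j)" for n
  proof -
    have "(\<Sum>i. a i n) = (\<Sum>i<n-1. a i n)" by (rule suminf_finite) (auto simp: a_def)
    also have "\<dots> = (\<Sum>i<n-1. w n (Suc i) * c (Suc i))" by (intro sum.cong refl) (auto simp: a_def)
    also have "\<dots> = (\<Sum>j=1..n-1. w n j * c j)" by (simp add: sum.atLeast1_atMost_eq)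
    finally show ?thesis .
  qed
  ultimately show ?thesis using sums by (simp add: sums_iff)
qed

lemma L2_set_diff_le:
  assumes "\<And>i. i \<in> A \<Longrightarrow> 0 \<le> f i" "\<And>i. i \<in> A \<Longrightarrow> 0 \<le> g i" "\<And>i. i \<in> A \<Longrightarrow> \<bar>f i - g i\<bar> \<le> h i"
  shows "\<bar>L2_set f A - L2_set g A\<bar> \<le> L2_set h A"
proof -
  have *: "L2_set f A \<le> L2_set g A + L2_set h A"
    if "\<And>i. i \<in> A \<Longrightarrow> 0 \<le> f i" "\<And>i. i \<in> A \<Longrightarrow> \<bar>f i - g i\<bar> \<le> h i" for f g
  proof -
    have "L2_set f A \<le> L2_set (\<lambda>i. g i + h i) A"
    proof (rule L2_set_mono)
      fix i assume "i \<in> A"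
      then show "f i \<le> g i + h i" using that(2)[of i] by linarith
    qed (rule that(1))
    also have "\<dots> \<le> L2_set g A + L2_set h A" by (rule L2_set_triangle_ineq)
    finally show ?thesis .
  qed
  have "L2_set f A \<le> L2_set g A + L2_set h A" by (rule *) (use assms in auto)
  moreover have "L2_set g A \<le> L2_set f A + L2_set h A" by (rule *) (use assms in \<open>auto simp: abs_minus_commute\<close>)
  ultimately show ?thesis by linarith
qed

context centered_stationary
begin

text \<open>By \<open>x \<le> 1 + x * x\<close> the second moment is bounded by the fourth, and the
  mixed moment estimate at equal times and \<open>j = 0\<close> bounds that one independently of
  \<open>t\<close>.\<close>

lemma second_moment_bounded:
  assumes N: "(\<Sum>\<^sub>\<infinity>j. (nuclear_norm (hs_blinfun (C j)))\<^sup>2) < \<infinity>"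
    and K: "(SUP j. \<Sum>\<^sub>\<infinity>h. nuclear_norm (cumulant_operator M u (h + j) h j)) < \<infinity>"
  obtains m where "0 \<le> m" "\<And>t. (\<integral>w. (norm (u t w))\<^sup>2 \<partial>M) \<le> m"
proof -
  have "(\<Sum>\<^sub>\<infinity>h. nuclear_norm (cumulant_operator M u (h + 0) h 0)) \<le>
      (SUP j. \<Sum>\<^sub>\<infinity>h. nuclear_norm (cumulant_operator M u (h + j) h j))"
    by (rule SUP_upper) simp
  from ennreal_infsum_bounds(1)[OF this K, of 0]
  have K0: "nuclear_norm (cumulant_operator M u (t - t + 0) (t - t) 0) < \<infinity>" for t by simp
  have N0: "nuclear_norm (hs_blinfun (C (t - t))) < \<infinity>" for t
    using ennreal_infsum_bounds(1)[OF order_refl N, of 0] by (simp add: power_less_top_ennreal)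
  define m where "m = 1 + ((norm (C 0))\<^sup>2 + (enn2real (nuclear_norm (cumulant_operator M u 0 0 0)) +
     (enn2real (nuclear_norm (hs_blinfun (C 0))))\<^sup>2 + norm (C 0) * norm (C 0)))"
  have "(\<integral>w. (norm (u t w))\<^sup>2 \<partial>M) \<le> m" for t
  proof -
    have "(\<integral>w. (norm (u t w))\<^sup>2 \<partial>M) \<le> (\<integral>w. 1 + (u t w \<bullet> u t w) * (u (t - 0) w \<bullet> u (t - 0) w) \<partial>M)"
    proof (rule integral_mono)
      show "integrable M (\<lambda>w. (norm (u t w))\<^sup>2)"
        using integrable_norm2[of t t] by (simp add: power2_eq_square)
      show "integrable M (\<lambda>w. 1 + (u t w \<bullet> u t w) * (u (t - 0) w \<bullet> u (t - 0) w))"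
        by (intro Bochner_Integration.integrable_add integrable_const integrable_inner_mult)
      have "x \<le> 1 + x * x" for x :: real
      proof -
        have "0 \<le> (x - 1)\<^sup>2 + 1 + x * x" by (simp add: add_nonneg_nonneg)
        then show ?thesis by (simp add: power2_eq_square algebra_simps)
      qed
      then show "(norm (u t w))\<^sup>2 \<le> 1 + (u t w \<bullet> u t w) * (u (t - 0) w \<bullet> u (t - 0) w)" for w
        by (simp add: power2_norm_eq_inner)
    qed
    also have "\<dots> = 1 + (\<integral>w. (u t w \<bullet> u t w) * (u (t - 0) w \<bullet> u (t - 0) w) \<partial>M)"
      by (subst Bochner_Integration.integral_add[OF integrable_const integrable_inner_mult]) (simp add: prob_space)
    also have "\<dots> \<le> m"
      using integral_inner_mult_le[OF K0 N0, of t] by (simp add: m_def)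
    finally show ?thesis .
  qed
  moreover have "0 \<le> m" by (simp add: m_def add_nonneg_nonneg)
  ultimately show ?thesis using that by blast
qed

lemma
  assumes m: "0 \<le> m" "\<And>t. (\<integral>w. (norm (u t w))\<^sup>2 \<partial>M) \<le> m"
  shows integrable_sample_sigma2: "integrable M (\<lambda>w. sample_sigma2 (\<lambda>t. u t w) n)"
    and integral_sample_sigma2_le: "(\<integral>w. sample_sigma2 (\<lambda>t. u t w) n \<partial>M) \<le> m"
proof -
  have i: "integrable M (\<lambda>w. (norm (u t w))\<^sup>2)" for t
    using integrable_norm2[of t t] by (simp add: power2_eq_square)
  show "integrable M (\<lambda>w. sample_sigma2 (\<lambda>t. u t w) n)"
    unfolding sample_sigma2_def by (intro integrable_mult_right Bochner_Integration.integrable_sum i)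
  have "(\<integral>w. sample_sigma2 (\<lambda>t. u t w) n \<partial>M) = (1 / real n) * (\<Sum>t=1..int n. \<integral>w. (norm (u t w))\<^sup>2 \<partial>M)"
    unfolding sample_sigma2_def using i by (simp add: Bochner_Integration.integral_sum)
  also have "\<dots> \<le> (1 / real n) * (\<Sum>t=1..int n. m)" by (intro mult_left_mono sum_mono m) auto
  also have "\<dots> \<le> m" using m by simp
  finally show "(\<integral>w. sample_sigma2 (\<lambda>t. u t w) n \<partial>M) \<le> m" .
qed

end

section \<open>Limits of the parts of the statistic\<close>

locale test_setting = centered_stationary M u + kernel k p \<alpha>
  for M :: "'w measure" and u :: "int \<Rightarrow> 'w \<Rightarrow> 'a::{real_inner,banach,second_countable_topology}"
    and k :: "real \<Rightarrow> real" and p :: "nat \<Rightarrow> real" and \<alpha> :: real +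
  assumes autocov_summable: "(\<Sum>\<^sub>\<infinity>j. (nuclear_norm (hs_blinfun (autocov M u j)))\<^sup>2) < \<infinity>"
    and cumulant_summable: "(SUP j. \<Sum>\<^sub>\<infinity>h. nuclear_norm (cumulant_operator M u (h + j) h j)) < \<infinity>"
begin

abbreviation sample_C :: "nat \<Rightarrow> nat \<Rightarrow> 'w \<Rightarrow> ('a, 'a) hs"
  where "sample_C n j w \<equiv> sample_autocov (\<lambda>t. u t w) n (int j)"

text \<open>As a Euclidean norm over the lags, the root differs from its noiseless counterpart by at
  most the norm of the deviations; squares would produce cross terms.\<close>

definition root_Q2 :: "nat \<Rightarrow> 'w \<Rightarrow> real" where
  "root_Q2 n w = L2_set (\<lambda>j. \<bar>k (real j / p n)\<bar> * norm (sample_C n j w)) {1..n-1}"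

lemma borel_measurable_root_Q2 [measurable]: "root_Q2 n \<in> borel_measurable M"
  unfolding root_Q2_def L2_set_def by measurable

lemma sample_Q2_root: "n \<ge> 1 \<Longrightarrow> sample_Q2 k (p n) (\<lambda>t. u t w) n / 2 = (root_Q2 n w)\<^sup>2"
  by (simp add: sample_Q2_eq[OF _ k0 k_sym] root_Q2_def L2_set_def sum_nonneg power_mult_distrib)

text \<open>\<open>x n\<close> is the same norm with every estimator replaced by its mean, and
  converges by Tannery's theorem. \<open>Y n\<close> collects the squared deviations; its mean is at
  most \<open>B * B' * (p n / n)\<close>.\<close>

lemma root_Q2_limit: "tendsto_in_probability M root_Q2 (sqrt (population_Q2 M u / 2))"
proof -
  obtain B where B: "0 \<le> B"
    and iV: "\<And>n j. 0 \<le> j \<Longrightarrow> j < int n \<Longrightarrow>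
      integrable M (\<lambda>w. (norm (sample_autocov (\<lambda>t. u t w) n j - (1 - of_int j / real n) *\<^sub>R C j))\<^sup>2)"
    and V: "\<And>n j. 0 \<le> j \<Longrightarrow> j < int n \<Longrightarrow>
      (\<integral>w. (norm (sample_autocov (\<lambda>t. u t w) n j - (1 - of_int j / real n) *\<^sub>R C j))\<^sup>2 \<partial>M) \<le> B / real n"
    using sample_autocov_mean_square_bound[OF autocov_summable cumulant_summable] by metis
  obtain B' where B': "B' \<ge> 0" "\<And>n N. n \<ge> 1 \<Longrightarrow> (\<Sum>j=1..N. (k (real j / p n))\<^sup>2) \<le> p n * B'"
    using sum_k_square_bound by blast
  define x where "x n = L2_set (\<lambda>j. \<bar>k (real j / p n)\<bar> * ((1 - real j / real n) * norm (C (int j)))) {1..n-1}" for n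
  define Y where "Y n w = (\<Sum>j=1..n-1. (k (real j / p n))\<^sup>2 *
      (norm (sample_C n j w - (1 - of_int (int j) / real n) *\<^sub>R C (int j)))\<^sup>2)" for n w
  show ?thesis
  proof (rule tendsto_in_probability_square_bound[where x = x and Y = Y])
    show "prob_space M" by (rule prob_space_axioms)
    have sq: "(x n)\<^sup>2 = (\<Sum>j=1..n-1. ((k (real j / p n))\<^sup>2 * (1 - real j / real n)\<^sup>2) * (norm (C (int j)))\<^sup>2)" for n
      by (simp add: x_def L2_set_def sum_nonneg power_mult_distrib mult.assoc)
    have "(\<lambda>n. \<Sum>j=1..n-1. ((k (real j / p n))\<^sup>2 * (1 - real j / real n)\<^sup>2) * (norm (C (int j)))\<^sup>2) \<longlonglongrightarrow> population_Q2 M u / 2"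
    proof (rule weighted_sum_limit)
      show "(\<lambda>n. \<Sum>j=1..n. (norm (C (int j)))\<^sup>2) \<longlonglongrightarrow> population_Q2 M u / 2"
        using tendsto_divide[OF population_Q2_limit[OF autocov_summable] tendsto_const[of 2]] by simp
      show "\<bar>(k (real j / p n))\<^sup>2 * (1 - real j / real n)\<^sup>2\<bar> \<le> 1" if "1 \<le> j" "j \<le> n" for n j
      proof -
        have "(1 - real j / real n)\<^sup>2 \<le> 1" using that by (intro power_le_one) (auto simp: divide_le_eq_1)
        then show ?thesis using k_square_le_1[of "real j / p n"] by (simp add: mult_le_one)
      qed
      show "(\<lambda>n. (k (real j / p n))\<^sup>2 * (1 - real j / real n)\<^sup>2) \<longlonglongrightarrow> 1" for j
      proof -
        have "(\<lambda>n. real j / p n) \<longlonglongrightarrow> 0"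
          by (rule tendsto_divide_0[OF tendsto_const]) (use p_top in \<open>simp add: filterlim_at_top_imp_at_infinity\<close>)
        from isCont_tendsto_compose[OF k_cont0 this] have 1: "(\<lambda>n. k (real j / p n)) \<longlonglongrightarrow> 1" by (simp add: k0)
        have 2: "(\<lambda>n. real j / real n) \<longlonglongrightarrow> 0" by (rule lim_const_over_n)
        have "(\<lambda>n. (k (real j / p n))\<^sup>2 * (1 - real j / real n)\<^sup>2) \<longlonglongrightarrow> 1\<^sup>2 * (1 - 0)\<^sup>2"
          by (intro tendsto_intros 1 2)
        then show ?thesis by simp
      qed
    qed simp
    from tendsto_real_sqrt[OF this[folded sq]] show "x \<longlonglongrightarrow> sqrt (population_Q2 M u / 2)"
      by (simp add: x_def[abs_def] L2_set_nonneg)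
    have iY: "integrable M (\<lambda>w. (k (real j / p n))\<^sup>2 * (norm (sample_C n j w - (1 - of_int (int j) / real n) *\<^sub>R C (int j)))\<^sup>2)"
      if "j \<in> {1..n-1}" for n j using that by (intro integrable_mult_right iV) auto
    then show "integrable M (Y n)" for n
      unfolding Y_def by (intro Bochner_Integration.integrable_sum)
    show "(root_Q2 n w - x n)\<^sup>2 \<le> Y n w" if n: "n \<ge> 1" for n w
    proof -
      let ?h = "\<lambda>j. \<bar>k (real j / p n)\<bar> * norm (sample_C n j w - (1 - of_int (int j) / real n) *\<^sub>R C (int j))"
      have "\<bar>root_Q2 n w - x n\<bar> \<le> L2_set ?h {1..n-1}"
        unfolding root_Q2_def x_def
      proof (rule L2_set_diff_le)
        fix j assume j: "j \<in> {1..n-1}"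
        then have j1: "0 \<le> 1 - real j / real n" by (auto simp: divide_le_eq_1)
        then show "0 \<le> \<bar>k (real j / p n)\<bar> * ((1 - real j / real n) * norm (C (int j)))" by simp
        have "\<bar>norm (sample_C n j w) - norm ((1 - real j / real n) *\<^sub>R C (int j))\<bar> \<le>
            norm (sample_C n j w - (1 - real j / real n) *\<^sub>R C (int j))" by (rule norm_triangle_ineq3)
        then show "\<bar>\<bar>k (real j / p n)\<bar> * norm (sample_C n j w) - \<bar>k (real j / p n)\<bar> * ((1 - real j / real n) * norm (C (int j)))\<bar> \<le> ?h j"
          using j1 by (simp add: abs_mult mult_left_mono flip: right_diff_distrib)
      qed simp
      then have "\<bar>root_Q2 n w - x n\<bar>\<^sup>2 \<le> (L2_set ?h {1..n-1})\<^sup>2" by (intro power_mono) auto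
      also have "\<dots> = Y n w" by (simp add: L2_set_def Y_def sum_nonneg power_mult_distrib)
      finally show ?thesis by simp
    qed
    have EY: "(\<integral>w. Y n w \<partial>M) \<le> B * B' * (p n / real n)" if n: "n \<ge> 1" for n
    proof -
      have "(\<integral>w. Y n w \<partial>M) = (\<Sum>j=1..n-1. (k (real j / p n))\<^sup>2 *
          (\<integral>w. (norm (sample_C n j w - (1 - of_int (int j) / real n) *\<^sub>R C (int j)))\<^sup>2 \<partial>M))"
        unfolding Y_def using iY by (subst Bochner_Integration.integral_sum) auto
      also have "\<dots> \<le> (\<Sum>j=1..n-1. (k (real j / p n))\<^sup>2 * (B / real n))"
        by (intro sum_mono mult_left_mono V) auto
      also have "\<dots> = (\<Sum>j=1..n-1. (k (real j / p n))\<^sup>2) * (B / real n)"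
        by (simp only: sum_distrib_right)
      also have "\<dots> \<le> p n * B' * (B / real n)"
        using B by (intro mult_right_mono B'(2)[OF n]) auto
      finally show ?thesis by (simp add: mult_ac)
    qed
    show "(\<lambda>n. \<integral>w. Y n w \<partial>M) \<longlonglongrightarrow> 0"
    proof (rule tendsto_sandwich[OF _ _ tendsto_const])
      show "\<forall>\<^sub>F n in sequentially. 0 \<le> (\<integral>w. Y n w \<partial>M)"
        unfolding Y_def by (intro always_eventually allI integral_nonneg_AE AE_I2 sum_nonneg) auto
      show "\<forall>\<^sub>F n in sequentially. (\<integral>w. Y n w \<partial>M) \<le> B * B' * (p n / real n)"
        using eventually_ge_at_top[of 1] by eventually_elim (rule EY)
      show "(\<lambda>n. B * B' * (p n / real n)) \<longlonglongrightarrow> 0"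
        using tendsto_mult[OF tendsto_const[of "B * B'"] p_small] by simp
    qed
  qed
qed

lemma norm_sample_autocov_limit:
  "tendsto_in_probability M (\<lambda>n w. norm (sample_C n 0 w)) (norm (C 0))"
proof -
  obtain B where
    iV: "\<And>n j. 0 \<le> j \<Longrightarrow> j < int n \<Longrightarrow>
      integrable M (\<lambda>w. (norm (sample_autocov (\<lambda>t. u t w) n j - (1 - of_int j / real n) *\<^sub>R C j))\<^sup>2)"
    and V: "\<And>n j. 0 \<le> j \<Longrightarrow> j < int n \<Longrightarrow>
      (\<integral>w. (norm (sample_autocov (\<lambda>t. u t w) n j - (1 - of_int j / real n) *\<^sub>R C j))\<^sup>2 \<partial>M) \<le> B / real n"
    using sample_autocov_mean_square_bound[OF autocov_summable cumulant_summable] by metis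
  show ?thesis
  proof (rule tendsto_in_probability_square_bound[where x = "\<lambda>n. norm (C 0)" and Y = "\<lambda>n w. (norm (sample_C n 0 w - C 0))\<^sup>2"])
    show "prob_space M" by (rule prob_space_axioms)
    show "integrable M (\<lambda>w. (norm (sample_C n 0 w - C 0))\<^sup>2)" if "n \<ge> 1" for n
      using iV[of 0 n] that by simp
    show "(norm (sample_C n 0 w) - norm (C 0))\<^sup>2 \<le> (norm (sample_C n 0 w - C 0))\<^sup>2" for n w
      using power_mono[OF norm_triangle_ineq3[of "sample_C n 0 w" "C 0"], of 2] by simp
    show "(\<lambda>n. \<integral>w. (norm (sample_C n 0 w - C 0))\<^sup>2 \<partial>M) \<longlonglongrightarrow> 0"
    proof (rule tendsto_sandwich[OF _ _ tendsto_const])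
      show "\<forall>\<^sub>F n in sequentially. (\<integral>w. (norm (sample_C n 0 w - C 0))\<^sup>2 \<partial>M) \<le> B / real n"
        using eventually_ge_at_top[of 1]
      proof eventually_elim
        fix n :: nat assume "1 \<le> n"
        then show "(\<integral>w. (norm (sample_C n 0 w - C 0))\<^sup>2 \<partial>M) \<le> B / real n" using V[of 0 n] by simp
      qed
      show "(\<lambda>n. B / real n) \<longlonglongrightarrow> 0" by (rule lim_const_over_n)
    qed simp
  qed simp
qed

text \<open>The square roots reduce the claim to a first moment: the square of this term has mean at
  most \<open>m\<close> times a null sequence. Its fourth power is the centering part of the
  numerator divided by \<open>n\<close>.\<close>

lemma centering_term_limit:
  "tendsto_in_probability M (\<lambda>n w. sqrt (sample_sigma2 (\<lambda>t. u t w) n * sqrt (centering k (p n) n / real n))) 0"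
proof -
  obtain m where m: "0 \<le> m" "\<And>t. (\<integral>w. (norm (u t w))\<^sup>2 \<partial>M) \<le> m"
    using second_moment_bounded[OF autocov_summable cumulant_summable] by blast
  define c where "c n = sqrt (centering k (p n) n / real n)" for n
  have c0: "0 \<le> c n" for n by (simp add: c_def centering_nonneg)
  have s0: "0 \<le> sample_sigma2 x n" for x :: "int \<Rightarrow> 'a" and n by (simp add: sample_sigma2_def sum_nonneg)
  have "c \<longlonglongrightarrow> sqrt 0" unfolding c_def by (intro tendsto_real_sqrt centering_limit)
  then have c: "c \<longlonglongrightarrow> 0" by simp
  show ?thesis
    unfolding c_def[symmetric]
  proof (rule tendsto_in_probability_square_bound[where x = "\<lambda>n. 0" and Y = "\<lambda>n w. sample_sigma2 (\<lambda>t. u t w) n * c n"])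
    show "prob_space M" by (rule prob_space_axioms)
    show "integrable M (\<lambda>w. sample_sigma2 (\<lambda>t. u t w) n * c n)" for n
      by (intro integrable_mult_left integrable_sample_sigma2[OF m])
    show "(sqrt (sample_sigma2 (\<lambda>t. u t w) n * c n) - 0)\<^sup>2 \<le> sample_sigma2 (\<lambda>t. u t w) n * c n" for n w
      using c0 s0 by simp
    show "(\<lambda>n. \<integral>w. sample_sigma2 (\<lambda>t. u t w) n * c n \<partial>M) \<longlonglongrightarrow> 0"
    proof (rule tendsto_sandwich[OF _ _ tendsto_const])
      show "\<forall>\<^sub>F n in sequentially. 0 \<le> (\<integral>w. sample_sigma2 (\<lambda>t. u t w) n * c n \<partial>M)"
        by (intro always_eventually allI integral_nonneg_AE AE_I2 mult_nonneg_nonneg s0 c0)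
      show "\<forall>\<^sub>F n in sequentially. (\<integral>w. sample_sigma2 (\<lambda>t. u t w) n * c n \<partial>M) \<le> m * c n"
        by (intro always_eventually allI) (simp add: mult_right_mono integral_sample_sigma2_le[OF m] c0)
      show "(\<lambda>n. m * c n) \<longlonglongrightarrow> 0" using tendsto_mult[OF tendsto_const[of m] c] by simp
    qed
  qed simp
qed

theorem test_statistic_limit:
  assumes C0: "autocov M u 0 \<noteq> 0"
  shows "tendsto_in_probability M
    (\<lambda>n w. p n powr (1 / 2) / real n * test_statistic k (p n) (\<lambda>t. u t w) n)
    ((population_Q2 M u / 2) /
      ((norm (autocov M u 0))\<^sup>2 * (2 * (LINT z:{0..}|lborel. k z ^ 4)) powr (1 / 2)))"
proof -
  define D where "D = (LINT z:{0..}|lborel. k z ^ 4)"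
  define S where "S n w = sqrt (sample_sigma2 (\<lambda>t. u t w) n * sqrt (centering k (p n) n / real n))" for n w
  define s where "s n = sqrt (2 * (scaling k (p n) n / p n))" for n
  define q where "q = sqrt (population_Q2 M u / 2)"
  note P = prob_space_axioms
  have [measurable]: "S n \<in> borel_measurable M" for n
    unfolding S_def sample_sigma2_def by measurable
  have [measurable]: "(\<lambda>w. norm (sample_C n 0 w)) \<in> borel_measurable M" for n by simp
  have "s \<longlonglongrightarrow> sqrt (2 * D)" unfolding s_def D_def by (intro tendsto_intros scaling_limit)
  note s = tendsto_in_probability_deterministic[OF P this]
  have D_pos: "0 < D" unfolding D_def by (rule integral_k_power4_pos)
  \<comment> \<open>Needed for squaring to undo the root in \<open>q\<close>.\<close>
  have "0 \<le> population_Q2 M u"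
    by (rule LIMSEQ_le_const[OF population_Q2_limit[OF autocov_summable]]) (simp add: sum_nonneg)
  then have q: "q\<^sup>2 = population_Q2 M u / 2" by (simp add: q_def)
  have S: "tendsto_in_probability M S 0" unfolding S_def[abs_def] by (rule centering_term_limit)
  have num: "tendsto_in_probability M (\<lambda>n w. (root_Q2 n w)\<^sup>2 - S n w ^ 4) (q\<^sup>2 - 0 ^ 4)"
    by (rule tendsto_in_probability_continuous2[where f = "\<lambda>x y. x\<^sup>2 - y ^ 4", OF P _ _ root_Q2_limit[folded q_def] S])
      (auto intro!: continuous_intros)
  have quot: "tendsto_in_probability M (\<lambda>n w. ((root_Q2 n w)\<^sup>2 - S n w ^ 4) / (norm (sample_C n 0 w))\<^sup>2) ((q\<^sup>2 - 0 ^ 4) / (norm (C 0))\<^sup>2)"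
    by (rule tendsto_in_probability_continuous2[where f = "\<lambda>x y. x / y\<^sup>2", OF P _ _ num norm_sample_autocov_limit])
      (use C0 in \<open>auto intro!: continuous_intros\<close>)
  have lim: "tendsto_in_probability M
      (\<lambda>n w. ((root_Q2 n w)\<^sup>2 - S n w ^ 4) / (norm (sample_C n 0 w))\<^sup>2 / s n) ((q\<^sup>2 - 0 ^ 4) / (norm (C 0))\<^sup>2 / sqrt (2 * D))"
    by (rule tendsto_in_probability_continuous2[where f = "\<lambda>x y. x / y", OF P _ _ quot s])
      (use D_pos in \<open>auto intro!: continuous_intros\<close>)
  have val: "(q\<^sup>2 - 0 ^ 4) / (norm (C 0))\<^sup>2 / sqrt (2 * D) =
      (population_Q2 M u / 2) / ((norm (C 0))\<^sup>2 * (2 * D) powr (1 / 2))"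
    using D_pos by (simp add: q powr_half_sqrt)
  \<comment> \<open>The normalizing factor is split: \<open>1 / n\<close> goes to the numerator, and
    the root of \<open>p n\<close> turns the root of the scaling into that of the scaling over
    \<open>p n\<close>.\<close>
  have stat: "((root_Q2 n w)\<^sup>2 - S n w ^ 4) / (norm (sample_C n 0 w))\<^sup>2 / s n =
      p n powr (1 / 2) / real n * test_statistic k (p n) (\<lambda>t. u t w) n" if n: "n \<ge> 1" for n w
  proof -
    have pn: "p n > 0" using p_pos[OF n] .
    have "S n w ^ 4 = ((S n w)\<^sup>2)\<^sup>2" by simp
    also have "\<dots> = (sample_sigma2 (\<lambda>t. u t w) n * sqrt (centering k (p n) n / real n))\<^sup>2"
      by (simp add: S_def sample_sigma2_def sum_nonneg centering_nonneg)
    also have "\<dots> = (sample_sigma2 (\<lambda>t. u t w) n)\<^sup>2 * centering k (p n) n / real n"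
      by (simp add: power_mult_distrib centering_nonneg)
    finally have S4: "S n w ^ 4 = (sample_sigma2 (\<lambda>t. u t w) n)\<^sup>2 * centering k (p n) n / real n" .
    have num: "(root_Q2 n w)\<^sup>2 - S n w ^ 4 =
        (real n * sample_Q2 k (p n) (\<lambda>t. u t w) n / 2 - (sample_sigma2 (\<lambda>t. u t w) n)\<^sup>2 * centering k (p n) n) / real n"
      unfolding S4 sample_Q2_root[OF n, symmetric] using n by (simp add: diff_divide_distrib)
    have den: "s n = sqrt (2 * scaling k (p n) n) / sqrt (p n)" by (simp add: s_def real_sqrt_divide)
    show ?thesis
      unfolding num den test_statistic_def using pn by (simp add: powr_half_sqrt mult_ac)
  qed
  show ?thesis
    unfolding D_def[symmetric] val[symmetric] by (rule tendsto_in_probability_cong[OF _ lim]) (rule stat)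
qed

end

theorem theorem2:
  fixes M :: "'w measure"
    and u :: "int \<Rightarrow> 'w \<Rightarrow> 'a::{real_inner,banach,second_countable_topology}"
    and k :: "real \<Rightarrow> real" and p :: "nat \<Rightarrow> real" and \<alpha> :: real
  assumes "prob_space M"
    and "\<And>t. u t \<in> borel_measurable M"
    and "fourth_order_stationary M u"
    and "\<And>t. (\<integral>w. u t w \<partial>M) = 0"
    and "autocov M u 0 \<noteq> 0"
    and "(\<Sum>\<^sub>\<infinity>j. (nuclear_norm (hs_blinfun (autocov M u j)))\<^sup>2) < \<infinity>"
    and "(SUP j. \<Sum>\<^sub>\<infinity>h. nuclear_norm (cumulant_operator M u (h + j) h j)) < \<infinity>"
    and "\<And>x. k x \<in> {-1..1}"
    and "\<And>x. k (- x) = k x"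
    and "isCont k 0"
    and "finite {x. \<not> isCont k x}"
    and "k 0 = 1"
    and "\<alpha> > 1 / 2"
    and "k \<in> O[at_top](\<lambda>x. x powr (- \<alpha>))"
    and "\<And>n. n \<ge> 1 \<Longrightarrow> p n > 0"
    and "filterlim p at_top sequentially"
    and "(\<lambda>n. p n / real n) \<longlonglongrightarrow> 0"
  shows "tendsto_in_probability M
    (\<lambda>n w. p n powr (1 / 2) / real n * test_statistic k (p n) (\<lambda>t. u t w) n)
    ((population_Q2 M u / 2) /
      ((norm (autocov M u 0))\<^sup>2 * (2 * (LINT z:{0..}|lborel. k z ^ 4)) powr (1 / 2)))"
proof -
  interpret prob_space M by fact
  interpret test_setting M u k p \<alpha>
    by unfold_locales (use assms in auto)
  show ?thesis by (rule test_statistic_limit) fact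
qed

end
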